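(* Let $M$ be a smooth manifold and let $I\subseteq\mathbb{R}$ be an open interval. Choose $t_0\in I$ and let $\iota\colon M\to I\times M$ be the smooth inclusion $x\mapsto(t_0,x)$. Then each smooth vector bundle $F\to I\times M$ is isomorphic to $I\times\iota^!F\to I\times M$, via an isomorphism of smooth vector bundles over the identity on $I\times M$.
   Context: All manifolds and vector bundles are smooth and real. $\iota^!F\to M$ denotes the pullback vector bundle of $F$ along $\iota$, with fibre $F_{(t_0,x)}$ over $x\in M$. The vector bundle $I\times\iota^!F\to I\times M$ has as fibre over $(t,x)$ the vector space $\{t\}\times F_{(t_0,x)}$ (i.e. it is the pullback of $\iota^!F$ along the projection $I\times M\to M$). *)

theory Defs
  imports "HOL-Analysis.Analysis"
begin

section \<open>Smooth functions on open subsets of \<open>\<real>\<^sup>n\<close>\<close>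

text \<open>
  The space \<open>\<real>\<^sup>n\<close> is the library's \<^const>\<open>Euclidean_space\<close> \<open>n\<close>: the functions
  \<open>nat \<Rightarrow> real\<close> vanishing at all indices \<open>\<ge> n\<close>. The dimension is thus a term, and \<open>n = 0\<close> is
  allowed. A function is of class \<open>C\<^sup>k\<close> on an open set if its partial derivatives of
  order at most \<open>k\<close> exist and are continuous.
\<close>

primrec C_on :: "nat \<Rightarrow> nat \<Rightarrow> (nat \<Rightarrow> real) set \<Rightarrow> ((nat \<Rightarrow> real) \<Rightarrow> real) \<Rightarrow> bool" where
  "C_on 0 n S f \<longleftrightarrow> continuous_map (subtopology (Euclidean_space n) S) euclideanreal f"
| "C_on (Suc k) n S f \<longleftrightarrow>
     continuous_map (subtopology (Euclidean_space n) S) euclideanreal f \<and>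
     (\<forall>i<n. (\<forall>x\<in>S. (\<lambda>t. f (x(i := t))) differentiable (at (x i))) \<and>
            C_on k n S (\<lambda>x. deriv (\<lambda>t. f (x(i := t))) (x i)))"

definition smooth_between ::
    "nat \<Rightarrow> nat \<Rightarrow> (nat \<Rightarrow> real) set \<Rightarrow> ((nat \<Rightarrow> real) \<Rightarrow> (nat \<Rightarrow> real)) \<Rightarrow> bool" where
  "smooth_between n m S f \<longleftrightarrow> (\<forall>j<m. \<forall>k. C_on k n S (\<lambda>x. f x j))"


section \<open>Smooth manifolds\<close>

datatype 'a chart =
  Chart (chart_dom: "'a set") (chart_dim: nat) (chart_map: "'a \<Rightarrow> nat \<Rightarrow> real")

record 'a manifold =
  mtop :: "'a topology"
  atlas :: "'a chart set"

abbreviation points :: "'a manifold \<Rightarrow> 'a set" where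
  "points M \<equiv> topspace (mtop M)"

definition chart_on :: "'a topology \<Rightarrow> 'a chart \<Rightarrow> bool" where
  "chart_on X c \<longleftrightarrow>
     openin X (chart_dom c) \<and>
     openin (Euclidean_space (chart_dim c)) (chart_map c ` chart_dom c) \<and>
     homeomorphic_map (subtopology X (chart_dom c))
       (subtopology (Euclidean_space (chart_dim c)) (chart_map c ` chart_dom c)) (chart_map c)"

definition chart_inv :: "'a chart \<Rightarrow> (nat \<Rightarrow> real) \<Rightarrow> 'a" where
  "chart_inv c = inv_into (chart_dom c) (chart_map c)"

definition smooth_transition :: "'a chart \<Rightarrow> 'a chart \<Rightarrow> bool" where
  "smooth_transition c d \<longleftrightarrow>
     smooth_between (chart_dim c) (chart_dim d) (chart_map c ` (chart_dom c \<inter> chart_dom d))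
       (chart_map d \<circ> chart_inv c)"

text \<open>
  A smooth structure is given by any smooth atlas, not necessarily a maximal one; the notions
  of smooth map and diffeomorphism below depend only on the maximal atlas it generates.
  The dimension is locally constant: it may differ between connected components.
\<close>

definition smooth_manifold :: "'a manifold \<Rightarrow> bool" where
  "smooth_manifold M \<longleftrightarrow>
     Hausdorff_space (mtop M) \<and> second_countable (mtop M) \<and>
     (\<forall>c\<in>atlas M. chart_on (mtop M) c) \<and>
     \<Union>(chart_dom ` atlas M) = points M \<and>
     (\<forall>c\<in>atlas M. \<forall>d\<in>atlas M. smooth_transition c d)"

definition smooth_map :: "'a manifold \<Rightarrow> 'b manifold \<Rightarrow> ('a \<Rightarrow> 'b) \<Rightarrow> bool" where
  "smooth_map M N f \<longleftrightarrow>
     continuous_map (mtop M) (mtop N) f \<and>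
     (\<forall>c\<in>atlas M. \<forall>d\<in>atlas N.
        smooth_between (chart_dim c) (chart_dim d)
          (chart_map c ` (chart_dom c \<inter> f -` chart_dom d))
          (chart_map d \<circ> f \<circ> chart_inv c))"

definition diffeomorphism :: "'a manifold \<Rightarrow> 'b manifold \<Rightarrow> ('a \<Rightarrow> 'b) \<Rightarrow> bool" where
  "diffeomorphism M N f \<longleftrightarrow>
     (\<exists>g. smooth_map M N f \<and> smooth_map N M g \<and>
          (\<forall>x\<in>points M. g (f x) = x) \<and> (\<forall>y\<in>points N. f (g y) = y))"

definition euclidean_manifold :: "nat \<Rightarrow> (nat \<Rightarrow> real) manifold" where
  "euclidean_manifold n =
     \<lparr>mtop = Euclidean_space n, atlas = {Chart (topspace (Euclidean_space n)) n id}\<rparr>"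

definition real_line :: "real manifold" where
  "real_line =
     \<lparr>mtop = euclideanreal, atlas = {Chart UNIV 1 (\<lambda>t i. if i = 0 then t else 0)}\<rparr>"

definition open_submanifold :: "'a manifold \<Rightarrow> 'a set \<Rightarrow> 'a manifold" where
  "open_submanifold M U =
     \<lparr>mtop = subtopology (mtop M) U,
      atlas = (\<lambda>c. Chart (chart_dom c \<inter> U) (chart_dim c) (chart_map c)) ` atlas M\<rparr>"

text \<open>The identification \<open>\<real>\<^sup>n \<times> \<real>\<^sup>m = \<real>\<^sup>n\<^sup>+\<^sup>m\<close>.\<close>

definition vec_append :: "nat \<Rightarrow> (nat \<Rightarrow> real) \<Rightarrow> (nat \<Rightarrow> real) \<Rightarrow> nat \<Rightarrow> real" where
  "vec_append n a b = (\<lambda>i. if i < n then a i else b (i - n))"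

definition product_manifold :: "'a manifold \<Rightarrow> 'b manifold \<Rightarrow> ('a \<times> 'b) manifold" where
  "product_manifold M N =
     \<lparr>mtop = prod_topology (mtop M) (mtop N),
      atlas = {Chart (chart_dom c \<times> chart_dom d) (chart_dim c + chart_dim d)
                 (\<lambda>(x, y). vec_append (chart_dim c) (chart_map c x) (chart_map d y))
               | c d. c \<in> atlas M \<and> d \<in> atlas N}\<rparr>"


section \<open>Smooth vector bundles\<close>

text \<open>
  A real vector space with carrier \<open>V\<close>; \<open>add\<close> and \<open>scl\<close> are only relevant on \<open>V\<close>.
\<close>

definition real_vector_space_on ::
    "'e set \<Rightarrow> ('e \<Rightarrow> 'e \<Rightarrow> 'e) \<Rightarrow> (real \<Rightarrow> 'e \<Rightarrow> 'e) \<Rightarrow> bool" where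
  "real_vector_space_on V add scl \<longleftrightarrow>
     (\<forall>u\<in>V. \<forall>v\<in>V. add u v \<in> V \<and> add u v = add v u) \<and>
     (\<forall>u\<in>V. \<forall>v\<in>V. \<forall>w\<in>V. add (add u v) w = add u (add v w)) \<and>
     (\<exists>z\<in>V. \<forall>v\<in>V. add z v = v \<and> (\<exists>w\<in>V. add v w = z)) \<and>
     (\<forall>a. \<forall>v\<in>V. scl a v \<in> V) \<and>
     (\<forall>v\<in>V. scl 1 v = v) \<and>
     (\<forall>a b. \<forall>v\<in>V. scl a (scl b v) = scl (a * b) v \<and> scl (a + b) v = add (scl a v) (scl b v)) \<and>
     (\<forall>a. \<forall>u\<in>V. \<forall>v\<in>V. scl a (add u v) = add (scl a u) (scl a v))"

text \<open>
  The operations \<open>fib_add\<close> and \<open>fib_scale\<close> are only relevant within one fibre.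
\<close>

record ('b, 'e) vector_bundle =
  base :: "'b manifold"
  total :: "'e manifold"
  proj :: "'e \<Rightarrow> 'b"
  fib_add :: "'e \<Rightarrow> 'e \<Rightarrow> 'e"
  fib_scale :: "real \<Rightarrow> 'e \<Rightarrow> 'e"

definition bundle_over :: "('b, 'e) vector_bundle \<Rightarrow> 'b set \<Rightarrow> 'e set" where
  "bundle_over F U = {v \<in> points (total F). proj F v \<in> U}"

abbreviation fibre :: "('b, 'e) vector_bundle \<Rightarrow> 'b \<Rightarrow> 'e set" where
  "fibre F x \<equiv> bundle_over F {x}"

text \<open>
  \<open>\<Phi>\<close> is a local trivialization of \<open>F\<close> over \<open>U\<close> with typical fibre \<open>\<real>\<^sup>k\<close>.
\<close>

definition local_trivialization ::
    "('b, 'e) vector_bundle \<Rightarrow> 'b set \<Rightarrow> nat \<Rightarrow> ('e \<Rightarrow> 'b \<times> (nat \<Rightarrow> real)) \<Rightarrow> bool" where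
  "local_trivialization F U k \<Phi> \<longleftrightarrow>
     openin (mtop (base F)) U \<and>
     diffeomorphism (open_submanifold (total F) (bundle_over F U))
       (product_manifold (open_submanifold (base F) U) (euclidean_manifold k)) \<Phi> \<and>
     (\<forall>v\<in>bundle_over F U. fst (\<Phi> v) = proj F v) \<and>
     (\<forall>x\<in>U. \<forall>v\<in>fibre F x. \<forall>w\<in>fibre F x.
        snd (\<Phi> (fib_add F v w)) = (\<lambda>i. snd (\<Phi> v) i + snd (\<Phi> w) i)) \<and>
     (\<forall>x\<in>U. \<forall>a. \<forall>v\<in>fibre F x. snd (\<Phi> (fib_scale F a v)) = (\<lambda>i. a * snd (\<Phi> v) i))"

text \<open>The rank is locally constant, and may be zero.\<close>

definition smooth_vector_bundle :: "('b, 'e) vector_bundle \<Rightarrow> bool" where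
  "smooth_vector_bundle F \<longleftrightarrow>
     smooth_manifold (base F) \<and> smooth_manifold (total F) \<and>
     smooth_map (total F) (base F) (proj F) \<and>
     (\<forall>x\<in>points (base F). real_vector_space_on (fibre F x) (fib_add F) (fib_scale F)) \<and>
     (\<forall>x\<in>points (base F). \<exists>U k \<Phi>. x \<in> U \<and> local_trivialization F U k \<Phi>)"

text \<open>
  The pullback \<open>f\<^sup>!F\<close> of \<open>F\<close> along a smooth map \<open>f\<close> from \<open>N\<close> to the base of \<open>F\<close>. Its total space is
  the fibre product \<open>{(y, v). f y = proj F v}\<close> with the subspace topology, so its fibre over
  \<open>y\<close> is \<open>{y} \<times> F\<^sub>f\<^sub>(\<^sub>y\<^sub>)\<close>. Its charts are built from the charts of \<open>N\<close> and the local
  trivializations of \<open>F\<close>.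
\<close>

definition pullback_points ::
    "'a manifold \<Rightarrow> ('a \<Rightarrow> 'b) \<Rightarrow> ('b, 'e) vector_bundle \<Rightarrow> ('a \<times> 'e) set" where
  "pullback_points N f F = {(y, v). y \<in> points N \<and> v \<in> points (total F) \<and> f y = proj F v}"

definition pullback_bundle ::
    "'a manifold \<Rightarrow> ('a \<Rightarrow> 'b) \<Rightarrow> ('b, 'e) vector_bundle \<Rightarrow> ('a, 'a \<times> 'e) vector_bundle" where
  "pullback_bundle N f F =
     \<lparr>base = N,
      total =
        \<lparr>mtop = subtopology (prod_topology (mtop N) (mtop (total F))) (pullback_points N f F),
         atlas =
           {Chart {(y, v) \<in> pullback_points N f F. y \<in> chart_dom c \<and> f y \<in> U}
              (chart_dim c + k)
              (\<lambda>(y, v). vec_append (chart_dim c) (chart_map c y) (snd (\<Phi> v)))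
            | c U k \<Phi>. c \<in> atlas N \<and> local_trivialization F U k \<Phi>}\<rparr>,
      proj = fst,
      fib_add = (\<lambda>(y, v) (y', w). (y, fib_add F v w)),
      fib_scale = (\<lambda>a (y, v). (y, fib_scale F a v))\<rparr>"

definition bundle_isomorphism ::
    "('b, 'e) vector_bundle \<Rightarrow> ('b, 'f) vector_bundle \<Rightarrow> ('e \<Rightarrow> 'f) \<Rightarrow> bool" where
  "bundle_isomorphism F G \<Psi> \<longleftrightarrow>
     diffeomorphism (total F) (total G) \<Psi> \<and>
     (\<forall>v\<in>points (total F). proj G (\<Psi> v) = proj F v) \<and>
     (\<forall>x\<in>points (base F). \<forall>v\<in>fibre F x. \<forall>w\<in>fibre F x.
        \<Psi> (fib_add F v w) = fib_add G (\<Psi> v) (\<Psi> w)) \<and>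
     (\<forall>x\<in>points (base F). \<forall>a. \<forall>v\<in>fibre F x. \<Psi> (fib_scale F a v) = fib_scale G a (\<Psi> v))"

text \<open>Isomorphism of smooth vector bundles over the identity of their common base.\<close>

definition bundle_isomorphic ::
    "('b, 'e) vector_bundle \<Rightarrow> ('b, 'f) vector_bundle \<Rightarrow> bool" where
  "bundle_isomorphic F G \<longleftrightarrow> base F = base G \<and> (\<exists>\<Psi>. bundle_isomorphism F G \<Psi>)"

end

theory Submission
  imports Defs
begin

text \<open>Maps between manifolds are tested on \<^emph>\<open>plots\<close>, germs of smooth maps from open subsets of
  \<open>\<real>\<^sup>m\<close>. A local trivialization of \<open>F\<close> gives smooth linear isomorphisms between the fibres over
  \<open>(s, x)\<close> and \<open>(t, x)\<close> in its domain. Gluing these along the compact interval between \<open>t0\<close>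
  and \<open>t\<close> yields, for every \<open>(t, x)\<close>, such isomorphisms over a box \<open>J \<times> U\<close> with \<open>t0, t \<in> J\<close>.
  Take countably many of these boxes, with bump functions \<open>\<rho>\<^sub>n\<close> supported in them whose plateaus
  cover \<open>I \<times> M\<close>. Starting at \<open>t0\<close>, move in the \<open>n\<close>-th step the fraction \<open>\<rho>\<^sub>n(t, x)\<close> of the
  remaining way to \<open>t\<close>, inside the \<open>n\<close>-th box. Every point of \<open>I \<times> M\<close> has a neighbourhood on which
  all but finitely many steps are trivial, so the composite of the steps is a smooth isomorphism
  from the fibre over \<open>(t0, x)\<close> to that over \<open>(t, x)\<close>. Neither differential equations nor
  partitions of unity are needed.\<close>

section \<open>Calculus on open subsets of Euclidean space\<close>

text \<open>Rank and dimension are only locally constant, so the fibres have no fixed matrix model.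
  Isomorphisms are therefore kept as pairs of mutually inverse maps, and a map on a fibre product is
  called smooth if it sends pairs of plots lying in that fibre product to plots. The target is a
  pullback of a pullback, and the charts of the outer one come from local trivializations of the
  inner one. The inner pullback is therefore equipped with exactly the structure this requires:
  charts that cover, inverse charts that are plots, and local trivializations
  (\<open>charted\<close>, \<open>compatible\<close>, \<open>charted_bundle\<close>). A box has to
  be an interval in time that contains both \<open>t0\<close> and \<open>t\<close>: every
  intermediate position of a point then lies in the same box, whatever the earlier steps did, so the
  transport over the box applies at any stage. Hausdorffness of the base lets bump functions extend
  smoothly by zero; second countability makes the number of steps countable.\<close>

abbreviation (input) Euc :: "nat \<Rightarrow> (nat \<Rightarrow> real) topology" where
  "Euc \<equiv> Euclidean_space"

text \<open>A basic open set of the product topology may also constrain coordinates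
  \<open>\<ge> n\<close>, but there both points vanish. Hence finitely many radii decide, and their
  minimum is a radius for a cube.\<close>

lemma openin_Euclidean_spaceE:
  assumes S: "openin (Euc n) S" and x: "x \<in> S"
  obtains e where "e > 0"
    "\<And>y. y \<in> topspace (Euc n) \<Longrightarrow> (\<And>i. i < n \<Longrightarrow> \<bar>y i - x i\<bar> < e) \<Longrightarrow> y \<in> S"
proof -
  obtain T where T: "openin (powertop_real UNIV) T" and ST: "S = T \<inter> topspace (Euc n)"
    using S unfolding Euclidean_space_def openin_subtopology by auto
  have "x \<in> T" using x ST by auto
  then obtain U where U: "finite {i. U i \<noteq> UNIV}" "\<And>i. openin euclideanreal (U i)" "x \<in> Pi\<^sub>E UNIV U" "Pi\<^sub>E UNIV U \<subseteq> T"
    using T unfolding openin_product_topology_alt by auto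
  have "\<exists>e>0. \<forall>s. \<bar>s - x i\<bar> < e \<longrightarrow> s \<in> U i" for i
    using U(2)[of i] U(3) by (auto simp: open_real PiE_def Pi_def)
  then obtain e where e: "\<And>i. e i > 0" "\<And>i s. \<bar>s - x i\<bar> < e i \<Longrightarrow> s \<in> U i"
    by metis
  \<comment> \<open>The inserted \<open>1\<close> keeps the minimum defined when
    \<open>n = 0\<close>.\<close>
  define d where "d = Min (insert 1 (e ` {..<n}))"
  have d: "d > 0" "\<And>i. i < n \<Longrightarrow> d \<le> e i"
    unfolding d_def by (auto simp: e(1))
  have "y \<in> S" if y: "y \<in> topspace (Euc n)" "\<forall>i<n. \<bar>y i - x i\<bar> < d" for y
  proof -
    have "y i \<in> U i" for i
    proof (cases "i < n")
      case True
      with y d(2)[of i] show ?thesis by (intro e(2)) (meson order_less_le_trans)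
    next
      case False
      then have "y i = x i" using y(1) \<open>x \<in> S\<close> ST by (auto simp: topspace_Euclidean_space)
      with e(1)[of i] show ?thesis by (intro e(2)) auto
    qed
    then show ?thesis using U(4) y(1) ST by auto
  qed
  with d(1) that show ?thesis by blast
qed

lemma fun_upd_topspace_Euclidean:
  "x \<in> topspace (Euc n) \<Longrightarrow> i < n \<Longrightarrow> x(i := t) \<in> topspace (Euc n)"
  by (auto simp: topspace_Euclidean_space)

lemma eventually_fun_upd_in_open:
  assumes "openin (Euc n) S" "x \<in> S" "i < n"
  shows "\<forall>\<^sub>F t in nhds (x i). x(i := t) \<in> S"
proof -
  obtain e where e: "e > 0"
    "\<And>y. y \<in> topspace (Euc n) \<Longrightarrow> (\<And>i. i < n \<Longrightarrow> \<bar>y i - x i\<bar> < e) \<Longrightarrow> y \<in> S"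
    using openin_Euclidean_spaceE[OF assms(1,2)] by blast
  have "x \<in> topspace (Euc n)" using assms openin_subset by blast
  then have "x(i := t) \<in> S" if "dist t (x i) < e" for t
    using that e(1) assms(3) by (intro e(2) fun_upd_topspace_Euclidean) (auto simp: dist_real_def)
  then show ?thesis unfolding eventually_nhds_metric using e(1) by blast
qed

lemma continuous_map_Euclidean_boxE:
  assumes S: "openin (Euc n) S"
    and f: "continuous_map (subtopology (Euc n) S) euclideanreal f"
    and x: "x \<in> S" and e: "e > 0"
  obtains d where "d > 0"
    "\<And>y. y \<in> topspace (Euc n) \<Longrightarrow> (\<And>i. i < n \<Longrightarrow> \<bar>y i - x i\<bar> < d) \<Longrightarrow> y \<in> S \<and> \<bar>f y - f x\<bar> < e"
proof -
  have "openin (subtopology (Euc n) S)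
          {y \<in> topspace (subtopology (Euc n) S). f y \<in> {f x - e<..<f x + e}}"
    by (rule openin_continuous_map_preimage[OF f]) (simp flip: open_openin)
  then have "openin (Euc n)
      {y \<in> topspace (subtopology (Euc n) S). f y \<in> {f x - e<..<f x + e}}"
    using S openin_trans_full by blast
  moreover have "x \<in> {y \<in> topspace (subtopology (Euc n) S). f y \<in> {f x - e<..<f x + e}}"
    using x e openin_subset[OF S] by auto
  ultimately obtain d where "d > 0"
    "\<And>y. y \<in> topspace (Euc n) \<Longrightarrow> (\<And>i. i < n \<Longrightarrow> \<bar>y i - x i\<bar> < d) \<Longrightarrow>
       y \<in> {y \<in> topspace (subtopology (Euc n) S). f y \<in> {f x - e<..<f x + e}}"
    by (rule openin_Euclidean_spaceE) blast
  then show ?thesis using that by (auto simp: abs_diff_less_iff)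
qed

definition partial_deriv :: "nat \<Rightarrow> ((nat \<Rightarrow> real) \<Rightarrow> real) \<Rightarrow> (nat \<Rightarrow> real) \<Rightarrow> real" where
  "partial_deriv i f x = deriv (\<lambda>t. f (x(i := t))) (x i)"

lemma C_on_imp_continuous_map:
  "C_on k n S f \<Longrightarrow> continuous_map (subtopology (Euc n) S) euclideanreal f"
  by (cases k) auto

lemma C_on_SucD:
  assumes "C_on (Suc k) n S f" "i < n"
  shows "C_on k n S (partial_deriv i f)"
    and "x \<in> S \<Longrightarrow> ((\<lambda>t. f (x(i := t))) has_real_derivative partial_deriv i f x) (at (x i))"
  using assms by (auto simp: partial_deriv_def[abs_def] DERIV_deriv_iff_real_differentiable)

text \<open>\<open>C_on\<close> differentiates along whole coordinate lines, so values off
  \<open>S\<close> could interfere. Openness of \<open>S\<close> confines small difference quotients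
  to \<open>S\<close>, and the agreement passes to all partial derivatives.\<close>

lemma C_on_cong:
  assumes S: "openin (Euc n) S" and fg: "\<And>x. x \<in> S \<Longrightarrow> f x = g x" and "C_on k n S f"
  shows "C_on k n S g"
  using assms(3) fg
proof (induction k arbitrary: f g)
  case 0
  then show ?case by (auto elim: continuous_map_eq)
next
  case (Suc k)
  have ev: "\<forall>\<^sub>F t in nhds (x i). f (x(i := t)) = g (x(i := t))" if "i < n" "x \<in> S" for i x
    using eventually_fun_upd_in_open[OF S that(2,1)] by eventually_elim (rule Suc.prems)
  have "continuous_map (subtopology (Euc n) S) euclideanreal g"
    using Suc.prems by (auto elim: continuous_map_eq)
  moreover have "(\<lambda>t. g (x(i := t))) differentiable (at (x i))" if "i < n" "x \<in> S" for i x
  proof -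
    have "(\<lambda>t. f (x(i := t))) differentiable (at (x i))" using Suc.prems(1) that by simp
    then show ?thesis
      unfolding real_differentiable_def using DERIV_cong_ev[OF refl ev[OF that] refl] by simp
  qed
  moreover have "C_on k n S (\<lambda>x. deriv (\<lambda>t. g (x(i := t))) (x i))" if "i < n" for i
  proof (rule Suc.IH)
    show "C_on k n S (\<lambda>x. deriv (\<lambda>t. f (x(i := t))) (x i))" using Suc.prems(1) that by auto
    show "deriv (\<lambda>t. f (x(i := t))) (x i) = deriv (\<lambda>t. g (x(i := t))) (x i)" if "x \<in> S" for x
      by (rule deriv_cong_ev[OF ev[OF \<open>i < n\<close> that] refl])
  qed
  ultimately show ?case by simp
qed

text \<open>Allows the partial derivatives to be supplied as formulas \<open>D i\<close>, so that
  inductions on the order run through differentiation rules rather than through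
  \<open>deriv\<close>.\<close>

lemma C_on_SucI:
  assumes S: "openin (Euc n) S"
    and "continuous_map (subtopology (Euc n) S) euclideanreal f"
    and "\<And>i. i < n \<Longrightarrow> C_on k n S (D i)"
    and D: "\<And>i x. i < n \<Longrightarrow> x \<in> S \<Longrightarrow> ((\<lambda>t. f (x(i := t))) has_real_derivative D i x) (at (x i))"
  shows "C_on (Suc k) n S f"
  unfolding C_on.simps
proof (intro conjI allI impI ballI)
  fix i assume i: "i < n"
  show "C_on k n S (\<lambda>x. deriv (\<lambda>t. f (x(i := t))) (x i))"
    by (rule C_on_cong[OF S _ assms(3)[OF i]]) (simp add: DERIV_imp_deriv[OF D[OF i]])
qed (use assms in \<open>auto simp: real_differentiable_def\<close>)

lemma C_on_subset: "C_on k n S f \<Longrightarrow> T \<subseteq> S \<Longrightarrow> C_on k n T f"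
proof (induction k arbitrary: f)
  case 0
  then show ?case by (auto intro: continuous_map_from_subtopology_mono)
next
  case (Suc k)
  then show ?case by (auto intro: continuous_map_from_subtopology_mono)
qed

lemma C_on_Suc_imp: "C_on (Suc k) n S f \<Longrightarrow> C_on k n S f"
  by (induction k arbitrary: f) auto

text \<open>Order zero is the pasting lemma; higher orders reduce to it because partial derivatives
  are determined point by point. This is the way back from germs to \<open>C_on\<close>.\<close>

lemma C_on_local:
  assumes S: "openin (Euc n) S"
    and "\<And>x. x \<in> S \<Longrightarrow> \<exists>V. openin (Euc n) V \<and> x \<in> V \<and> C_on k n V f"
  shows "C_on k n S f"
  using assms(2)
proof (induction k arbitrary: f)
  case 0
  have "continuous_map (subtopology (Euc n) S) euclideanreal f"
  proof (rule pasting_lemma)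
    let ?I = "{V. openin (Euc n) V \<and> V \<subseteq> S \<and> C_on 0 n V f}"
    show "openin (subtopology (Euc n) S) V" if "V \<in> ?I" for V
      using that by (simp add: openin_open_subtopology[OF S])
    show "continuous_map (subtopology (subtopology (Euc n) S) V) euclideanreal f" if "V \<in> ?I" for V
      using that by (simp add: subtopology_subtopology Int_absorb1)
    show "\<exists>V. V \<in> ?I \<and> x \<in> V \<and> f x = f x" if x: "x \<in> topspace (subtopology (Euc n) S)" for x
    proof -
      from x obtain V where V: "openin (Euc n) V" "x \<in> V" "C_on 0 n V f" using "0.prems" by auto
      then have "V \<inter> S \<in> ?I" using S C_on_subset[OF V(3), of "V \<inter> S"] by auto
      with V x show ?thesis by auto
    qed
  qed auto
  then show ?case by simp
next
  case (Suc k)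
  have "C_on k n S f" by (rule Suc.IH) (blast dest: Suc.prems C_on_Suc_imp)
  then have "continuous_map (subtopology (Euc n) S) euclideanreal f"
    by (rule C_on_imp_continuous_map)
  then show ?case
  proof (rule C_on_SucI[OF S])
    fix i assume i: "i < n"
    show "C_on k n S (partial_deriv i f)" by (rule Suc.IH) (blast dest: Suc.prems C_on_SucD(1)[OF _ i])
    show "((\<lambda>t. f (x(i := t))) has_real_derivative partial_deriv i f x) (at (x i))" if "x \<in> S" for x
      using Suc.prems[OF that] by (blast dest: C_on_SucD(2)[OF _ i])
  qed
qed

lemma C_on_const: "C_on k n S (\<lambda>_. c)"
proof (induction k arbitrary: c)
  case (Suc k)
  then show ?case by auto
qed simp

lemma continuous_map_Euclidean_coordinate:
  "continuous_map (subtopology (Euc n) S) euclideanreal (\<lambda>x. x j)"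
  unfolding Euclidean_space_def
  by (intro continuous_map_from_subtopology continuous_map_product_projection) auto

lemma C_on_coordinate:
  assumes "openin (Euc n) S"
  shows "C_on k n S (\<lambda>x. x j)"
proof (cases k)
  case (Suc l)
  show ?thesis
    unfolding Suc
    by (rule C_on_SucI[OF assms continuous_map_Euclidean_coordinate,
          where D="\<lambda>i x. if i = j then 1 else 0"])
       (auto intro!: C_on_const)
qed (simp add: continuous_map_Euclidean_coordinate)

section \<open>Sums, products, reciprocals and compositions of differentiable functions\<close>

lemma C_on_add:
  assumes S: "openin (Euc n) S" and "C_on k n S f" "C_on k n S g"
  shows "C_on k n S (\<lambda>x. f x + g x)"
  using assms(2,3)
proof (induction k arbitrary: f g)
  case 0
  then show ?case by (auto intro: continuous_map_add)
next
  case (Suc k)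
  show ?case
  proof (rule C_on_SucI[OF S])
    show "continuous_map (subtopology (Euc n) S) euclideanreal (\<lambda>x. f x + g x)"
      using Suc.prems by (intro continuous_map_add) auto
    show "C_on k n S (\<lambda>x. partial_deriv i f x + partial_deriv i g x)" if "i < n" for i
      by (intro Suc.IH C_on_SucD(1)[OF _ that] Suc.prems)
    show "((\<lambda>t. f (x(i := t)) + g (x(i := t))) has_real_derivative partial_deriv i f x + partial_deriv i g x)
            (at (x i))" if "i < n" "x \<in> S" for i x
      using that Suc.prems by (intro DERIV_add C_on_SucD(2))
  qed
qed

lemma C_on_mult:
  assumes S: "openin (Euc n) S" and "C_on k n S f" "C_on k n S g"
  shows "C_on k n S (\<lambda>x. f x * g x)"
  using assms(2,3)
proof (induction k arbitrary: f g)
  case 0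
  then show ?case by (auto intro: continuous_map_real_mult)
next
  case (Suc k)
  show ?case
  proof (rule C_on_SucI[OF S])
    show "continuous_map (subtopology (Euc n) S) euclideanreal (\<lambda>x. f x * g x)"
      using Suc.prems by (intro continuous_map_real_mult) auto
    show "C_on k n S (\<lambda>x. partial_deriv i f x * g x + partial_deriv i g x * f x)" if "i < n" for i
      using Suc.prems by (intro C_on_add[OF S] Suc.IH C_on_SucD(1)[OF _ that]) (auto dest: C_on_Suc_imp simp del: C_on.simps)
    show "((\<lambda>t. f (x(i := t)) * g (x(i := t))) has_real_derivative
            partial_deriv i f x * g x + partial_deriv i g x * f x) (at (x i))"
      if "i < n" "x \<in> S" for i x
      using DERIV_mult[OF C_on_SucD(2)[OF Suc.prems(1) that] C_on_SucD(2)[OF Suc.prems(2) that]]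
      by (simp add: fun_upd_def)
  qed
qed

lemma C_on_sum:
  assumes S: "openin (Euc n) S" and "\<And>a. a \<in> A \<Longrightarrow> C_on k n S (f a)"
  shows "C_on k n S (\<lambda>x. \<Sum>a\<in>A. f a x)"
  using assms(2)
  by (induction A rule: infinite_finite_induct) (auto intro: C_on_add[OF S] C_on_const)

text \<open>The derivative of the reciprocal contains the reciprocal itself, which at one order less
  is covered by the induction hypothesis.\<close>

lemma C_on_inverse:
  assumes S: "openin (Euc n) S" and f0: "\<And>x. x \<in> S \<Longrightarrow> f x \<noteq> 0" and "C_on k n S f"
  shows "C_on k n S (\<lambda>x. inverse (f x))"
  using assms(3)
proof (induction k)
  case 0
  then show ?case using f0 by (auto intro!: continuous_map_real_inverse)
next
  case (Suc k)
  have inv: "C_on k n S (\<lambda>x. inverse (f x))" using Suc C_on_Suc_imp by blast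
  show ?case
  proof (rule C_on_SucI[OF S])
    show "continuous_map (subtopology (Euc n) S) euclideanreal (\<lambda>x. inverse (f x))"
      using inv by (rule C_on_imp_continuous_map)
    show "C_on k n S (\<lambda>x. -1 * (partial_deriv i f x * (inverse (f x) * inverse (f x))))" if "i < n" for i
      using Suc.prems by (intro C_on_mult[OF S] inv C_on_SucD(1)[OF _ that] C_on_const)
    show "((\<lambda>t. inverse (f (x(i := t)))) has_real_derivative
            -1 * (partial_deriv i f x * (inverse (f x) * inverse (f x)))) (at (x i))"
      if "i < n" "x \<in> S" for i x
      using DERIV_inverse_fun[OF C_on_SucD(2)[OF Suc.prems that]] f0[OF that(2)]
      by (simp add: power2_eq_square fun_upd_def)
  qed
qed

text \<open>Continuous partial derivatives give total differentiability: change the coordinates from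
  \<open>x\<close> to \<open>y\<close> one at a time and apply the mean value inequality to each
  change.\<close>

lemma C1_increment:
  assumes T: "openin (Euc n) T" and h: "C_on (Suc 0) n T h" and x: "x \<in> T" and e: "\<eta> > 0"
  obtains d where "d > 0"
    "\<And>y. y \<in> topspace (Euc n) \<Longrightarrow> (\<And>i. i < n \<Longrightarrow> \<bar>y i - x i\<bar> < d) \<Longrightarrow>
       \<bar>h y - h x - (\<Sum>i<n. partial_deriv i h x * (y i - x i))\<bar> \<le> \<eta> * (\<Sum>i<n. \<bar>y i - x i\<bar>)"
proof -
  have "\<exists>d>0. \<forall>y\<in>topspace (Euc n). (\<forall>i<n. \<bar>y i - x i\<bar> < d) \<longrightarrow>
          y \<in> T \<and> \<bar>partial_deriv j h y - partial_deriv j h x\<bar> < \<eta>" if "j < n" for j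
    using continuous_map_Euclidean_boxE[OF T C_on_imp_continuous_map[OF C_on_SucD(1)[OF h that]] x e]
    by metis
  then obtain d0 where d0: "\<And>j. j < n \<Longrightarrow> d0 j > 0"
    "\<And>j y. j < n \<Longrightarrow> y \<in> topspace (Euc n) \<Longrightarrow> (\<forall>i<n. \<bar>y i - x i\<bar> < d0 j) \<Longrightarrow>
          y \<in> T \<and> \<bar>partial_deriv j h y - partial_deriv j h x\<bar> < \<eta>"
    by metis
  define d where "d = Min (insert 1 (d0 ` {..<n}))"
  have d: "d > 0" "\<And>i. i < n \<Longrightarrow> d \<le> d0 i"
    unfolding d_def using d0(1) by auto
  have xE: "x \<in> topspace (Euc n)" using T x openin_subset by blast
  show ?thesis
  proof (rule that[OF d(1)])
    fix y assume y: "y \<in> topspace (Euc n)" and yx: "\<And>i. i < n \<Longrightarrow> \<bar>y i - x i\<bar> < d"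
    \<comment> \<open>Corner points of the path: \<open>p 0 = x\<close>, \<open>p n = y\<close>, and
      \<open>p (Suc j)\<close> differs from \<open>p j\<close> at most in coordinate
      \<open>j\<close>.\<close>
    define p where "p j = (\<lambda>i. if i < j then y i else x i)" for j :: nat
    have step: "\<bar>h (p (Suc j)) - h (p j) - partial_deriv j h x * (y j - x j)\<bar> \<le> \<eta> * \<bar>y j - x j\<bar>"
      if j: "j < n" for j
    proof -
      let ?c = "partial_deriv j h x"
      let ?q = "\<lambda>s. (p j)(j := s)"
      have q: "?q s \<in> T \<and> \<bar>partial_deriv j h (?q s) - ?c\<bar> < \<eta>" if s: "s \<in> ball (x j) d" for s
      proof (rule d0(2)[OF j])
        show "?q s \<in> topspace (Euc n)"
          using xE y j by (auto simp: p_def topspace_Euclidean_space)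
        show "\<forall>i<n. \<bar>?q s i - x i\<bar> < d0 j"
          using s yx d(2)[OF j] d(1) d0(1)[OF j]
          by (auto simp: p_def dist_real_def abs_minus_commute intro: less_le_trans)
      qed
      \<comment> \<open>Subtracting the linear term \<open>?c * s\<close> leaves a function of one
        variable whose derivative is bounded by \<open>\<eta>\<close> on the ball.\<close>
      have "norm ((h (?q (y j)) - ?c * y j) - (h (?q (x j)) - ?c * x j)) \<le> \<eta> * norm (y j - x j)"
      proof (rule field_differentiable_bound[where S="ball (x j) d"])
        show "((\<lambda>s. h (?q s) - ?c * s) has_real_derivative partial_deriv j h (?q s) - ?c)
                (at s within ball (x j) d)" if "s \<in> ball (x j) d" for s
        proof -
          have "((\<lambda>t. h ((?q s)(j := t))) has_real_derivative partial_deriv j h (?q s)) (at ((?q s) j))"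
            using q[OF that] by (intro C_on_SucD(2)[OF h j]) auto
          then have "((\<lambda>t. h (?q t)) has_real_derivative partial_deriv j h (?q s)) (at s)" by simp
          then show ?thesis
            by (intro DERIV_subset[OF DERIV_diff subset_UNIV]) (auto intro!: derivative_eq_intros)
        qed
        show "norm (partial_deriv j h (?q s) - ?c) \<le> \<eta>" if "s \<in> ball (x j) d" for s
          using q[OF that] by auto
      qed (use yx[OF j] d(1) in \<open>auto simp: dist_real_def abs_minus_commute\<close>)
      moreover have "?q (y j) = p (Suc j)" "?q (x j) = p j" by (auto simp: p_def)
      ultimately show ?thesis by (simp add: algebra_simps)
    qed
    have "p n = y" "p 0 = x" using xE y by (auto simp: p_def topspace_Euclidean_space)
    then have "h y - h x - (\<Sum>i<n. partial_deriv i h x * (y i - x i)) =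
        (\<Sum>j<n. h (p (Suc j)) - h (p j) - partial_deriv j h x * (y j - x j))"
      using sum_lessThan_telescope[of "\<lambda>j. h (p j)" n] by (simp add: sum_subtractf)
    also have "\<bar>\<dots>\<bar> \<le> (\<Sum>j<n. \<eta> * \<bar>y j - x j\<bar>)"
      by (rule sum_abs[THEN order_trans], rule sum_mono) (use step in auto)
    finally show "\<bar>h y - h x - (\<Sum>i<n. partial_deriv i h x * (y i - x i))\<bar> \<le> \<eta> * (\<Sum>i<n. \<bar>y i - x i\<bar>)"
      by (simp add: sum_distrib_left)
  qed
qed

text \<open>The increment estimate is divided by \<open>t - s\<close>; its error is
  \<open>\<eta>\<close> times the sum of the difference quotients of the curve, which stays
  bounded.\<close>

lemma C1_chain_rule:
  assumes T: "openin (Euc n) T" and h: "C_on (Suc 0) n T h"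
    and g: "\<forall>\<^sub>F t in nhds s. g t \<in> T"
    and dg: "\<And>i. i < n \<Longrightarrow> ((\<lambda>t. g t i) has_real_derivative d i) (at s)"
  shows "((\<lambda>t. h (g t)) has_real_derivative (\<Sum>i<n. partial_deriv i h (g s) * d i)) (at s)"
  unfolding has_field_derivative_iff
proof -
  let ?q = "\<lambda>i t. (g t i - g s i) / (t - s)"
  let ?c = "\<lambda>i. partial_deriv i h (g s)"
  have gs: "g s \<in> T" using eventually_nhds_x_imp_x[OF g] .
  have q: "((?q i) \<longlongrightarrow> d i) (at s)" if "i < n" for i
    using dg[OF that] by (simp add: has_field_derivative_iff)
  have "((\<lambda>t. (h (g t) - h (g s)) / (t - s) - (\<Sum>i<n. ?c i * ?q i t)) \<longlongrightarrow> 0) (at s)"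
  proof (rule tendstoI)
    fix e :: real assume e: "e > 0"
    \<comment> \<open>Eventual bound for the sum of the absolute difference quotients. The
      \<open>+ 1\<close> makes the bound strict and \<open>K\<close> positive; the factor
      \<open>2\<close> in \<open>e / (2 * K)\<close> below makes the final estimate strict.\<close>
    define K where "K = (\<Sum>i<n. \<bar>d i\<bar>) + 1"
    have K: "K > 0" unfolding K_def by (intro add_nonneg_pos sum_nonneg) auto
    have evK: "\<forall>\<^sub>F t in at s. (\<Sum>i<n. \<bar>?q i t\<bar>) < K"
    proof -
      have "((\<lambda>t. \<Sum>i<n. \<bar>?q i t\<bar>) \<longlongrightarrow> (\<Sum>i<n. \<bar>d i\<bar>)) (at s)"
        by (intro tendsto_sum tendsto_rabs q) auto
      then show ?thesis by (rule order_tendstoD) (simp add: K_def)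
    qed
    from e K have eta: "e / (2 * K) > 0" by simp
    obtain r where r: "r > 0"
      "\<And>y. y \<in> topspace (Euc n) \<Longrightarrow> (\<And>i. i < n \<Longrightarrow> \<bar>y i - g s i\<bar> < r) \<Longrightarrow>
       \<bar>h y - h (g s) - (\<Sum>i<n. ?c i * (y i - g s i))\<bar> \<le> e / (2 * K) * (\<Sum>i<n. \<bar>y i - g s i\<bar>)"
      by (rule C1_increment[OF T h gs eta]) blast
    have "\<forall>\<^sub>F t in at s. \<forall>i\<in>{..<n}. \<bar>g t i - g s i\<bar> < r"
    proof (rule eventually_ball_finite; clarsimp)
      fix i assume "i < n"
      then have "((\<lambda>t. g t i) \<longlongrightarrow> g s i) (at s)"
        using DERIV_isCont[OF dg] by (auto simp: isCont_def)
      from tendstoD[OF this r(1)] show "\<forall>\<^sub>F t in at s. \<bar>g t i - g s i\<bar> < r"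
        by (simp add: dist_real_def)
    qed
    moreover have "\<forall>\<^sub>F t in at s. g t \<in> T" using g by (auto simp: eventually_nhds_conv_at)
    moreover have "\<forall>\<^sub>F t in at s. t \<noteq> s" by (simp add: eventually_at_filter)
    ultimately show "\<forall>\<^sub>F t in at s. dist ((h (g t) - h (g s)) / (t - s) - (\<Sum>i<n. ?c i * ?q i t)) 0 < e"
      using evK
    proof eventually_elim
      case (elim t)
      have "g t \<in> topspace (Euc n)" using elim(2) T openin_subset by blast
      with r(2)[of "g t"] elim(1)
      have "\<bar>h (g t) - h (g s) - (\<Sum>i<n. ?c i * (g t i - g s i))\<bar> \<le> e / (2 * K) * (\<Sum>i<n. \<bar>g t i - g s i\<bar>)"
        by auto
      then have "\<bar>h (g t) - h (g s) - (\<Sum>i<n. ?c i * (g t i - g s i))\<bar> / \<bar>t - s\<bar>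
          \<le> e / (2 * K) * (\<Sum>i<n. \<bar>g t i - g s i\<bar>) / \<bar>t - s\<bar>"
        by (rule divide_right_mono) simp
      also have "\<dots> = e / (2 * K) * (\<Sum>i<n. \<bar>?q i t\<bar>)"
        by (simp add: abs_divide flip: sum_divide_distrib)
      also have "\<dots> \<le> e / (2 * K) * K"
        using elim(4) eta by (intro mult_left_mono) auto
      also have "\<dots> < e" using e K by simp
      finally have "\<bar>(h (g t) - h (g s) - (\<Sum>i<n. ?c i * (g t i - g s i))) / (t - s)\<bar> < e"
        by (simp add: abs_divide)
      then show ?case
        by (simp add: diff_divide_distrib right_diff_distrib sum_divide_distrib dist_real_def)
    qed
  qed
  from tendsto_add[OF this tendsto_sum[of "{..<n}" "\<lambda>i t. ?c i * ?q i t" "\<lambda>i. ?c i * d i", OF tendsto_mult_left[OF q]]]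
  show "((\<lambda>t. (h (g t) - h (g s)) / (t - s)) \<longlongrightarrow> (\<Sum>i<n. ?c i * d i)) (at s)"
    by simp
qed

text \<open>By the chain rule a partial derivative of the composite is a sum of products in which
  partial derivatives of \<open>h\<close> are again composed with \<open>g\<close>. The induction
  therefore varies \<open>h\<close> and keeps \<open>g\<close>.\<close>

lemma C_on_compose:
  assumes S: "openin (Euc m) S" and T: "openin (Euc n) T"
    and h: "C_on k n T h" and g: "\<And>i. i < n \<Longrightarrow> C_on k m S (\<lambda>x. g x i)" and gT: "\<And>x. x \<in> S \<Longrightarrow> g x \<in> T"
  shows "C_on k m S (\<lambda>x. h (g x))"
  using h g
proof (induction k arbitrary: h)
  case 0
  \<comment> \<open>Truncating at \<open>n\<close> makes the componentwise criterion applicable; on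
    \<open>S\<close> it changes nothing, since \<open>g x \<in> T\<close> vanishes beyond
    \<open>n\<close>.\<close>
  have "continuous_map (subtopology (Euc m) S) (Euc n) (\<lambda>x i. if i < n then g x i else 0)"
    using 0 by (auto simp: continuous_map_componentwise_Euclidean_space)
  then have "continuous_map (subtopology (Euc m) S) (Euc n) g"
    by (rule continuous_map_eq)
       (use gT openin_subset[OF T] in \<open>fastforce simp: topspace_Euclidean_space\<close>)
  then have "continuous_map (subtopology (Euc m) S) (subtopology (Euc n) T) g"
    using gT by (auto simp: continuous_map_in_subtopology)
  from continuous_map_compose[OF this] 0 show ?case by (auto simp: o_def)
next
  case (Suc k)
  have gk: "C_on k m S (\<lambda>x. g x i)" if "i < n" for i
    using Suc.prems(2)[OF that] by (rule C_on_Suc_imp)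
  show ?case
  proof (rule C_on_SucI[OF S])
    show "continuous_map (subtopology (Euc m) S) euclideanreal (\<lambda>x. h (g x))"
      by (rule C_on_imp_continuous_map[OF Suc.IH[OF C_on_Suc_imp[OF Suc.prems(1)] gk]])
    show "C_on k m S (\<lambda>x. \<Sum>j<n. partial_deriv j h (g x) * partial_deriv i (\<lambda>x. g x j) x)" if i: "i < m" for i
    proof (intro C_on_sum[OF S] C_on_mult[OF S])
      fix j assume "j \<in> {..<n}"
      then have j: "j < n" by simp
      show "C_on k m S (\<lambda>x. partial_deriv j h (g x))"
        by (rule Suc.IH[OF C_on_SucD(1)[OF Suc.prems(1) j] gk])
      show "C_on k m S (partial_deriv i (\<lambda>x. g x j))"
        by (rule C_on_SucD(1)[OF Suc.prems(2)[OF j] i])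
    qed
    show "((\<lambda>t. h (g (x(i := t)))) has_real_derivative
        (\<Sum>j<n. partial_deriv j h (g x) * partial_deriv i (\<lambda>x. g x j) x)) (at (x i))"
      if i: "i < m" and x: "x \<in> S" for i x
    proof -
      have "C_on (Suc 0) n T h" using Suc.prems(1) by (cases k) auto
      moreover have "\<forall>\<^sub>F t in nhds (x i). g (x(i := t)) \<in> T"
        using eventually_fun_upd_in_open[OF S x i] by eventually_elim (rule gT)
      ultimately show ?thesis
        using C1_chain_rule[OF T, of h "\<lambda>t. g (x(i := t))" "x i" "\<lambda>j. partial_deriv i (\<lambda>x. g x j) x"]
          C_on_SucD(2)[OF Suc.prems(2) i x] by simp
    qed
  qed
qed

subsection \<open>A smooth step function\<close>

text \<open>The family is closed under differentiation up to linear combinations.\<close>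

definition flat_exp :: "nat \<Rightarrow> real \<Rightarrow> real" where
  "flat_exp j t = (if t \<le> 0 then 0 else exp (- inverse t) * inverse t ^ j)"

text \<open>From the right, the substitution \<open>t = inverse u\<close> turns the claim into the
  decay of \<open>u ^ j / exp u\<close>.\<close>

lemma flat_exp_tendsto_0: "(flat_exp j \<longlongrightarrow> 0) (at 0)"
proof (rule filterlim_split_at)
  have "((\<lambda>_. 0) \<longlongrightarrow> 0) (at_left (0::real))" by simp
  then show "(flat_exp j \<longlongrightarrow> 0) (at_left 0)"
    by (rule Lim_transform_eventually) (auto simp: flat_exp_def eventually_at_filter)
  have "((\<lambda>u::real. u ^ j / exp u) \<longlongrightarrow> 0) at_top" by (rule tendsto_power_div_exp_0)
  then have "((\<lambda>u. flat_exp j (inverse u)) \<longlongrightarrow> 0) at_top"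
    by (rule Lim_transform_eventually)
       (auto intro!: eventually_mono[OF eventually_gt_at_top[of 0]] simp: flat_exp_def exp_minus divide_inverse)
  then show "(flat_exp j \<longlongrightarrow> 0) (at_right 0)"
    by (simp add: filterlim_at_right_to_top)
qed

lemma DERIV_flat_exp:
  "(flat_exp j has_real_derivative flat_exp (Suc (Suc j)) t - real j * flat_exp (Suc j) t) (at t)"
proof -
  consider "t < 0" | "t = 0" | "t > 0" by linarith
  then show ?thesis
  proof cases
    case 1
    have "\<forall>\<^sub>F s in nhds t. flat_exp j s = 0"
      using eventually_nhds_in_open[of "{..<0}" t] 1 by (auto simp: flat_exp_def elim: eventually_mono)
    from DERIV_cong_ev[OF refl this refl, of 0] have "(flat_exp j has_real_derivative 0) (at t)" by simp
    with 1 show ?thesis by (simp add: flat_exp_def)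
  next
    case 2
    \<comment> \<open>At zero the difference quotient of \<open>flat_exp j\<close> is
      \<open>flat_exp (Suc j)\<close>, whose limit is already known.\<close>
    have "((\<lambda>s. (flat_exp j s - flat_exp j 0) / (s - 0)) \<longlongrightarrow> 0) (at 0)"
      by (rule Lim_transform_eventually[OF flat_exp_tendsto_0[of "Suc j"]])
         (auto simp: flat_exp_def eventually_at_filter divide_inverse)
    then show ?thesis using 2 by (simp add: has_field_derivative_iff flat_exp_def)
  next
    case 3
    have "\<forall>\<^sub>F s in nhds t. flat_exp j s = exp (- inverse s) * inverse s ^ j"
      using eventually_nhds_in_open[of "{0<..}" t] 3 by (auto simp: flat_exp_def elim: eventually_mono)
    moreover have "((\<lambda>s. exp (- inverse s) * inverse s ^ j) has_real_derivative
        flat_exp (Suc (Suc j)) t - real j * flat_exp (Suc j) t) (at t)"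
    proof -
      have "((\<lambda>s. inverse s ^ j) has_real_derivative - (real j * inverse t ^ Suc j)) (at t)"
        using DERIV_power[OF DERIV_inverse, of t j] 3 by (cases j) (simp_all add: mult_ac)
      moreover have "((\<lambda>s. exp (- inverse s)) has_real_derivative exp (- inverse t) * inverse t ^ 2) (at t)"
        using 3 by (auto intro!: derivative_eq_intros simp: power2_eq_square)
      ultimately show ?thesis
        using DERIV_mult 3 by (fastforce simp: flat_exp_def algebra_simps power2_eq_square)
    qed
    ultimately show ?thesis by (simp add: DERIV_cong_ev[OF refl _ refl])
  qed
qed

text \<open>Differentiation raises the index, so the induction has to treat all \<open>j\<close>
  simultaneously.\<close>

lemma C_on_flat_exp:
  assumes S: "openin (Euc n) S" and "C_on k n S f"
  shows "C_on k n S (\<lambda>x. flat_exp j (f x))"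
  using assms(2)
proof (induction k arbitrary: j)
  case 0
  have "continuous_map euclideanreal euclideanreal (flat_exp j)"
    using DERIV_flat_exp DERIV_isCont continuous_at_imp_continuous_on by (metis continuous_map_iff_continuous2)
  from continuous_map_compose[OF _ this] 0 show ?case by (auto simp: o_def)
next
  case (Suc k)
  have *: "C_on k n S (\<lambda>x. flat_exp j (f x))" for j
    by (rule Suc.IH[OF C_on_Suc_imp[OF Suc.prems]])
  show ?case
  proof (rule C_on_SucI[OF S C_on_imp_continuous_map[OF *]])
    show "C_on k n S (\<lambda>x. (flat_exp (Suc (Suc j)) (f x) + (- real j) * flat_exp (Suc j) (f x)) * partial_deriv i f x)"
      if "i < n" for i
      by (intro C_on_mult[OF S] C_on_add[OF S] * C_on_const C_on_SucD(1)[OF Suc.prems that])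
    show "((\<lambda>t. flat_exp j (f (x(i := t)))) has_real_derivative
        (flat_exp (Suc (Suc j)) (f x) + (- real j) * flat_exp (Suc j) (f x)) * partial_deriv i f x) (at (x i))"
      if "i < n" "x \<in> S" for i x
      using DERIV_chain2[OF DERIV_flat_exp C_on_SucD(2)[OF Suc.prems that]] by (simp add: fun_upd_def)
  qed
qed

text \<open>The standard smooth transition from \<open>0\<close> to \<open>1\<close>. One summand of
  the denominator is positive for \<open>t > 0\<close>, the other for \<open>t < 1\<close>, so the
  quotient is defined everywhere.\<close>

definition smooth_step :: "real \<Rightarrow> real" where
  "smooth_step t = flat_exp 0 t * inverse (flat_exp 0 t + flat_exp 0 (1 - t))"

lemma flat_exp_nonneg: "flat_exp j t \<ge> 0"
  by (simp add: flat_exp_def)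

lemma smooth_step_denominator_pos: "flat_exp 0 t + flat_exp 0 (1 - t) > 0"
proof (cases "t > 0")
  case True
  then have "flat_exp 0 t > 0" by (simp add: flat_exp_def)
  then show ?thesis using flat_exp_nonneg[of 0 "1 - t"] by linarith
next
  case False
  then have "flat_exp 0 (1 - t) > 0" by (simp add: flat_exp_def)
  then show ?thesis using flat_exp_nonneg[of 0 t] by linarith
qed

lemma smooth_step_eq_0: "t \<le> 0 \<Longrightarrow> smooth_step t = 0"
  by (simp add: smooth_step_def flat_exp_def)

lemma smooth_step_eq_1: "t \<ge> 1 \<Longrightarrow> smooth_step t = 1"
  using smooth_step_denominator_pos[of t] by (simp add: smooth_step_def flat_exp_def)

lemma smooth_step_bounds: "0 \<le> smooth_step t" "smooth_step t \<le> 1"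
  using smooth_step_denominator_pos[of t] flat_exp_nonneg[of 0 t] flat_exp_nonneg[of 0 "1 - t"]
  by (auto simp: smooth_step_def divide_simps simp flip: divide_inverse)

lemma C_on_smooth_step:
  assumes S: "openin (Euc n) S" and f: "C_on k n S f"
  shows "C_on k n S (\<lambda>x. smooth_step (f x))"
proof -
  have "C_on k n S (\<lambda>x. 1 + -1 * f x)"
    by (intro C_on_add[OF S] C_on_mult[OF S] C_on_const f)
  then have "C_on k n S (\<lambda>x. 1 - f x)" by simp
  then show ?thesis
    unfolding smooth_step_def
    by (intro C_on_mult[OF S] C_on_inverse[OF S] C_on_add[OF S] C_on_flat_exp[OF S] f)
       (use smooth_step_denominator_pos in \<open>metis less_irrefl\<close>)
qed

section \<open>Germs of smooth functions\<close>

text \<open>One neighbourhood has to serve all orders \<open>k\<close>. Working at a point lets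
  sums, products and compositions shrink their domains silently.\<close>

definition smooth_germ :: "nat \<Rightarrow> ((nat \<Rightarrow> real) \<Rightarrow> real) \<Rightarrow> (nat \<Rightarrow> real) \<Rightarrow> bool" where
  "smooth_germ m g z \<longleftrightarrow> (\<exists>V. openin (Euc m) V \<and> z \<in> V \<and> (\<forall>k. C_on k m V g))"

abbreviation near :: "nat \<Rightarrow> (nat \<Rightarrow> real) \<Rightarrow> (nat \<Rightarrow> real) filter" where
  "near m z \<equiv> nhdsin (Euc m) z"

lemma eventually_near_topspace: "\<forall>\<^sub>F u in near m z. u \<in> topspace (Euc m)"
  unfolding eventually_nhdsin by (metis openin_topspace)

text \<open>At a \<open>z\<close> outside the space \<open>near m z\<close> is the trivial filter,
  under which everything holds eventually; hence the membership assumption.\<close>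

lemma eventually_near_self:
  "\<forall>\<^sub>F u in near m z. P u \<Longrightarrow> z \<in> topspace (Euc m) \<Longrightarrow> P z"
  unfolding eventually_nhdsin by blast

lemma smooth_germ_topspace: "smooth_germ m g z \<Longrightarrow> z \<in> topspace (Euc m)"
  unfolding smooth_germ_def using openin_subset by blast

lemma smooth_germ_cong:
  assumes "smooth_germ m f z" "\<forall>\<^sub>F u in near m z. f u = g u"
  shows "smooth_germ m g z"
proof -
  obtain V where V: "openin (Euc m) V" "z \<in> V" "\<And>k. C_on k m V f"
    using assms(1) unfolding smooth_germ_def by blast
  have "z \<in> topspace (Euc m)" using assms(1) by (rule smooth_germ_topspace)
  then obtain W where W: "openin (Euc m) W" "z \<in> W" "\<And>u. u \<in> W \<Longrightarrow> f u = g u"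
    using assms(2) unfolding eventually_nhdsin by blast
  have VW: "openin (Euc m) (V \<inter> W)" using V W by blast
  have "C_on k m (V \<inter> W) g" for k
    by (rule C_on_cong[OF VW _ C_on_subset[OF V(3)]]) (use W in auto)
  then show ?thesis using VW V W unfolding smooth_germ_def by blast
qed

lemma smooth_germ_const: "z \<in> topspace (Euc m) \<Longrightarrow> smooth_germ m (\<lambda>_. c) z"
  unfolding smooth_germ_def using C_on_const openin_topspace by blast

lemma smooth_germ_coordinate: "z \<in> topspace (Euc m) \<Longrightarrow> smooth_germ m (\<lambda>u. u j) z"
  unfolding smooth_germ_def using C_on_coordinate openin_topspace by blast

lemma smooth_germ_binary:
  assumes "smooth_germ m f z" "smooth_germ m g z"
    and "\<And>k V. openin (Euc m) V \<Longrightarrow> C_on k m V f \<Longrightarrow> C_on k m V g \<Longrightarrow> C_on k m V h"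
  shows "smooth_germ m h z"
proof -
  obtain V where V: "openin (Euc m) V" "z \<in> V" "\<And>k. C_on k m V f"
    using assms(1) unfolding smooth_germ_def by blast
  obtain W where W: "openin (Euc m) W" "z \<in> W" "\<And>k. C_on k m W g"
    using assms(2) unfolding smooth_germ_def by blast
  have VW: "openin (Euc m) (V \<inter> W)" using V W by blast
  have "C_on k m (V \<inter> W) h" for k
    by (intro assms(3) VW C_on_subset[OF V(3)] C_on_subset[OF W(3)]) auto
  then show ?thesis using VW V W unfolding smooth_germ_def by blast
qed

lemma smooth_germ_add:
  "smooth_germ m f z \<Longrightarrow> smooth_germ m g z \<Longrightarrow> smooth_germ m (\<lambda>u. f u + g u) z"
  by (rule smooth_germ_binary[of m f z g]) (auto intro: C_on_add)

lemma smooth_germ_mult: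
  "smooth_germ m f z \<Longrightarrow> smooth_germ m g z \<Longrightarrow> smooth_germ m (\<lambda>u. f u * g u) z"
  by (rule smooth_germ_binary[of m f z g]) (auto intro: C_on_mult)

lemma smooth_germ_diff:
  assumes "smooth_germ m f z" "smooth_germ m g z"
  shows "smooth_germ m (\<lambda>u. f u - g u) z"
  using smooth_germ_add[OF assms(1) smooth_germ_mult[OF smooth_germ_const[of z m "-1"] assms(2)]]
    smooth_germ_topspace[OF assms(1)] by simp

lemma smooth_germ_smooth_step:
  "smooth_germ m f z \<Longrightarrow> smooth_germ m (\<lambda>u. smooth_step (f u)) z"
  by (rule smooth_germ_binary[of m f z f]) (auto intro: C_on_smooth_step)

lemma smooth_germ_sum:
  assumes "z \<in> topspace (Euc m)" "\<And>a. a \<in> A \<Longrightarrow> smooth_germ m (f a) z"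
  shows "smooth_germ m (\<lambda>u. \<Sum>a\<in>A. f a u) z"
  using assms(2)
  by (induction A rule: infinite_finite_induct)
     (auto intro: smooth_germ_add smooth_germ_const assms(1))

lemma smooth_germ_eventually_in_open:
  assumes "smooth_germ m f z" "open U" "f z \<in> U"
  shows "\<forall>\<^sub>F u in near m z. f u \<in> U"
proof -
  obtain V where V: "openin (Euc m) V" "z \<in> V" "C_on 0 m V f"
    using assms(1) unfolding smooth_germ_def by blast
  then have "openin (subtopology (Euc m) V) {u \<in> topspace (subtopology (Euc m) V). f u \<in> U}"
    using assms(2) by (intro openin_continuous_map_preimage) (auto simp flip: open_openin)
  then have "openin (Euc m) {u \<in> topspace (subtopology (Euc m) V). f u \<in> U}"
    using V(1) openin_trans_full by blast
  moreover have "z \<in> {u \<in> topspace (subtopology (Euc m) V). f u \<in> U}"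
    using V assms(3) openin_subset by fastforce
  ultimately show ?thesis unfolding eventually_nhdsin by blast
qed

lemma C_on_smooth_germ:
  assumes "openin (Euc n) T" "x \<in> T" "\<And>k. C_on k n T h"
  shows "smooth_germ n h x"
  using assms unfolding smooth_germ_def by blast

lemma smooth_germ_imp_C_on:
  assumes "openin (Euc n) S" "\<And>x. x \<in> S \<Longrightarrow> smooth_germ n h x"
  shows "C_on k n S h"
  using assms(2) by (intro C_on_local[OF assms(1)]) (auto simp: smooth_germ_def)

lemma smooth_germs_common_open:
  fixes n :: nat
  assumes "z \<in> topspace (Euc m)" "\<And>i. i < n \<Longrightarrow> smooth_germ m (f i) z"
  shows "\<exists>V. openin (Euc m) V \<and> z \<in> V \<and> (\<forall>i<n. \<forall>k. C_on k m V (f i))"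
  using assms(2)
proof (induction n)
  case 0
  then show ?case using assms(1) by auto
next
  case (Suc n)
  then obtain V W where "openin (Euc m) V" "z \<in> V" "\<forall>i<n. \<forall>k. C_on k m V (f i)"
    "openin (Euc m) W" "z \<in> W" "\<forall>k. C_on k m W (f n)"
    unfolding smooth_germ_def by (metis less_Suc_eq)
  then have "openin (Euc m) (V \<inter> W)" "z \<in> V \<inter> W"
    "\<forall>i<Suc n. \<forall>k. C_on k m (V \<inter> W) (f i)"
    by (auto simp: less_Suc_eq intro: C_on_subset)
  then show ?case by blast
qed

text \<open>The germs control only the first \<open>n\<close> coordinates. That the remaining ones
  vanish, i.e. that the values lie in the space at all, enters as \<open>gE\<close>.\<close>

lemma smooth_germs_eventually_in_open:
  assumes T: "openin (Euc n) T" "g z \<in> T"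
    and g: "\<And>i. i < n \<Longrightarrow> smooth_germ m (\<lambda>u. g u i) z"
    and gE: "\<forall>\<^sub>F u in near m z. g u \<in> topspace (Euc n)"
  shows "\<forall>\<^sub>F u in near m z. g u \<in> T"
proof -
  obtain e where e: "e > 0"
    "\<And>y. y \<in> topspace (Euc n) \<Longrightarrow> (\<And>i. i < n \<Longrightarrow> \<bar>y i - g z i\<bar> < e) \<Longrightarrow> y \<in> T"
    using openin_Euclidean_spaceE[OF T(1,2)] by blast
  have "\<forall>\<^sub>F u in near m z. \<forall>i\<in>{..<n}. g u i \<in> ball (g z i) e"
    using e(1) by (intro eventually_ball_finite ballI smooth_germ_eventually_in_open[OF g]) auto
  then show ?thesis
    using gE by eventually_elim (auto intro!: e(2) simp: dist_real_def abs_minus_commute)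
qed

text \<open>\<open>C_on_compose\<close> asks for one open domain on which all coordinates of
  \<open>g\<close> are smooth and which \<open>g\<close> maps into a domain of \<open>h\<close>.
  Finitely many coordinates make such a common domain exist.\<close>

lemma smooth_germ_compose:
  assumes h: "smooth_germ n h (g z)"
    and g: "\<And>i. i < n \<Longrightarrow> smooth_germ m (\<lambda>u. g u i) z"
    and z: "z \<in> topspace (Euc m)"
    and gE: "\<forall>\<^sub>F u in near m z. g u \<in> topspace (Euc n)"
  shows "smooth_germ m (\<lambda>u. h (g u)) z"
proof -
  obtain T where T: "openin (Euc n) T" "g z \<in> T" "\<And>k. C_on k n T h"
    using h unfolding smooth_germ_def by blast
  obtain W where W: "openin (Euc m) W" "z \<in> W" "\<And>u. u \<in> W \<Longrightarrow> g u \<in> T"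
    using z smooth_germs_eventually_in_open[where g=g, OF T(1,2) g gE] unfolding eventually_nhdsin by blast
  have "\<exists>V. openin (Euc m) V \<and> z \<in> V \<and> (\<forall>i<n. \<forall>k. C_on k m V (\<lambda>u. g u i))"
    by (rule smooth_germs_common_open[OF z g])
  then obtain V where V: "openin (Euc m) V" "z \<in> V" "\<And>i k. i < n \<Longrightarrow> C_on k m V (\<lambda>u. g u i)"
    by auto
  have VW: "openin (Euc m) (V \<inter> W)" using V W by blast
  have "C_on k m (V \<inter> W) (\<lambda>u. h (g u))" for k
    by (rule C_on_compose[OF VW T(1) T(3) C_on_subset[OF V(3)]]) (use W in auto)
  then show ?thesis using VW V W unfolding smooth_germ_def by blast
qed

section \<open>Charts and plots\<close>

text \<open>Isolates what can be read off a single chart at a time. Smooth maps and plots can be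
  handled at this level, and it can be verified for pullbacks directly.\<close>

definition charted :: "'a manifold \<Rightarrow> bool" where
  "charted N \<longleftrightarrow> (\<forall>c\<in>atlas N. chart_on (mtop N) c) \<and> \<Union>(chart_dom ` atlas N) = points N"

lemma smooth_manifold_imp_charted: "smooth_manifold N \<Longrightarrow> charted N"
  unfolding smooth_manifold_def charted_def by blast

lemma charted_chart_on: "charted N \<Longrightarrow> c \<in> atlas N \<Longrightarrow> chart_on (mtop N) c"
  unfolding charted_def by blast

lemma charted_chartE:
  assumes "charted N" "p \<in> points N"
  obtains c where "c \<in> atlas N" "p \<in> chart_dom c"
  using assms unfolding charted_def by blast

context
  fixes X :: "'a topology" and c :: "'a chart"
  assumes c: "chart_on X c"
begin

lemma chart_on_openin: "openin X (chart_dom c)"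
  and chart_on_image_openin: "openin (Euc (chart_dim c)) (chart_map c ` chart_dom c)"
  using c unfolding chart_on_def by auto

lemma chart_on_dom_subset: "chart_dom c \<subseteq> topspace X"
  using chart_on_openin openin_subset by blast

lemma chart_map_topspace: "x \<in> chart_dom c \<Longrightarrow> chart_map c x \<in> topspace (Euc (chart_dim c))"
  using chart_on_image_openin openin_subset by blast

lemma chart_on_homeomorphic:
  "homeomorphic_map (subtopology X (chart_dom c))
     (subtopology (Euc (chart_dim c)) (chart_map c ` chart_dom c)) (chart_map c)"
  using c unfolding chart_on_def by auto

lemma inj_on_chart_map: "inj_on (chart_map c) (chart_dom c)"
  using homeomorphic_imp_injective_map[OF chart_on_homeomorphic] chart_on_dom_subset
  by (simp add: Int_absorb1)

lemma chart_inv_chart_map: "x \<in> chart_dom c \<Longrightarrow> chart_inv c (chart_map c x) = x"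
  unfolding chart_inv_def by (rule inv_into_f_f[OF inj_on_chart_map])

lemma chart_on_image_open:
  assumes "openin X W"
  shows "openin (Euc (chart_dim c)) (chart_map c ` (chart_dom c \<inter> W))"
proof -
  have "openin (subtopology X (chart_dom c)) (chart_dom c \<inter> W)"
    using assms by (simp add: openin_subtopology_Int2)
  then have "openin (subtopology (Euc (chart_dim c)) (chart_map c ` chart_dom c))
               (chart_map c ` (chart_dom c \<inter> W))"
    using chart_on_homeomorphic homeomorphic_imp_open_map open_map_def by blast
  then show ?thesis using chart_on_image_openin openin_trans_full by blast
qed

lemma chart_map_continuous:
  "continuous_map (subtopology X (chart_dom c)) (Euc (chart_dim c)) (chart_map c)"
  using homeomorphic_imp_continuous_map[OF chart_on_homeomorphic] continuous_map_in_subtopology by blast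

lemma chart_on_preimage_open:
  assumes "openin (Euc (chart_dim c)) T"
  shows "openin X {x \<in> chart_dom c. chart_map c x \<in> T}"
proof -
  have "openin (subtopology X (chart_dom c)) {x \<in> topspace (subtopology X (chart_dom c)). chart_map c x \<in> T}"
    by (rule openin_continuous_map_preimage[OF chart_map_continuous assms])
  then have "openin X {x \<in> topspace (subtopology X (chart_dom c)). chart_map c x \<in> T}"
    using chart_on_openin openin_trans_full by blast
  moreover have "{x \<in> topspace (subtopology X (chart_dom c)). chart_map c x \<in> T} = {x \<in> chart_dom c. chart_map c x \<in> T}"
    using chart_on_dom_subset by auto
  ultimately show ?thesis by simp
qed

lemma chart_inv_continuous:
  "continuous_map (subtopology (Euc (chart_dim c)) (chart_map c ` chart_dom c)) X (chart_inv c)"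
  unfolding continuous_map_def
proof (intro conjI allI impI)
  have im: "topspace (subtopology (Euc (chart_dim c)) (chart_map c ` chart_dom c)) = chart_map c ` chart_dom c"
    using openin_subset[OF chart_on_image_openin] by auto
  show "chart_inv c \<in> topspace (subtopology (Euc (chart_dim c)) (chart_map c ` chart_dom c)) \<rightarrow> topspace X"
    unfolding im using chart_on_dom_subset by (auto simp: chart_inv_chart_map)
  fix U assume "openin X U"
  then have "openin (Euc (chart_dim c)) (chart_map c ` (chart_dom c \<inter> U))"
    by (rule chart_on_image_open)
  moreover have "{x \<in> chart_map c ` chart_dom c. chart_inv c x \<in> U} = chart_map c ` (chart_dom c \<inter> U)"
    by (auto simp: chart_inv_chart_map)
  ultimately show "openin (subtopology (Euc (chart_dim c)) (chart_map c ` chart_dom c))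
      {x \<in> topspace (subtopology (Euc (chart_dim c)) (chart_map c ` chart_dom c)). chart_inv c x \<in> U}"
    unfolding im by (auto simp: openin_open_subtopology[OF chart_on_image_openin])
qed

end

lemma chart_onI:
  assumes D: "openin X D" and T: "openin (Euc n) T"
    and fg: "\<And>x. x \<in> D \<Longrightarrow> f x \<in> T \<and> g (f x) = x" "\<And>a. a \<in> T \<Longrightarrow> g a \<in> D \<and> f (g a) = a"
    and f: "continuous_map (subtopology X D) (Euc n) f"
    and g: "continuous_map (subtopology (Euc n) T) X g"
  shows "chart_on X (Chart D n f)"
proof -
  have im: "f ` D = T" using fg by (force simp: image_iff)
  have "homeomorphic_maps (subtopology X D) (subtopology (Euc n) T) f g"
    using f g fg openin_subset[OF D] openin_subset[OF T]
    unfolding homeomorphic_maps_def by (auto simp: continuous_map_in_subtopology)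
  then show ?thesis
    unfolding chart_on_def using D T im homeomorphic_map_maps by (auto simp: im)
qed

text \<open>Smoothness of maps into \<open>N\<close> is tested in \<^emph>\<open>all\<close> charts around the image point, so that
  compatibility of the charts is needed only for the plot \<open>chart_inv\<close>.\<close>

definition plot :: "nat \<Rightarrow> 'a manifold \<Rightarrow> ((nat \<Rightarrow> real) \<Rightarrow> 'a) \<Rightarrow> (nat \<Rightarrow> real) \<Rightarrow> bool" where
  "plot m N \<phi> z \<longleftrightarrow> z \<in> topspace (Euc m) \<and> \<phi> z \<in> points N \<and>
     (\<forall>d\<in>atlas N. \<phi> z \<in> chart_dom d \<longrightarrow>
        (\<forall>\<^sub>F u in near m z. \<phi> u \<in> chart_dom d) \<and>
        (\<forall>j<chart_dim d. smooth_germ m (\<lambda>u. chart_map d (\<phi> u) j) z))"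

lemma plot_topspace: "plot m N \<phi> z \<Longrightarrow> z \<in> topspace (Euc m)"
  and plot_points: "plot m N \<phi> z \<Longrightarrow> \<phi> z \<in> points N"
  unfolding plot_def by auto

lemma plot_eventually_chart:
  "plot m N \<phi> z \<Longrightarrow> d \<in> atlas N \<Longrightarrow> \<phi> z \<in> chart_dom d \<Longrightarrow> \<forall>\<^sub>F u in near m z. \<phi> u \<in> chart_dom d"
  and plot_coordinate:
  "plot m N \<phi> z \<Longrightarrow> d \<in> atlas N \<Longrightarrow> \<phi> z \<in> chart_dom d \<Longrightarrow> j < chart_dim d \<Longrightarrow>
     smooth_germ m (\<lambda>u. chart_map d (\<phi> u) j) z"
  unfolding plot_def by auto

lemma plot_cong:
  assumes p: "plot m N \<phi> z" and ev: "\<forall>\<^sub>F u in near m z. \<phi> u = \<psi> u"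
  shows "plot m N \<psi> z"
proof -
  have z: "\<phi> z = \<psi> z" using eventually_near_self[OF ev plot_topspace[OF p]] .
  show ?thesis
    unfolding plot_def
  proof (intro conjI ballI impI allI)
    fix d assume d: "d \<in> atlas N" "\<psi> z \<in> chart_dom d"
    show "\<forall>\<^sub>F u in near m z. \<psi> u \<in> chart_dom d"
      using plot_eventually_chart[OF p d(1)] d(2) z ev by (auto elim: eventually_elim2)
    fix j assume "j < chart_dim d"
    then show "smooth_germ m (\<lambda>u. chart_map d (\<psi> u) j) z"
      using d z by (intro smooth_germ_cong[OF plot_coordinate[OF p]] eventually_mono[OF ev]) auto
  qed (use p z in \<open>auto simp: plot_def\<close>)
qed

text \<open>Continuity of plots: in a chart around the image point, the open set becomes an open set
  of Euclidean space, and injectivity of the chart carries membership back.\<close>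

lemma plot_eventually_in_open:
  assumes N: "charted N" and p: "plot m N \<phi> z" and W: "openin (mtop N) W" "\<phi> z \<in> W"
  shows "\<forall>\<^sub>F u in near m z. \<phi> u \<in> W"
proof -
  obtain d where d: "d \<in> atlas N" "\<phi> z \<in> chart_dom d"
    using N plot_points[OF p] by (rule charted_chartE)
  note c = charted_chart_on[OF N d(1)]
  have ev: "\<forall>\<^sub>F u in near m z. \<phi> u \<in> chart_dom d" using plot_eventually_chart[OF p d] .
  have "\<forall>\<^sub>F u in near m z. chart_map d (\<phi> u) \<in> chart_map d ` (chart_dom d \<inter> W)"
  proof (rule smooth_germs_eventually_in_open[where g="\<lambda>u. chart_map d (\<phi> u)"])
    show "openin (Euc (chart_dim d)) (chart_map d ` (chart_dom d \<inter> W))"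
      using c W(1) by (rule chart_on_image_open)
    show "\<forall>\<^sub>F u in near m z. chart_map d (\<phi> u) \<in> topspace (Euc (chart_dim d))"
      using ev by eventually_elim (rule chart_map_topspace[OF c])
  qed (use d W plot_coordinate[OF p d] in auto)
  with ev show ?thesis
    by eventually_elim (auto dest: inj_onD[OF inj_on_chart_map[OF c]])
qed

lemma smooth_map_points: "smooth_map M N f \<Longrightarrow> x \<in> points M \<Longrightarrow> f x \<in> points N"
  unfolding smooth_map_def by (auto dest: continuous_map_image_subset_topspace)

text \<open>In a target chart the composite is the local expression of \<open>f\<close>, in some
  chart \<open>c\<close> around \<open>\<phi> z\<close>, applied to the coordinates of the plot; so
  it is a composition of smooth germs.\<close>

lemma plot_smooth_map:
  assumes M: "charted M" and N: "charted N" and f: "smooth_map M N f" and p: "plot m M \<phi> z"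
  shows "plot m N (\<lambda>u. f (\<phi> u)) z"
  unfolding plot_def
proof (intro conjI ballI impI allI)
  show "z \<in> topspace (Euc m)" using p by (rule plot_topspace)
  show "f (\<phi> z) \<in> points N" using plot_points[OF p] by (rule smooth_map_points[OF f])
  fix d assume d: "d \<in> atlas N" "f (\<phi> z) \<in> chart_dom d"
  let ?W = "{x \<in> points M. f x \<in> chart_dom d}"
  have cf: "continuous_map (mtop M) (mtop N) f" using f unfolding smooth_map_def by blast
  have W: "openin (mtop M) ?W" "\<phi> z \<in> ?W"
    using openin_continuous_map_preimage[OF cf chart_on_openin[OF charted_chart_on[OF N d(1)]]]
      plot_points[OF p] d(2) by auto
  show "\<forall>\<^sub>F u in near m z. f (\<phi> u) \<in> chart_dom d"
    using plot_eventually_in_open[OF M p W] by eventually_elim auto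
  fix j assume j: "j < chart_dim d"
  obtain c where c: "c \<in> atlas M" "\<phi> z \<in> chart_dom c"
    using M plot_points[OF p] by (rule charted_chartE)
  note cc = charted_chart_on[OF M c(1)]
  let ?T = "chart_map c ` (chart_dom c \<inter> ?W)"
  let ?h = "\<lambda>a. chart_map d (f (chart_inv c a)) j"
  have T: "openin (Euc (chart_dim c)) ?T" by (rule chart_on_image_open[OF cc W(1)])
  have "?T = chart_map c ` (chart_dom c \<inter> f -` chart_dom d)"
    using chart_on_dom_subset[OF cc] by auto
  then have "C_on k (chart_dim c) ?T ?h" for k
    using f c(1) d(1) j unfolding smooth_map_def smooth_between_def by (auto simp: o_def)
  then have h: "smooth_germ (chart_dim c) ?h (chart_map c (\<phi> z))"
    using T W(2) c(2) by (intro C_on_smooth_germ[OF T]) auto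
  have ev: "\<forall>\<^sub>F u in near m z. \<phi> u \<in> chart_dom c" using plot_eventually_chart[OF p c] .
  have "smooth_germ m (\<lambda>u. ?h (chart_map c (\<phi> u))) z"
  proof (rule smooth_germ_compose[where h="?h" and g="\<lambda>u. chart_map c (\<phi> u)", OF h])
    show "\<forall>\<^sub>F u in near m z. chart_map c (\<phi> u) \<in> topspace (Euc (chart_dim c))"
      using ev by eventually_elim (rule chart_map_topspace[OF cc])
  qed (use plot_coordinate[OF p c] plot_topspace[OF p] in auto)
  then show "smooth_germ m (\<lambda>u. chart_map d (f (\<phi> u)) j) z"
    by (rule smooth_germ_cong) (use ev in eventually_elim, simp add: chart_inv_chart_map[OF cc])
qed

text \<open>Inverse charts are enough test plots. They also yield continuity, because plots are
  continuous and chart preimages of open sets are open.\<close>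

lemma smooth_mapI_plots:
  assumes X: "charted X" and Y: "charted Y"
    and p: "\<And>e z. e \<in> atlas X \<Longrightarrow> z \<in> chart_map e ` chart_dom e \<Longrightarrow>
              plot (chart_dim e) Y (\<lambda>u. \<phi> (chart_inv e u)) z"
  shows "smooth_map X Y \<phi>"
proof -
  have cont: "openin (mtop X) {x \<in> points X. \<phi> x \<in> W}" if W: "openin (mtop Y) W" for W
  proof (subst openin_subopen, intro ballI)
    fix x assume x: "x \<in> {x \<in> points X. \<phi> x \<in> W}"
    then obtain e where e: "e \<in> atlas X" "x \<in> chart_dom e" using charted_chartE[OF X] by blast
    note c = charted_chart_on[OF X e(1)]
    have "\<forall>\<^sub>F u in near (chart_dim e) (chart_map e x). \<phi> (chart_inv e u) \<in> W"
      using x e by (intro plot_eventually_in_open[OF Y p W]) (auto simp: chart_inv_chart_map[OF c])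
    then obtain V where V: "openin (Euc (chart_dim e)) V" "chart_map e x \<in> V"
      "\<And>u. u \<in> V \<Longrightarrow> \<phi> (chart_inv e u) \<in> W"
      using chart_map_topspace[OF c e(2)] unfolding eventually_nhdsin by blast
    have "{x \<in> chart_dom e. chart_map e x \<in> V} \<subseteq> {x \<in> points X. \<phi> x \<in> W}"
      using V(3) chart_on_dom_subset[OF c] by (force simp: chart_inv_chart_map[OF c])
    then show "\<exists>T. openin (mtop X) T \<and> x \<in> T \<and> T \<subseteq> {x \<in> points X. \<phi> x \<in> W}"
      using chart_on_preimage_open[OF c V(1)] V(2) e(2) by blast
  qed
  have pts: "\<phi> x \<in> points Y" if x: "x \<in> points X" for x
  proof -
    obtain e where e: "e \<in> atlas X" "x \<in> chart_dom e" using X x by (rule charted_chartE)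
    then show ?thesis
      using plot_points[OF p[OF e(1) imageI[OF e(2)]]] chart_inv_chart_map[OF charted_chart_on[OF X e(1)]]
      by simp
  qed
  show ?thesis
    unfolding smooth_map_def smooth_between_def
  proof (intro conjI ballI allI impI)
    show "continuous_map (mtop X) (mtop Y) \<phi>"
      unfolding continuous_map_def using cont pts by blast
    fix e d j k assume e: "e \<in> atlas X" and d: "d \<in> atlas Y" and j: "j < chart_dim d"
    note c = charted_chart_on[OF X e]
    have *: "chart_dom e \<inter> \<phi> -` chart_dom d = chart_dom e \<inter> {x \<in> points X. \<phi> x \<in> chart_dom d}"
      using chart_on_dom_subset[OF c] by auto
    show "C_on k (chart_dim e) (chart_map e ` (chart_dom e \<inter> \<phi> -` chart_dom d))
            (\<lambda>x. (chart_map d \<circ> \<phi> \<circ> chart_inv e) x j)"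
    proof (rule smooth_germ_imp_C_on)
      show "openin (Euc (chart_dim e)) (chart_map e ` (chart_dom e \<inter> \<phi> -` chart_dom d))"
        unfolding * by (intro chart_on_image_open[OF c] cont chart_on_openin charted_chart_on[OF Y d])
      fix z assume "z \<in> chart_map e ` (chart_dom e \<inter> \<phi> -` chart_dom d)"
      then show "smooth_germ (chart_dim e) (\<lambda>x. (chart_map d \<circ> \<phi> \<circ> chart_inv e) x j) z"
        using plot_coordinate[OF p[OF e] d _ j] by (auto simp: chart_inv_chart_map[OF c])
    qed
  qed
qed

lemma plot_chart_inv:
  assumes N: "smooth_manifold N" and c: "c \<in> atlas N" and z: "z \<in> chart_map c ` chart_dom c"
  shows "plot (chart_dim c) N (chart_inv c) z"
  unfolding plot_def
proof (intro conjI ballI impI allI)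
  have N': "charted N" using N by (rule smooth_manifold_imp_charted)
  note cc = charted_chart_on[OF N' c]
  show "z \<in> topspace (Euc (chart_dim c))" "chart_inv c z \<in> points N"
    using z chart_map_topspace[OF cc] chart_on_dom_subset[OF cc] by (auto simp: chart_inv_chart_map[OF cc])
  fix d assume d: "d \<in> atlas N" "chart_inv c z \<in> chart_dom d"
  let ?S = "chart_map c ` (chart_dom c \<inter> chart_dom d)"
  have S: "openin (Euc (chart_dim c)) ?S"
    by (intro chart_on_image_open[OF cc] chart_on_openin charted_chart_on[OF N' d(1)])
  have zS: "z \<in> ?S" using z d(2) by (auto simp: chart_inv_chart_map[OF cc])
  show "\<forall>\<^sub>F u in near (chart_dim c) z. chart_inv c u \<in> chart_dom d"
    unfolding eventually_nhdsin using S zS by (auto simp: chart_inv_chart_map[OF cc] intro!: exI[of _ ?S])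
  fix j assume j: "j < chart_dim d"
  then have "C_on k (chart_dim c) ?S (\<lambda>u. chart_map d (chart_inv c u) j)" for k
    using N c d(1) unfolding smooth_manifold_def smooth_transition_def smooth_between_def by (auto simp: o_def)
  then show "smooth_germ (chart_dim c) (\<lambda>u. chart_map d (chart_inv c u) j) z"
    using C_on_smooth_germ[OF S zS] by blast
qed

lemma charted_open_submanifold:
  assumes N: "charted N" and U: "openin (mtop N) U"
  shows "charted (open_submanifold N U)"
proof -
  have "chart_on (subtopology (mtop N) U) (Chart (chart_dom c \<inter> U) (chart_dim c) (chart_map c))"
    if c: "c \<in> atlas N" for c
  proof -
    note cc = charted_chart_on[OF N c]
    show ?thesis
    proof (rule chart_onI[where T="chart_map c ` (chart_dom c \<inter> U)" and g="chart_inv c"])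
      show "openin (subtopology (mtop N) U) (chart_dom c \<inter> U)"
        using chart_on_openin[OF cc] U by (simp add: openin_open_subtopology openin_Int)
      show "openin (Euc (chart_dim c)) (chart_map c ` (chart_dom c \<inter> U))"
        by (rule chart_on_image_open[OF cc U])
      show "continuous_map (subtopology (subtopology (mtop N) U) (chart_dom c \<inter> U))
              (Euc (chart_dim c)) (chart_map c)"
        using continuous_map_from_subtopology_mono[OF chart_map_continuous[OF cc], of "chart_dom c \<inter> U"]
        by (simp add: subtopology_subtopology Int_ac)
      show "continuous_map (subtopology (Euc (chart_dim c)) (chart_map c ` (chart_dom c \<inter> U)))
              (subtopology (mtop N) U) (chart_inv c)"
        using continuous_map_from_subtopology_mono[OF chart_inv_continuous[OF cc], of "chart_map c ` (chart_dom c \<inter> U)"]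
        by (auto simp: continuous_map_in_subtopology chart_inv_chart_map[OF cc])
    qed (auto simp: chart_inv_chart_map[OF cc])
  qed
  moreover have "\<Union>(chart_dom ` atlas (open_submanifold N U)) = points N \<inter> U"
    using N unfolding charted_def open_submanifold_def by auto
  ultimately show ?thesis
    unfolding charted_def by (auto simp: open_submanifold_def)
qed

lemma plot_open_submanifold_iff:
  assumes N: "charted N" and U: "openin (mtop N) U"
  shows "plot m (open_submanifold N U) \<phi> z \<longleftrightarrow> plot m N \<phi> z \<and> \<phi> z \<in> U"
proof
  assume p: "plot m (open_submanifold N U) \<phi> z"
  have z: "\<phi> z \<in> points N" "\<phi> z \<in> U" using plot_points[OF p] by (auto simp: open_submanifold_def)
  have "plot m N \<phi> z"
    unfolding plot_def
  proof (intro conjI ballI impI allI)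
    fix d assume d: "d \<in> atlas N" "\<phi> z \<in> chart_dom d"
    let ?d = "Chart (chart_dom d \<inter> U) (chart_dim d) (chart_map d)"
    have d': "?d \<in> atlas (open_submanifold N U)" "\<phi> z \<in> chart_dom ?d"
      using d z by (auto simp: open_submanifold_def)
    show "\<forall>\<^sub>F u in near m z. \<phi> u \<in> chart_dom d"
      using plot_eventually_chart[OF p d'] by eventually_elim auto
    fix j assume "j < chart_dim d"
    then show "smooth_germ m (\<lambda>u. chart_map d (\<phi> u) j) z"
      using plot_coordinate[OF p d'] by auto
  qed (use z plot_topspace[OF p] in auto)
  with z show "plot m N \<phi> z \<and> \<phi> z \<in> U" by blast
next
  assume p: "plot m N \<phi> z \<and> \<phi> z \<in> U"
  then have ev: "\<forall>\<^sub>F u in near m z. \<phi> u \<in> U" using plot_eventually_in_open[OF N _ U] by blast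
  show "plot m (open_submanifold N U) \<phi> z"
    unfolding plot_def
  proof (intro conjI ballI impI allI)
    fix d' assume d': "d' \<in> atlas (open_submanifold N U)" "\<phi> z \<in> chart_dom d'"
    then obtain d where d: "d \<in> atlas N" "d' = Chart (chart_dom d \<inter> U) (chart_dim d) (chart_map d)"
      by (auto simp: open_submanifold_def)
    have dz: "\<phi> z \<in> chart_dom d" using d d' by auto
    show "\<forall>\<^sub>F u in near m z. \<phi> u \<in> chart_dom d'"
      using plot_eventually_chart[OF conjunct1[OF p] d(1) dz] ev by eventually_elim (auto simp: d(2))
    fix j assume "j < chart_dim d'"
    then show "smooth_germ m (\<lambda>u. chart_map d' (\<phi> u) j) z"
      using plot_coordinate[OF conjunct1[OF p] d(1) dz] by (auto simp: d(2))
  qed (use p in \<open>auto simp: open_submanifold_def plot_def\<close>)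
qed

section \<open>Splitting of coordinates; products of manifolds, Euclidean space and the real
  line\<close>

definition vec_take :: "nat \<Rightarrow> (nat \<Rightarrow> real) \<Rightarrow> nat \<Rightarrow> real" where
  "vec_take n a = (\<lambda>i. if i < n then a i else 0)"

definition vec_drop :: "nat \<Rightarrow> (nat \<Rightarrow> real) \<Rightarrow> nat \<Rightarrow> real" where
  "vec_drop n a = (\<lambda>i. a (i + n))"

lemma vec_take_in_Euclidean: "vec_take n a \<in> topspace (Euc n)"
  by (auto simp: vec_take_def topspace_Euclidean_space)

lemma vec_drop_in_Euclidean:
  "a \<in> topspace (Euc (n + k)) \<Longrightarrow> vec_drop n a \<in> topspace (Euc k)"
  by (auto simp: vec_drop_def topspace_Euclidean_space)

lemma vec_append_in_Euclidean:
  "b \<in> topspace (Euc k) \<Longrightarrow> vec_append n a b \<in> topspace (Euc (n + k))"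
  by (auto simp: vec_append_def topspace_Euclidean_space)

lemma vec_take_append: "a \<in> topspace (Euc n) \<Longrightarrow> vec_take n (vec_append n a b) = a"
  by (auto simp: vec_take_def vec_append_def topspace_Euclidean_space fun_eq_iff)

lemma vec_drop_append: "vec_drop n (vec_append n a b) = b"
  by (auto simp: vec_drop_def vec_append_def)

lemma vec_append_take_drop: "vec_append n (vec_take n a) (vec_drop n a) = a"
  by (auto simp: vec_take_def vec_append_def vec_drop_def)

lemma continuous_map_Euclidean_coordinates:
  assumes "\<And>i. i < n \<Longrightarrow> continuous_map X euclideanreal (\<lambda>x. f x i)"
    and "\<And>x. x \<in> topspace X \<Longrightarrow> f x \<in> topspace (Euc n)"
  shows "continuous_map X (Euc n) f"
proof (rule continuous_map_eq)
  show "continuous_map X (Euc n) (\<lambda>x i. if i < n then f x i else 0)"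
    using assms(1) by (simp add: continuous_map_componentwise_Euclidean_space)
  show "(\<lambda>i. if i < n then f x i else 0) = f x" if "x \<in> topspace X" for x
    using assms(2)[OF that] by (auto simp: topspace_Euclidean_space fun_eq_iff)
qed

lemma continuous_map_coordinate:
  "continuous_map X (Euc n) f \<Longrightarrow> continuous_map X euclideanreal (\<lambda>x. f x i)"
  using continuous_map_compose[OF _ continuous_map_Euclidean_coordinate[of n UNIV i]] by (auto simp: o_def)

lemma continuous_map_vec_append:
  assumes "continuous_map X (Euc n) f" "continuous_map X (Euc k) g"
  shows "continuous_map X (Euc (n + k)) (\<lambda>x. vec_append n (f x) (g x))"
proof (rule continuous_map_Euclidean_coordinates)
  show "continuous_map X euclideanreal (\<lambda>x. vec_append n (f x) (g x) i)" for i
    using assms by (cases "i < n") (auto simp: vec_append_def intro: continuous_map_coordinate)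
  show "vec_append n (f x) (g x) \<in> topspace (Euc (n + k))" if "x \<in> topspace X" for x
    using continuous_map_image_subset_topspace[OF assms(2)] that by (intro vec_append_in_Euclidean) auto
qed

lemma continuous_map_vec_take: "continuous_map (Euc (n + k)) (Euc n) (vec_take n)"
  by (rule continuous_map_Euclidean_coordinates)
     (auto simp: topspace_Euclidean_space vec_take_def intro: continuous_map_coordinate[OF continuous_map_id[unfolded id_def]])

lemma continuous_map_vec_drop: "continuous_map (Euc (n + k)) (Euc k) (vec_drop n)"
  by (rule continuous_map_Euclidean_coordinates)
     (auto simp: topspace_Euclidean_space vec_drop_def intro: continuous_map_coordinate[OF continuous_map_id[unfolded id_def]])

lemma openin_vec_product:
  assumes "openin (Euc n) S" "openin (Euc k) T"
  shows "openin (Euc (n + k))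
    {a \<in> topspace (Euc (n + k)). vec_take n a \<in> S \<and> vec_drop n a \<in> T}"
  using openin_Int[OF openin_continuous_map_preimage[OF continuous_map_vec_take assms(1)]
      openin_continuous_map_preimage[OF continuous_map_vec_drop assms(2)]]
  by (rule back_subst[where P="openin _"]) auto

abbreviation prod_chart :: "'a chart \<Rightarrow> 'b chart \<Rightarrow> ('a \<times> 'b) chart" where
  "prod_chart c d \<equiv> Chart (chart_dom c \<times> chart_dom d) (chart_dim c + chart_dim d)
     (\<lambda>(x, y). vec_append (chart_dim c) (chart_map c x) (chart_map d y))"

lemma points_product_manifold [simp]: "points (product_manifold M N) = points M \<times> points N"
  by (simp add: product_manifold_def)

lemma charted_product_manifold:
  assumes M: "charted M" and N: "charted N"
  shows "charted (product_manifold M N)"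
proof -
  have "chart_on (prod_topology (mtop M) (mtop N)) (prod_chart c d)"
    if cd: "c \<in> atlas M" "d \<in> atlas N" for c d
  proof -
    note c = charted_chart_on[OF M cd(1)] and d = charted_chart_on[OF N cd(2)]
    let ?T = "{a \<in> topspace (Euc (chart_dim c + chart_dim d)).
                 vec_take (chart_dim c) a \<in> chart_map c ` chart_dom c \<and>
                 vec_drop (chart_dim c) a \<in> chart_map d ` chart_dom d}"
    let ?g = "\<lambda>a. (chart_inv c (vec_take (chart_dim c) a), chart_inv d (vec_drop (chart_dim c) a))"
    show ?thesis
    proof (rule chart_onI[where T="?T" and g="?g"])
      show "openin (prod_topology (mtop M) (mtop N)) (chart_dom c \<times> chart_dom d)"
        using chart_on_openin[OF c] chart_on_openin[OF d] by (simp add: openin_prod_Times_iff)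
      show "openin (Euc (chart_dim c + chart_dim d)) ?T"
        by (intro openin_vec_product chart_on_image_openin[OF c] chart_on_image_openin[OF d])
      show "(case x of (x, y) \<Rightarrow> vec_append (chart_dim c) (chart_map c x) (chart_map d y)) \<in> ?T \<and>
            ?g (case x of (x, y) \<Rightarrow> vec_append (chart_dim c) (chart_map c x) (chart_map d y)) = x"
        if "x \<in> chart_dom c \<times> chart_dom d" for x
        using that chart_map_topspace[OF c] chart_map_topspace[OF d]
        by (auto simp: vec_take_append vec_drop_append vec_append_in_Euclidean
            chart_inv_chart_map[OF c] chart_inv_chart_map[OF d])
      show "?g a \<in> chart_dom c \<times> chart_dom d \<and>
            (case ?g a of (x, y) \<Rightarrow> vec_append (chart_dim c) (chart_map c x) (chart_map d y)) = a"
        if a: "a \<in> ?T" for a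
      proof -
        from a obtain x y where "x \<in> chart_dom c" "y \<in> chart_dom d"
          "vec_take (chart_dim c) a = chart_map c x" "vec_drop (chart_dim c) a = chart_map d y"
          by blast
        then show ?thesis
          using vec_append_take_drop[of "chart_dim c" a]
          by (simp add: chart_inv_chart_map[OF c] chart_inv_chart_map[OF d])
      qed
      have fst: "continuous_map (subtopology (prod_topology (mtop M) (mtop N)) (chart_dom c \<times> chart_dom d))
          (subtopology (mtop M) (chart_dom c)) fst"
        and snd: "continuous_map (subtopology (prod_topology (mtop M) (mtop N)) (chart_dom c \<times> chart_dom d))
          (subtopology (mtop N) (chart_dom d)) snd"
        by (auto simp: continuous_map_in_subtopology intro: continuous_map_from_subtopology continuous_map_fst continuous_map_snd)
      show "continuous_map (subtopology (prod_topology (mtop M) (mtop N)) (chart_dom c \<times> chart_dom d))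
          (Euc (chart_dim c + chart_dim d))
          (\<lambda>(x, y). vec_append (chart_dim c) (chart_map c x) (chart_map d y))"
        using continuous_map_vec_append[OF continuous_map_compose[OF fst chart_map_continuous[OF c]]
            continuous_map_compose[OF snd chart_map_continuous[OF d]]]
        by (simp add: o_def case_prod_unfold)
      have tk: "continuous_map (subtopology (Euc (chart_dim c + chart_dim d)) ?T)
          (subtopology (Euc (chart_dim c)) (chart_map c ` chart_dom c)) (vec_take (chart_dim c))"
        and dr: "continuous_map (subtopology (Euc (chart_dim c + chart_dim d)) ?T)
          (subtopology (Euc (chart_dim d)) (chart_map d ` chart_dom d)) (vec_drop (chart_dim c))"
        by (auto simp: continuous_map_in_subtopology
            intro: continuous_map_from_subtopology continuous_map_vec_take continuous_map_vec_drop)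
      show "continuous_map (subtopology (Euc (chart_dim c + chart_dim d)) ?T)
          (prod_topology (mtop M) (mtop N)) ?g"
        using continuous_map_compose[OF tk chart_inv_continuous[OF c]]
          continuous_map_compose[OF dr chart_inv_continuous[OF d]]
        by (simp add: continuous_map_pairwise o_def)
    qed
  qed
  moreover have "\<Union>(chart_dom ` atlas (product_manifold M N)) = points M \<times> points N"
  proof -
    have "\<Union>(chart_dom ` atlas (product_manifold M N)) = \<Union>(chart_dom ` atlas M) \<times> \<Union>(chart_dom ` atlas N)"
      by (fastforce simp: product_manifold_def)
    then show ?thesis using M N by (simp add: charted_def)
  qed
  ultimately show ?thesis
    unfolding charted_def by (auto simp: product_manifold_def)
qed

lemma plot_product_iff:
  assumes M: "charted M" and N: "charted N"
  shows "plot m (product_manifold M N) \<phi> z \<longleftrightarrow>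
           plot m M (\<lambda>u. fst (\<phi> u)) z \<and> plot m N (\<lambda>u. snd (\<phi> u)) z"
proof
  assume p: "plot m (product_manifold M N) \<phi> z"
  have pts: "fst (\<phi> z) \<in> points M" "snd (\<phi> z) \<in> points N" using plot_points[OF p] by auto
  have *: "(\<forall>\<^sub>F u in near m z. fst (\<phi> u) \<in> chart_dom c) \<and> (\<forall>\<^sub>F u in near m z. snd (\<phi> u) \<in> chart_dom d) \<and>
      (\<forall>j<chart_dim c. smooth_germ m (\<lambda>u. chart_map c (fst (\<phi> u)) j) z) \<and>
      (\<forall>j<chart_dim d. smooth_germ m (\<lambda>u. chart_map d (snd (\<phi> u)) j) z)"
    if cd: "c \<in> atlas M" "fst (\<phi> z) \<in> chart_dom c" "d \<in> atlas N" "snd (\<phi> z) \<in> chart_dom d" for c d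
  proof (intro conjI allI impI)
    have cd': "prod_chart c d \<in> atlas (product_manifold M N)" "\<phi> z \<in> chart_dom (prod_chart c d)"
      using cd by (auto simp: product_manifold_def mem_Times_iff)
    note ev = plot_eventually_chart[OF p cd']
    show "\<forall>\<^sub>F u in near m z. fst (\<phi> u) \<in> chart_dom c" using ev by eventually_elim auto
    show "\<forall>\<^sub>F u in near m z. snd (\<phi> u) \<in> chart_dom d" using ev by eventually_elim auto
    fix j
    show "smooth_germ m (\<lambda>u. chart_map c (fst (\<phi> u)) j) z" if "j < chart_dim c"
      using plot_coordinate[OF p cd', of j] that by (simp add: case_prod_unfold vec_append_def)
    show "smooth_germ m (\<lambda>u. chart_map d (snd (\<phi> u)) j) z" if "j < chart_dim d"
      \<comment> \<open>In a product chart the coordinates of the second factor start at index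
        \<open>chart_dim c\<close>.\<close>
      using plot_coordinate[OF p cd', of "chart_dim c + j"] that by (simp add: case_prod_unfold vec_append_def)
  qed
  \<comment> \<open>A product chart needs both factors: testing one component in a given chart
    requires some chart around the image point of the other component.\<close>
  obtain c0 d0 where "c0 \<in> atlas M" "fst (\<phi> z) \<in> chart_dom c0" "d0 \<in> atlas N" "snd (\<phi> z) \<in> chart_dom d0"
    using charted_chartE[OF M pts(1)] charted_chartE[OF N pts(2)] by metis
  with * pts plot_topspace[OF p]
  show "plot m M (\<lambda>u. fst (\<phi> u)) z \<and> plot m N (\<lambda>u. snd (\<phi> u)) z"
    unfolding plot_def by blast
next
  assume "plot m M (\<lambda>u. fst (\<phi> u)) z \<and> plot m N (\<lambda>u. snd (\<phi> u)) z"
  then have p: "plot m M (\<lambda>u. fst (\<phi> u)) z" and q: "plot m N (\<lambda>u. snd (\<phi> u)) z" by auto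
  show "plot m (product_manifold M N) \<phi> z"
    unfolding plot_def
  proof (intro conjI ballI impI allI)
    show "\<phi> z \<in> points (product_manifold M N)"
      using plot_points[OF p] plot_points[OF q] by (simp add: mem_Times_iff)
    fix e assume e: "e \<in> atlas (product_manifold M N)" "\<phi> z \<in> chart_dom e"
    then obtain c d where cd: "c \<in> atlas M" "d \<in> atlas N" and e_def: "e = prod_chart c d"
      by (auto simp: product_manifold_def)
    have z: "fst (\<phi> z) \<in> chart_dom c" "snd (\<phi> z) \<in> chart_dom d"
      using e(2) by (auto simp: e_def)
    show "\<forall>\<^sub>F u in near m z. \<phi> u \<in> chart_dom e"
      using plot_eventually_chart[OF p cd(1) z(1)] plot_eventually_chart[OF q cd(2) z(2)]
      by eventually_elim (auto simp: e_def mem_Times_iff)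
    fix j assume j: "j < chart_dim e"
    show "smooth_germ m (\<lambda>u. chart_map e (\<phi> u) j) z"
    proof (cases "j < chart_dim c")
      case True
      then show ?thesis
        using plot_coordinate[OF p cd(1) z(1) True] by (simp add: e_def case_prod_unfold vec_append_def)
    next
      case False
      then have "j - chart_dim c < chart_dim d" using j by (simp add: e_def)
      from plot_coordinate[OF q cd(2) z(2) this] False show ?thesis
        by (simp add: e_def case_prod_unfold vec_append_def)
    qed
  qed (rule plot_topspace[OF p])
qed

lemma charted_euclidean_manifold: "charted (euclidean_manifold n)"
proof -
  have "chart_on (Euc n) (Chart (topspace (Euc n)) n id)"
    by (rule chart_onI[where T="topspace (Euc n)" and g=id]) auto
  then show ?thesis by (simp add: charted_def euclidean_manifold_def)
qed

lemma plot_euclidean_manifold_iff: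
  "plot m (euclidean_manifold k) w z \<longleftrightarrow>
     z \<in> topspace (Euc m) \<and> (\<forall>\<^sub>F u in near m z. w u \<in> topspace (Euc k)) \<and>
     (\<forall>j<k. smooth_germ m (\<lambda>u. w u j) z)"
  using eventually_near_self[of "\<lambda>u. w u \<in> topspace (Euc k)" m z]
  by (auto simp: plot_def euclidean_manifold_def)

lemma charted_real_line: "charted real_line"
proof -
  have "chart_on euclideanreal (Chart UNIV 1 (\<lambda>t i. if i = 0 then t else 0))"
  proof (rule chart_onI[where T="topspace (Euc 1)" and g="\<lambda>a. a 0"])
    show "openin (Euc 1) (topspace (Euc 1))" by (rule openin_topspace)
    show "continuous_map (subtopology euclideanreal UNIV) (Euc 1) (\<lambda>t i. if i = 0 then t else 0)"
      by (rule continuous_map_Euclidean_coordinates) (auto simp: topspace_Euclidean_space)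
    show "continuous_map (subtopology (Euc 1) (topspace (Euc 1))) euclideanreal (\<lambda>a. a 0)"
      by (rule continuous_map_Euclidean_coordinate)
  qed (auto simp: topspace_Euclidean_space fun_eq_iff)
  then show ?thesis by (simp add: charted_def real_line_def)
qed

lemma plot_real_line_iff: "plot m real_line \<tau> z \<longleftrightarrow> smooth_germ m \<tau> z"
  by (auto simp: plot_def real_line_def dest: smooth_germ_topspace)

section \<open>Transport in a vector bundle\<close>

text \<open>What a pullback bundle has to satisfy for its trivializations to serve as charts of a second
  pullback.\<close>

definition charted_bundle :: "('b, 'e) vector_bundle \<Rightarrow> bool" where
  "charted_bundle F \<longleftrightarrow> charted (base F) \<and> charted (total F) \<and>
     smooth_map (total F) (base F) (proj F) \<and>
     (\<forall>x\<in>points (base F). \<exists>U k \<Phi>. x \<in> U \<and> local_trivialization F U k \<Phi>)"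

lemma charted_bundleI: "smooth_vector_bundle F \<Longrightarrow> charted_bundle F"
  unfolding smooth_vector_bundle_def charted_bundle_def by (simp add: smooth_manifold_imp_charted)

text \<open>A local trivialization in the language of plots: fibre coordinates of a plot are smooth,
  and a smooth base point with smooth fibre coordinates is assembled to a plot by
  \<open>\<Gamma>\<close>. The open submanifolds and the product in the definition stay hidden
  behind this interface.\<close>

locale trivialization_inverse =
  fixes F :: "('b, 'e) vector_bundle" and U k \<Phi> \<Gamma>
  assumes continuous: "continuous_map (subtopology (mtop (total F)) (bundle_over F U)) (Euc k) (\<lambda>v. snd (\<Phi> v))"
    and on_total: "\<And>v. v \<in> bundle_over F U \<Longrightarrow>
      \<Phi> v = (proj F v, snd (\<Phi> v)) \<and> snd (\<Phi> v) \<in> topspace (Euc k) \<and> \<Gamma> (\<Phi> v) = v"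
    and on_product: "\<And>x w. x \<in> U \<Longrightarrow> w \<in> topspace (Euc k) \<Longrightarrow>
      \<Gamma> (x, w) \<in> fibre F x \<and> \<Phi> (\<Gamma> (x, w)) = (x, w)"
    and plot_coordinates: "\<And>m b z. plot m (total F) b z \<Longrightarrow> proj F (b z) \<in> U \<Longrightarrow>
      plot m (euclidean_manifold k) (\<lambda>u. snd (\<Phi> (b u))) z"
    and plot_inverse: "\<And>m y w z. plot m (base F) y z \<Longrightarrow> y z \<in> U \<Longrightarrow> plot m (euclidean_manifold k) w z \<Longrightarrow>
      plot m (total F) (\<lambda>u. \<Gamma> (y u, w u)) z"

context
  fixes F :: "('b, 'e) vector_bundle"
  assumes F: "charted_bundle F"
begin

lemma charted_base: "charted (base F)"
  and charted_total: "charted (total F)"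
  using F unfolding charted_bundle_def by blast+

lemma smooth_map_proj: "smooth_map (total F) (base F) (proj F)"
  using F unfolding charted_bundle_def by blast

lemma ex_local_trivialization:
  "x \<in> points (base F) \<Longrightarrow> \<exists>U k \<Phi>. x \<in> U \<and> local_trivialization F U k \<Phi>"
  using F unfolding charted_bundle_def by blast

lemma plot_proj: "plot m (total F) b z \<Longrightarrow> plot m (base F) (\<lambda>u. proj F (b u)) z"
  by (rule plot_smooth_map[OF charted_total charted_base smooth_map_proj])

lemma proj_points: "v \<in> points (total F) \<Longrightarrow> proj F v \<in> points (base F)"
  by (rule smooth_map_points[OF smooth_map_proj])

lemma openin_bundle_over:
  assumes "openin (mtop (base F)) U"
  shows "openin (mtop (total F)) (bundle_over F U)"
  using openin_continuous_map_preimage[OF _ assms] smooth_map_proj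
  unfolding smooth_map_def bundle_over_def by blast

lemma ex_trivialization_inverse:
  assumes "local_trivialization F U k \<Phi>"
  shows "\<exists>\<Gamma>. trivialization_inverse F U k \<Phi> \<Gamma>"
proof -
  let ?T = "open_submanifold (total F) (bundle_over F U)"
  let ?B = "product_manifold (open_submanifold (base F) U) (euclidean_manifold k)"
  have U: "openin (mtop (base F)) U" and fst: "\<And>v. v \<in> bundle_over F U \<Longrightarrow> fst (\<Phi> v) = proj F v"
    using assms unfolding local_trivialization_def by auto
  obtain \<Gamma> where \<Phi>: "smooth_map ?T ?B \<Phi>" and \<Gamma>: "smooth_map ?B ?T \<Gamma>"
    and inv: "\<And>v. v \<in> points ?T \<Longrightarrow> \<Gamma> (\<Phi> v) = v" "\<And>p. p \<in> points ?B \<Longrightarrow> \<Phi> (\<Gamma> p) = p"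
    using assms unfolding local_trivialization_def diffeomorphism_def by blast
  have cT: "charted ?T" by (rule charted_open_submanifold[OF charted_total openin_bundle_over[OF U]])
  have cU: "charted (open_submanifold (base F) U)" by (rule charted_open_submanifold[OF charted_base U])
  have cB: "charted ?B" by (rule charted_product_manifold[OF cU charted_euclidean_manifold])
  have pT: "points ?T = bundle_over F U" by (auto simp: open_submanifold_def bundle_over_def)
  have pB: "points ?B = U \<times> topspace (Euc k)"
    using openin_subset[OF U] by (auto simp: open_submanifold_def euclidean_manifold_def)
  have "trivialization_inverse F U k \<Phi> \<Gamma>"
  proof (rule trivialization_inverse.intro)
    have "continuous_map (mtop ?T) (mtop ?B) \<Phi>" using \<Phi> unfolding smooth_map_def by blast
    then show "continuous_map (subtopology (mtop (total F)) (bundle_over F U)) (Euc k) (\<lambda>v. snd (\<Phi> v))"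
      using continuous_map_compose[OF _ continuous_map_snd]
      by (fastforce simp: open_submanifold_def product_manifold_def euclidean_manifold_def o_def)
    show "\<Phi> v = (proj F v, snd (\<Phi> v)) \<and> snd (\<Phi> v) \<in> topspace (Euc k) \<and> \<Gamma> (\<Phi> v) = v"
      if v: "v \<in> bundle_over F U" for v
    proof -
      have "\<Phi> v \<in> points ?B" using smooth_map_points[OF \<Phi>] v pT by blast
      then have "snd (\<Phi> v) \<in> topspace (Euc k)" unfolding pB by (simp add: mem_Times_iff)
      then show ?thesis using fst[OF v] inv(1) v pT by (metis prod.collapse)
    qed
    show "\<Gamma> (x, w) \<in> fibre F x \<and> \<Phi> (\<Gamma> (x, w)) = (x, w)"
      if "x \<in> U" "w \<in> topspace (Euc k)" for x w
    proof -
      have xw: "(x, w) \<in> points ?B" using that unfolding pB by simp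
      have g: "\<Gamma> (x, w) \<in> bundle_over F U" using smooth_map_points[OF \<Gamma> xw] unfolding pT .
      have "\<Phi> (\<Gamma> (x, w)) = (x, w)" by (rule inv(2)[OF xw])
      moreover have "proj F (\<Gamma> (x, w)) = x" using fst[OF g] calculation by simp
      ultimately show ?thesis using g by (simp add: bundle_over_def)
    qed
    show "plot m (euclidean_manifold k) (\<lambda>u. snd (\<Phi> (b u))) z"
      if "plot m (total F) b z" "proj F (b z) \<in> U" for m b z
    proof -
      have "plot m ?T b z"
        unfolding plot_open_submanifold_iff[OF charted_total openin_bundle_over[OF U]]
        using that plot_points[OF that(1)] by (simp add: bundle_over_def)
      from plot_smooth_map[OF cT cB \<Phi> this] show ?thesis
        by (simp add: plot_product_iff[OF cU charted_euclidean_manifold])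
    qed
    show "plot m (total F) (\<lambda>u. \<Gamma> (y u, w u)) z"
      if "plot m (base F) y z" "y z \<in> U" "plot m (euclidean_manifold k) w z" for m y w z
    proof -
      have "plot m ?B (\<lambda>u. (y u, w u)) z"
        using that by (simp add: plot_product_iff[OF cU charted_euclidean_manifold] plot_open_submanifold_iff[OF charted_base U])
      from plot_smooth_map[OF cB cT \<Gamma> this] show ?thesis
        by (simp add: plot_open_submanifold_iff[OF charted_total openin_bundle_over[OF U]])
    qed
  qed
  then show ?thesis by blast
qed

end

lemma
  assumes F: "smooth_vector_bundle F"
  shows fibre_add_closed: "v \<in> fibre F x \<Longrightarrow> w \<in> fibre F x \<Longrightarrow> fib_add F v w \<in> fibre F x"
    and fibre_scale_closed: "v \<in> fibre F x \<Longrightarrow> fib_scale F a v \<in> fibre F x"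
proof -
  have *: "real_vector_space_on (fibre F x) (fib_add F) (fib_scale F)" if "v \<in> fibre F x" for v x
    using F that proj_points[OF charted_bundleI[OF F]] unfolding smooth_vector_bundle_def bundle_over_def by auto
  show "v \<in> fibre F x \<Longrightarrow> w \<in> fibre F x \<Longrightarrow> fib_add F v w \<in> fibre F x"
    using *[of v x] unfolding real_vector_space_on_def by blast
  show "v \<in> fibre F x \<Longrightarrow> fib_scale F a v \<in> fibre F x"
    using *[of v x] unfolding real_vector_space_on_def by blast
qed

text \<open>\<open>Q y v\<close> moves the vector \<open>v\<close>, whose base point is \<open>proj F v\<close>, to the fibre over \<open>y\<close>, both
  points lying over the same point of \<open>M\<close>.\<close>

locale transport =
  fixes F :: "(real \<times> 'a, 'e) vector_bundle" and Z :: "(real \<times> 'a) set" and Q :: "real \<times> 'a \<Rightarrow> 'e \<Rightarrow> 'e"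
  assumes openin_domain: "openin (mtop (base F)) Z"
    and stay: "\<And>v. v \<in> bundle_over F Z \<Longrightarrow> Q (proj F v) v = v"
    and move: "\<And>y v. y \<in> Z \<Longrightarrow> v \<in> bundle_over F Z \<Longrightarrow> snd (proj F v) = snd y \<Longrightarrow> Q y v \<in> fibre F y"
    and move_back: "\<And>y v. y \<in> Z \<Longrightarrow> v \<in> bundle_over F Z \<Longrightarrow> snd (proj F v) = snd y \<Longrightarrow> Q (proj F v) (Q y v) = v"
    and move_add: "\<And>y v w. y \<in> Z \<Longrightarrow> v \<in> bundle_over F Z \<Longrightarrow> snd (proj F v) = snd y \<Longrightarrow>
      w \<in> fibre F (proj F v) \<Longrightarrow> Q y (fib_add F v w) = fib_add F (Q y v) (Q y w)"
    and move_scale: "\<And>y v a. y \<in> Z \<Longrightarrow> v \<in> bundle_over F Z \<Longrightarrow> snd (proj F v) = snd y \<Longrightarrow>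
      Q y (fib_scale F a v) = fib_scale F a (Q y v)"
    and plot_move: "\<And>m y b z. plot m (base F) y z \<Longrightarrow> plot m (total F) b z \<Longrightarrow> y z \<in> Z \<Longrightarrow> proj F (b z) \<in> Z \<Longrightarrow>
      \<forall>\<^sub>F u in near m z. snd (proj F (b u)) = snd (y u) \<Longrightarrow> plot m (total F) (\<lambda>u. Q (y u) (b u)) z"

lemmas transportD = transport.openin_domain transport.stay transport.move transport.move_back
  transport.move_add transport.move_scale transport.plot_move

text \<open>\<open>P y\<close> is a linear isomorphism with inverse \<open>R y\<close> from the
  fibre over \<open>(t0, snd y)\<close>. Its target \<open>\<beta> y\<close> is left free so that a
  family can begin with the identity at time \<open>t0\<close> and be moved in steps until
  \<open>\<beta> y = y\<close>. Smoothness is tested on pairs of plots in the fibre product, which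
  thus needs no charts here; smoothness of the inverse is part of the data and carried through each
  construction.\<close>

locale transport_family =
  fixes F :: "(real \<times> 'a, 'e) vector_bundle" and t0 :: real and W :: "(real \<times> 'a) set"
    and \<beta> :: "real \<times> 'a \<Rightarrow> real \<times> 'a" and P R :: "real \<times> 'a \<Rightarrow> 'e \<Rightarrow> 'e"
  assumes openin_domain: "openin (mtop (base F)) W"
    and snd_target: "\<And>y. y \<in> W \<Longrightarrow> snd (\<beta> y) = snd y"
    and plot_target: "\<And>m y z. plot m (base F) y z \<Longrightarrow> y z \<in> W \<Longrightarrow> plot m (base F) (\<lambda>u. \<beta> (y u)) z"
    and forward: "\<And>y v. y \<in> W \<Longrightarrow> v \<in> fibre F (t0, snd y) \<Longrightarrow> P y v \<in> fibre F (\<beta> y)"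
    and backward_forward: "\<And>y v. y \<in> W \<Longrightarrow> v \<in> fibre F (t0, snd y) \<Longrightarrow> R y (P y v) = v"
    and forward_add: "\<And>y v w. y \<in> W \<Longrightarrow> v \<in> fibre F (t0, snd y) \<Longrightarrow> w \<in> fibre F (t0, snd y) \<Longrightarrow>
      P y (fib_add F v w) = fib_add F (P y v) (P y w)"
    and forward_scale: "\<And>y v a. y \<in> W \<Longrightarrow> v \<in> fibre F (t0, snd y) \<Longrightarrow>
      P y (fib_scale F a v) = fib_scale F a (P y v)"
    and backward: "\<And>y w. y \<in> W \<Longrightarrow> w \<in> fibre F (\<beta> y) \<Longrightarrow> R y w \<in> fibre F (t0, snd y)"
    and forward_backward: "\<And>y w. y \<in> W \<Longrightarrow> w \<in> fibre F (\<beta> y) \<Longrightarrow> P y (R y w) = w"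
    and plot_forward: "\<And>m y b z. plot m (base F) y z \<Longrightarrow> plot m (total F) b z \<Longrightarrow> y z \<in> W \<Longrightarrow>
      \<forall>\<^sub>F u in near m z. proj F (b u) = (t0, snd (y u)) \<Longrightarrow> plot m (total F) (\<lambda>u. P (y u) (b u)) z"
    and plot_backward: "\<And>m y b z. plot m (base F) y z \<Longrightarrow> plot m (total F) b z \<Longrightarrow> y z \<in> W \<Longrightarrow>
      \<forall>\<^sub>F u in near m z. proj F (b u) = \<beta> (y u) \<Longrightarrow> plot m (total F) (\<lambda>u. R (y u) (b u)) z"

lemmas transport_familyD = transport_family.openin_domain transport_family.snd_target
  transport_family.plot_target transport_family.forward transport_family.backward_forward
  transport_family.forward_add transport_family.forward_scale transport_family.backward
  transport_family.forward_backward transport_family.plot_forward transport_family.plot_backward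

lemma fibre_subset_bundle_over: "v \<in> fibre F y \<Longrightarrow> y \<in> U \<Longrightarrow> v \<in> bundle_over F U"
  by (auto simp: bundle_over_def)

lemma fibreD: "v \<in> fibre F y \<Longrightarrow> proj F v = y" "v \<in> fibre F y \<Longrightarrow> v \<in> points (total F)"
  by (auto simp: bundle_over_def)

lemma transport_subset:
  assumes Q: "transport F Z Q" and Z': "openin (mtop (base F)) Z'" "Z' \<subseteq> Z"
  shows "transport F Z' Q"
proof -
  note T = transportD[OF Q]
  have v: "v \<in> bundle_over F Z" if "v \<in> bundle_over F Z'" for v
    using that Z'(2) by (auto simp: bundle_over_def)
  show ?thesis
    by (rule transport.intro[OF Z'(1)]) (use Z'(2) in \<open>auto intro: T v\<close>)
qed

text \<open>Keep the fibre coordinates and change the base point. Coordinates are linear and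
  injective on each fibre, so every required identity may be checked after applying
  \<open>\<Phi>\<close>; this is \<open>eqI\<close>.\<close>

lemma local_trivialization_transport:
  fixes F :: "(real \<times> 'a, 'e) vector_bundle"
  assumes F: "smooth_vector_bundle F" and triv: "local_trivialization F U k \<Phi>"
  shows "\<exists>Q. transport F U Q"
proof -
  obtain \<Gamma> where "trivialization_inverse F U k \<Phi> \<Gamma>"
    using ex_trivialization_inverse[OF charted_bundleI[OF F] triv] by blast
  then interpret trivialization_inverse F U k \<Phi> \<Gamma> .
  note \<Phi> = on_total and \<Gamma> = on_product
  have U: "openin (mtop (base F)) U"
    and add: "\<And>x v w. x \<in> U \<Longrightarrow> v \<in> fibre F x \<Longrightarrow> w \<in> fibre F x \<Longrightarrow>
        snd (\<Phi> (fib_add F v w)) = (\<lambda>i. snd (\<Phi> v) i + snd (\<Phi> w) i)"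
    and scale: "\<And>x a v. x \<in> U \<Longrightarrow> v \<in> fibre F x \<Longrightarrow> snd (\<Phi> (fib_scale F a v)) = (\<lambda>i. a * snd (\<Phi> v) i)"
    using triv unfolding local_trivialization_def by auto
  let ?Q = "\<lambda>y v. \<Gamma> (y, snd (\<Phi> v))"
  have eqI: "v = w" if "v \<in> fibre F x" "w \<in> fibre F x" "x \<in> U" "snd (\<Phi> v) = snd (\<Phi> w)" for v w x
  proof -
    have "v \<in> bundle_over F U" "w \<in> bundle_over F U" "proj F v = proj F w"
      using that by (auto simp: bundle_over_def)
    with \<Phi>[of v] \<Phi>[of w] that(4) show ?thesis by metis
  qed
  have Q: "?Q y v \<in> fibre F y" "snd (\<Phi> (?Q y v)) = snd (\<Phi> v)" if "y \<in> U" "v \<in> bundle_over F U" for y v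
    using \<Gamma>[OF that(1)] \<Phi>[OF that(2)] by auto
  have "transport F U ?Q"
  proof (rule transport.intro[OF U])
    show "?Q (proj F v) v = v" if "v \<in> bundle_over F U" for v
      using \<Phi>[OF that] by metis
    fix y v assume y: "y \<in> U" and v: "v \<in> bundle_over F U" and yv: "snd (proj F v) = snd y"
    have vU: "proj F v \<in> U" "v \<in> fibre F (proj F v)" using v by (auto simp: bundle_over_def)
    have Qv: "?Q y v \<in> bundle_over F U" using Q(1)[OF y v] y by (rule fibre_subset_bundle_over)
    show "?Q y v \<in> fibre F y" by (rule Q(1)[OF y v])
    show "?Q (proj F v) (?Q y v) = v"
      by (rule eqI[OF _ vU(2,1)]) (use Q vU Qv y v in auto)
    show "?Q y (fib_add F v w) = fib_add F (?Q y v) (?Q y w)" if w: "w \<in> fibre F (proj F v)" for w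
    proof (rule eqI[OF _ _ y])
      have wU: "w \<in> bundle_over F U" using w vU(1) by (rule fibre_subset_bundle_over)
      have vwU: "fib_add F v w \<in> bundle_over F U"
        using fibre_add_closed[OF F vU(2) w] vU(1) by (rule fibre_subset_bundle_over)
      show "?Q y (fib_add F v w) \<in> fibre F y" by (rule Q(1)[OF y vwU])
      show "fib_add F (?Q y v) (?Q y w) \<in> fibre F y"
        by (rule fibre_add_closed[OF F Q(1)[OF y v] Q(1)[OF y wU]])
      show "snd (\<Phi> (?Q y (fib_add F v w))) = snd (\<Phi> (fib_add F (?Q y v) (?Q y w)))"
        unfolding trans[OF Q(2)[OF y vwU] add[OF vU(1) vU(2) w]] add[OF y Q(1)[OF y v] Q(1)[OF y wU]]
          Q(2)[OF y v] Q(2)[OF y wU] ..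
    qed
    show "?Q y (fib_scale F a v) = fib_scale F a (?Q y v)" for a
    proof (rule eqI[OF _ _ y])
      have avU: "fib_scale F a v \<in> bundle_over F U"
        using fibre_scale_closed[OF F vU(2)] vU(1) by (rule fibre_subset_bundle_over)
      show "?Q y (fib_scale F a v) \<in> fibre F y" by (rule Q(1)[OF y avU])
      show "fib_scale F a (?Q y v) \<in> fibre F y"
        by (rule fibre_scale_closed[OF F Q(1)[OF y v]])
      show "snd (\<Phi> (?Q y (fib_scale F a v))) = snd (\<Phi> (fib_scale F a (?Q y v)))"
        unfolding trans[OF Q(2)[OF y avU] scale[OF vU]] scale[OF y Q(1)[OF y v]] Q(2)[OF y v] ..
    qed
  qed (use plot_coordinates plot_inverse in auto)
  then show ?thesis by blast
qed

lemma plot_eventually_fibre: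
  assumes F: "smooth_vector_bundle F" and b: "plot m (total F) b z"
    and ev: "\<forall>\<^sub>F u in near m z. proj F (b u) = y u"
  shows "\<forall>\<^sub>F u in near m z. b u \<in> fibre F (y u)"
proof -
  have "\<forall>\<^sub>F u in near m z. b u \<in> points (total F)"
    using plot_eventually_in_open[OF charted_total[OF charted_bundleI[OF F]] b openin_topspace plot_points[OF b]] .
  with ev show ?thesis by eventually_elim (auto simp: bundle_over_def)
qed

text \<open>Since \<open>\<theta>\<close> fixes the point of \<open>M\<close>, the starting fibre
  over \<open>t0\<close> is unchanged and only the arrival time is altered.\<close>

lemma transport_family_reparametrize:
  assumes fam: "transport_family F t0 W \<beta> P R" and W': "openin (mtop (base F)) W'"
    and \<theta>: "\<And>y. y \<in> W' \<Longrightarrow> \<theta> y \<in> W \<and> snd (\<theta> y) = snd y"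
    and p\<theta>: "\<And>m y z. plot m (base F) y z \<Longrightarrow> y z \<in> W' \<Longrightarrow> plot m (base F) (\<lambda>u. \<theta> (y u)) z"
    and B: "charted (base F)"
  shows "transport_family F t0 W' (\<lambda>y. \<beta> (\<theta> y)) (\<lambda>y. P (\<theta> y)) (\<lambda>y. R (\<theta> y))"
proof (rule transport_family.intro)
  note D = transport_familyD[OF fam]
  fix m y b z assume y: "plot m (base F) y z" "y z \<in> W'" and b: "plot m (total F) b z"
  have ev: "\<forall>\<^sub>F u in near m z. y u \<in> W'" by (rule plot_eventually_in_open[OF B y(1) W' y(2)])
  show "plot m (total F) (\<lambda>u. P (\<theta> (y u)) (b u)) z" if "\<forall>\<^sub>F u in near m z. proj F (b u) = (t0, snd (y u))"
  proof (rule D(10)[OF p\<theta>[OF y] b])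
    show "\<theta> (y z) \<in> W" using \<theta> y(2) by blast
    show "\<forall>\<^sub>F u in near m z. proj F (b u) = (t0, snd (\<theta> (y u)))"
      using ev that by eventually_elim (simp add: \<theta>)
  qed
  show "plot m (total F) (\<lambda>u. R (\<theta> (y u)) (b u)) z" if "\<forall>\<^sub>F u in near m z. proj F (b u) = \<beta> (\<theta> (y u))"
    using \<theta> y b that by (intro D(11) p\<theta>) auto
next
  note D = transport_familyD[OF fam]
  show "snd (\<beta> (\<theta> y)) = snd y" if "y \<in> W'" for y
    using D(2)[of "\<theta> y"] \<theta>[OF that] by simp
  show "plot m (base F) (\<lambda>u. \<beta> (\<theta> (y u))) z" if "plot m (base F) y z" "y z \<in> W'" for m y z
    using D(3)[OF p\<theta>[OF that]] \<theta>[OF that(2)] by simp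
  fix y assume "y \<in> W'"
  then have y: "\<theta> y \<in> W" "snd (\<theta> y) = snd y" using \<theta> by auto
  show "P (\<theta> y) v \<in> fibre F (\<beta> (\<theta> y))" "R (\<theta> y) (P (\<theta> y) v) = v"
    "P (\<theta> y) (fib_scale F a v) = fib_scale F a (P (\<theta> y) v)" if "v \<in> fibre F (t0, snd y)" for v a
    using D(4,5,7)[OF y(1)] that unfolding y(2) by auto
  show "P (\<theta> y) (fib_add F v w) = fib_add F (P (\<theta> y) v) (P (\<theta> y) w)"
    if "v \<in> fibre F (t0, snd y)" "w \<in> fibre F (t0, snd y)" for v w
    using D(6)[OF y(1)] that unfolding y(2) by blast
  show "R (\<theta> y) w \<in> fibre F (t0, snd y)" "P (\<theta> y) (R (\<theta> y) w) = w"
    if "w \<in> fibre F (\<beta> (\<theta> y))" for w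
    using D(8,9)[OF y(1) that] unfolding y(2) by auto
qed (rule W')

text \<open>\<open>Q\<close> is meaningful only between fibres over \<open>Z\<close>; elsewhere the
  step has to be trivial, and then \<open>\<beta> y\<close> and \<open>\<beta>' y\<close> must
  agree. That they do is imposed in \<open>transport_family_step\<close>.\<close>

definition step_forward where
  "step_forward Z Q \<beta> \<beta>' P = (\<lambda>y v. if \<beta> y \<in> Z \<and> \<beta>' y \<in> Z then Q (\<beta>' y) (P y v) else P y v)"

definition step_backward where
  "step_backward Z Q \<beta> \<beta>' R = (\<lambda>y w. if \<beta> y \<in> Z \<and> \<beta>' y \<in> Z then R y (Q (\<beta> y) w) else R y w)"

text \<open>If the target does not change, both branches agree, because a transport to the own base
  point is the identity.\<close>

lemma step_forward_eq:
  assumes "transport_family F t0 W \<beta> P R" "transport F Z Q" "y \<in> W" "\<beta>' y = \<beta> y" "v \<in> fibre F (t0, snd y)"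
  shows "step_forward Z Q \<beta> \<beta>' P y v = P y v"
proof -
  have "P y v \<in> fibre F (\<beta> y)" by (rule transport_familyD(4)[OF assms(1,3,5)])
  with transportD(2)[OF assms(2), of "P y v"] assms(4) show ?thesis
    by (auto simp: step_forward_def bundle_over_def)
qed

lemma step_backward_eq:
  assumes "transport F Z Q" "\<beta>' y = \<beta> y" "w \<in> fibre F (\<beta> y)"
  shows "step_backward Z Q \<beta> \<beta>' R y w = R y w"
  using transportD(2)[OF assms(1), of w] assms(2,3)
  by (auto simp: step_backward_def bundle_over_def)

text \<open>The case distinction in the step could destroy smoothness. By \<open>alt\<close> it does
  not: either both targets lie in \<open>Z\<close>, hence also nearby, or the targets agree on a
  whole neighbourhood, where the step is the identity.\<close>

lemma transport_family_step:
  assumes F: "smooth_vector_bundle F"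
    and fam: "transport_family F t0 W \<beta> P R" and tr: "transport F Z Q"
    and \<beta>': "\<And>y. y \<in> W \<Longrightarrow> snd (\<beta>' y) = snd y"
    and p\<beta>': "\<And>m y z. plot m (base F) y z \<Longrightarrow> y z \<in> W \<Longrightarrow> plot m (base F) (\<lambda>u. \<beta>' (y u)) z"
    and alt: "\<And>y. y \<in> W \<Longrightarrow> (\<beta> y \<in> Z \<and> \<beta>' y \<in> Z) \<or>
                (\<exists>V. openin (mtop (base F)) V \<and> y \<in> V \<and> (\<forall>y'\<in>V. \<beta>' y' = \<beta> y'))"
  shows "transport_family F t0 W \<beta>' (step_forward Z Q \<beta> \<beta>' P) (step_backward Z Q \<beta> \<beta>' R)"
    (is "transport_family F t0 W \<beta>' ?P ?R")
proof -
  note D = transport_familyD[OF fam] and T = transportD[OF tr]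
  note B = charted_base[OF charted_bundleI[OF F]]
  have P1: "?P y v = Q (\<beta>' y) (P y v)" and R1: "?R y v = R y (Q (\<beta> y) v)"
    if "\<beta> y \<in> Z" "\<beta>' y \<in> Z" for y v
    using that by (simp_all add: step_forward_def step_backward_def)
  have P2: "?P y v = P y v" if "y \<in> W" "\<beta>' y = \<beta> y" "v \<in> fibre F (t0, snd y)" for y v
    by (rule step_forward_eq[where \<beta>=\<beta> and \<beta>'=\<beta>', OF fam tr that])
  have R2: "?R y w = R y w" if "\<beta>' y = \<beta> y" "w \<in> fibre F (\<beta> y)" for y w
    by (rule step_backward_eq[where \<beta>=\<beta> and \<beta>'=\<beta>', OF tr that])
  have snds: "snd (\<beta>' y) = snd (\<beta> y)" if "y \<in> W" for y using D(2)[OF that] \<beta>'[OF that] by simp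
  have Q1: "Q y' v \<in> fibre F y'" "Q y (Q y' v) = v"
    "w \<in> fibre F y \<Longrightarrow> Q y' (fib_add F v w) = fib_add F (Q y' v) (Q y' w)"
    "Q y' (fib_scale F a v) = fib_scale F a (Q y' v)"
    if "y \<in> Z" "y' \<in> Z" "snd y' = snd y" "v \<in> fibre F y" for y y' v w a
    using T(3-6)[OF that(2) fibre_subset_bundle_over[OF that(4,1)]] fibreD(1)[OF that(4)] that(3) by auto
  \<comment> \<open>At a fixed point the step is composition with an isomorphism \<open>A\<close>
    with inverse \<open>B\<close>, namely a value of \<open>Q\<close> or the identity. The algebraic
    laws then need no further distinction; only smoothness does.\<close>
  have factor: "\<exists>A B. (\<forall>v\<in>fibre F (t0, snd y). ?P y v = A (P y v)) \<and>
      (\<forall>v\<in>fibre F (\<beta> y). A v \<in> fibre F (\<beta>' y) \<and> B (A v) = v \<and>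
        (\<forall>w\<in>fibre F (\<beta> y). A (fib_add F v w) = fib_add F (A v) (A w)) \<and>
        (\<forall>a. A (fib_scale F a v) = fib_scale F a (A v))) \<and>
      (\<forall>w\<in>fibre F (\<beta>' y). ?R y w = R y (B w) \<and> B w \<in> fibre F (\<beta> y) \<and> A (B w) = w)" if y: "y \<in> W" for y
    using alt[OF y]
  proof (elim disjE conjE)
    assume Z: "\<beta> y \<in> Z" "\<beta>' y \<in> Z"
    note Q = Q1[OF Z snds[OF y]] Q1[OF Z(2,1) snds[OF y, symmetric]]
    show ?thesis
      by (rule exI[of _ "Q (\<beta>' y)"], rule exI[of _ "Q (\<beta> y)"]) (use Q P1[OF Z] R1[OF Z] in simp)
  next
    assume "\<exists>V. openin (mtop (base F)) V \<and> y \<in> V \<and> (\<forall>y'\<in>V. \<beta>' y' = \<beta> y')"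
    then have "\<beta>' y = \<beta> y" by blast
    with P2[OF y this] R2[OF this] show ?thesis
      by (intro exI[of _ "\<lambda>v. v"]) simp
  qed
  show ?thesis
  proof (rule transport_family.intro)
    show "openin (mtop (base F)) W" by (rule D(1))
    show "snd (\<beta>' y) = snd y" if "y \<in> W" for y using \<beta>'[OF that] .
    show "plot m (base F) (\<lambda>u. \<beta>' (y u)) z" if "plot m (base F) y z" "y z \<in> W" for m y z
      using p\<beta>'[OF that] .
    fix y assume y: "y \<in> W"
    obtain A B where A: "\<forall>v\<in>fibre F (t0, snd y). ?P y v = A (P y v)"
      and A': "\<forall>v\<in>fibre F (\<beta> y). A v \<in> fibre F (\<beta>' y) \<and> B (A v) = v \<and>
        (\<forall>w\<in>fibre F (\<beta> y). A (fib_add F v w) = fib_add F (A v) (A w)) \<and>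
        (\<forall>a. A (fib_scale F a v) = fib_scale F a (A v))"
      and B: "\<forall>w\<in>fibre F (\<beta>' y). ?R y w = R y (B w) \<and> B w \<in> fibre F (\<beta> y) \<and> A (B w) = w"
      using factor[OF y] by (elim exE conjE) (rule that)
    note Dy = D(4-9)[OF y]
    show P: "?P y v \<in> fibre F (\<beta>' y)" "?R y (?P y v) = v"
      "?P y (fib_scale F a v) = fib_scale F a (?P y v)" if "v \<in> fibre F (t0, snd y)" for v a
      using A A' B Dy fibre_scale_closed[OF F] that by simp_all
    show "?P y (fib_add F v w) = fib_add F (?P y v) (?P y w)"
      if "v \<in> fibre F (t0, snd y)" "w \<in> fibre F (t0, snd y)" for v w
      using A A' Dy fibre_add_closed[OF F] that by simp
    show "?R y w \<in> fibre F (t0, snd y)" "?P y (?R y w) = w" if "w \<in> fibre F (\<beta>' y)" for w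
      using A B Dy that by simp_all
  next
    fix m y b z assume y: "plot m (base F) y z" "y z \<in> W" and b: "plot m (total F) b z"
    have evW: "\<forall>\<^sub>F u in near m z. y u \<in> W" by (rule plot_eventually_in_open[OF B y(1) D(1) y(2)])
    have p1: "plot m (base F) (\<lambda>u. \<beta> (y u)) z" and p2: "plot m (base F) (\<lambda>u. \<beta>' (y u)) z"
      using D(3)[OF y] p\<beta>'[OF y] by auto
    consider (Z) "\<beta> (y z) \<in> Z" "\<beta>' (y z) \<in> Z" | (V) V where "openin (mtop (base F)) V" "y z \<in> V" "\<forall>y'\<in>V. \<beta>' y' = \<beta> y'"
      using alt[OF y(2)] by blast
    note alternatives = this
    have evZ: "\<forall>\<^sub>F u in near m z. \<beta> (y u) \<in> Z \<and> \<beta>' (y u) \<in> Z" if "\<beta> (y z) \<in> Z" "\<beta>' (y z) \<in> Z"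
      using plot_eventually_in_open[OF B p1 T(1) that(1)] plot_eventually_in_open[OF B p2 T(1) that(2)]
      by eventually_elim auto
    have evV: "\<forall>\<^sub>F u in near m z. \<beta>' (y u) = \<beta> (y u)"
      if "openin (mtop (base F)) V" "y z \<in> V" "\<forall>y'\<in>V. \<beta>' y' = \<beta> y'" for V
      using plot_eventually_in_open[OF B y(1) that(1,2)] by eventually_elim (use that(3) in auto)
    show "plot m (total F) (\<lambda>u. ?P (y u) (b u)) z" if "\<forall>\<^sub>F u in near m z. proj F (b u) = (t0, snd (y u))"
    proof -
      have evb: "\<forall>\<^sub>F u in near m z. b u \<in> fibre F (t0, snd (y u))" by (rule plot_eventually_fibre[OF F b that])
      have Pb: "plot m (total F) (\<lambda>u. P (y u) (b u)) z" by (rule D(10)[OF y(1) b y(2) that])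
      have evP: "\<forall>\<^sub>F u in near m z. proj F (P (y u) (b u)) = \<beta> (y u)"
        using evW evb by eventually_elim (rule fibreD(1)[OF D(4)])
      show ?thesis using alternatives
      proof cases
        case Z
        have "plot m (total F) (\<lambda>u. Q (\<beta>' (y u)) (P (y u) (b u))) z"
        proof (rule T(7)[OF p2 Pb Z(2)])
          show "proj F (P (y z) (b z)) \<in> Z"
            using eventually_near_self[OF evP plot_topspace[OF b]] Z(1) by simp
          show "\<forall>\<^sub>F u in near m z. snd (proj F (P (y u) (b u))) = snd (\<beta>' (y u))"
            using evP evW by eventually_elim (simp add: snds)
        qed
        then show ?thesis by (rule plot_cong) (use evZ[OF Z] in eventually_elim, simp add: P1)
      next
        case V
        show ?thesis by (rule plot_cong[OF Pb]) (use evV[OF V] evW evb in eventually_elim, simp add: P2)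
      qed
    qed
    show "plot m (total F) (\<lambda>u. ?R (y u) (b u)) z" if "\<forall>\<^sub>F u in near m z. proj F (b u) = \<beta>' (y u)"
      using alternatives
    proof cases
      case Z
      have evb: "\<forall>\<^sub>F u in near m z. b u \<in> fibre F (\<beta>' (y u))" by (rule plot_eventually_fibre[OF F b that])
      have "plot m (total F) (\<lambda>u. Q (\<beta> (y u)) (b u)) z"
      proof (rule T(7)[OF p1 b Z(1)])
        show "proj F (b z) \<in> Z"
          using eventually_near_self[OF that plot_topspace[OF b]] Z(2) by simp
        show "\<forall>\<^sub>F u in near m z. snd (proj F (b u)) = snd (\<beta> (y u))"
          using that evW by eventually_elim (simp add: snds)
      qed
      from D(11)[OF y(1) this y(2)] have "plot m (total F) (\<lambda>u. R (y u) (Q (\<beta> (y u)) (b u))) z"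
        by this (use evZ[OF Z] evW evb in eventually_elim, rule fibreD(1)[OF Q1(1)], auto simp: snds)
      then show ?thesis by (rule plot_cong) (use evZ[OF Z] in eventually_elim, simp add: R1)
    next
      case V
      have evb: "\<forall>\<^sub>F u in near m z. b u \<in> fibre F (\<beta>' (y u))" by (rule plot_eventually_fibre[OF F b that])
      have ev\<beta>: "\<forall>\<^sub>F u in near m z. proj F (b u) = \<beta> (y u)"
        using that evV[OF V] by eventually_elim simp
      show ?thesis
        by (rule plot_cong[OF D(11)[OF y(1) b y(2) ev\<beta>]])
           (use evV[OF V] evb in eventually_elim, simp add: R2)
    qed
  qed
qed

text \<open>Travel from the given fibre back to time \<open>t0\<close>, then forward to the new one.
  This turns isomorphisms starting at \<open>t0\<close> into transport between arbitrary times of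
  the box, as the gluing steps require.\<close>

lemma transport_family_imp_transport:
  assumes F: "smooth_vector_bundle F" and fam: "transport_family F t0 W \<beta> P R"
    and id: "\<And>y. y \<in> W \<Longrightarrow> \<beta> y = y"
  shows "transport F W (\<lambda>y v. P y (R (proj F v) v))"
proof -
  note D = transport_familyD[OF fam]
  have R: "R (proj F v) v \<in> fibre F (t0, snd (proj F v))" "P (proj F v) (R (proj F v) v) = v"
    if "v \<in> bundle_over F W" for v
    using D(8)[of "proj F v" v] D(9)[of "proj F v" v] id[of "proj F v"] that by (auto simp: bundle_over_def)
  \<comment> \<open>The locale records linearity for \<open>P\<close> only; that of \<open>R\<close>
    follows because \<open>R\<close> inverts it.\<close>
  have R_eqI: "R y w = v" if "y \<in> W" "v \<in> fibre F (t0, snd y)" "P y v = w" for y v w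
    using D(5)[OF that(1,2)] that(3) by simp
  show ?thesis
  proof (rule transport.intro[OF D(1)])
    show "P (proj F v) (R (proj F v) v) = v" if "v \<in> bundle_over F W" for v using R(2)[OF that] .
    fix y v assume y: "y \<in> W" and v: "v \<in> bundle_over F W" and yv: "snd (proj F v) = snd y"
    note Rv = R[OF v, unfolded yv]
    have pv: "proj F v \<in> W" using v by (simp add: bundle_over_def)
    show P: "P y (R (proj F v) v) \<in> fibre F y"
      using D(4)[OF y Rv(1)] id[OF y] by simp
    show "P (proj F v) (R (proj F (P y (R (proj F v) v))) (P y (R (proj F v) v))) = v"
      using fibreD(1)[OF P] D(5)[OF y Rv(1)] Rv(2) by simp
    show "P y (R (proj F (fib_add F v w)) (fib_add F v w)) =
            fib_add F (P y (R (proj F v) v)) (P y (R (proj F w) w))" if w: "w \<in> fibre F (proj F v)" for w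
    proof -
      have pw: "proj F w = proj F v" by (rule fibreD(1)[OF w])
      have vf: "v \<in> fibre F (proj F v)" using v by (auto simp: bundle_over_def)
      have pvw: "proj F (fib_add F v w) = proj F v" by (rule fibreD(1)[OF fibre_add_closed[OF F vf w]])
      have Rw: "R (proj F v) w \<in> fibre F (t0, snd y)" "P (proj F v) (R (proj F v) w) = w"
        using R[of w] fibre_subset_bundle_over[OF w pv] pw yv by auto
      have "R (proj F v) (fib_add F v w) = fib_add F (R (proj F v) v) (R (proj F v) w)"
        by (rule R_eqI[OF pv])
           (use Rv Rw yv D(6)[OF pv] fibre_add_closed[OF F] in auto)
      then show ?thesis using D(6)[OF y Rv(1) Rw(1)] pw pvw by simp
    qed
    show "P y (R (proj F (fib_scale F a v)) (fib_scale F a v)) = fib_scale F a (P y (R (proj F v) v))" for a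
    proof -
      have vf: "v \<in> fibre F (proj F v)" using v by (auto simp: bundle_over_def)
      have pav: "proj F (fib_scale F a v) = proj F v" by (rule fibreD(1)[OF fibre_scale_closed[OF F vf]])
      have "R (proj F v) (fib_scale F a v) = fib_scale F a (R (proj F v) v)"
        by (rule R_eqI[OF pv])
           (use Rv yv D(7)[OF pv] fibre_scale_closed[OF F] in auto)
      then show ?thesis using D(7)[OF y Rv(1)] pav by simp
    qed
  next
    fix m y b z
    assume y: "plot m (base F) y z" "y z \<in> W" and b: "plot m (total F) b z" "proj F (b z) \<in> W"
      and ev: "\<forall>\<^sub>F u in near m z. snd (proj F (b u)) = snd (y u)"
    have evW: "\<forall>\<^sub>F u in near m z. proj F (b u) \<in> W"
      by (rule plot_eventually_in_open[OF charted_base[OF charted_bundleI[OF F]] plot_proj[OF charted_bundleI[OF F] b(1)] D(1) b(2)])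
    have Rb: "plot m (total F) (\<lambda>u. R (proj F (b u)) (b u)) z"
      by (rule D(11)[OF plot_proj[OF charted_bundleI[OF F] b(1)] b]) (use evW in eventually_elim, simp add: id)
    have "\<forall>\<^sub>F u in near m z. b u \<in> bundle_over F W"
      by (rule plot_eventually_in_open[OF charted_total[OF charted_bundleI[OF F]] b(1) openin_bundle_over[OF charted_bundleI[OF F] D(1)]])
         (use b plot_points[OF b(1)] in \<open>simp add: bundle_over_def\<close>)
    then have "\<forall>\<^sub>F u in near m z. proj F (R (proj F (b u)) (b u)) = (t0, snd (y u))"
      using ev by eventually_elim (simp add: fibreD(1)[OF R(1)])
    then show "plot m (total F) (\<lambda>u. P (y u) (R (proj F (b u)) (b u))) z"
      by (rule D(10)[OF y(1) Rb y(2)])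
  qed
qed

section \<open>Boxes that reach from \<open>t0\<close> to a given time\<close>

locale interval_bundle =
  fixes M :: "'a manifold" and I :: "real set" and t0 :: real
    and F :: "(real \<times> 'a, 'e) vector_bundle"
  assumes M: "smooth_manifold M" and open_I: "open I" and interval_I: "is_interval I" and t0_I: "t0 \<in> I"
    and F: "smooth_vector_bundle F"
    and base_F: "base F = product_manifold (open_submanifold real_line I) M"
begin

lemma charted_M: "charted M"
  using M by (rule smooth_manifold_imp_charted)

lemma openin_real_line_I: "openin (mtop real_line) I"
  using open_I by (simp add: real_line_def)

lemma points_base: "points (base F) = I \<times> points M"
  unfolding base_F points_product_manifold by (simp add: open_submanifold_def real_line_def)

lemma mtop_base: "mtop (base F) = prod_topology (top_of_set I) (mtop M)"
  unfolding base_F by (simp add: product_manifold_def open_submanifold_def real_line_def)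

lemma plot_base_iff:
  "plot m (base F) y z \<longleftrightarrow>
     smooth_germ m (\<lambda>u. fst (y u)) z \<and> fst (y z) \<in> I \<and> plot m M (\<lambda>u. snd (y u)) z"
  unfolding base_F
  by (simp add: plot_product_iff[OF charted_open_submanifold[OF charted_real_line openin_real_line_I] charted_M]
      plot_open_submanifold_iff[OF charted_real_line openin_real_line_I] plot_real_line_iff)

lemma plot_fst: "plot m (base F) y z \<Longrightarrow> smooth_germ m (\<lambda>u. fst (y u)) z"
  by (simp add: plot_base_iff)

lemma plot_change_time:
  "plot m (base F) y z \<Longrightarrow> smooth_germ m \<tau> z \<Longrightarrow> \<tau> z \<in> I \<Longrightarrow> plot m (base F) (\<lambda>u. (\<tau> u, snd (y u))) z"
  by (simp add: plot_base_iff)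

lemma openin_box: "open J \<Longrightarrow> J \<subseteq> I \<Longrightarrow> openin (mtop M) U \<Longrightarrow> openin (mtop (base F)) (J \<times> U)"
  by (simp add: mtop_base openin_prod_Times_iff openin_open_eq[OF open_I])

lemma openin_time: "open J \<Longrightarrow> openin (mtop (base F)) {y \<in> points (base F). fst y \<in> J}"
proof -
  assume J: "open J"
  have "{y \<in> points (base F). fst y \<in> J} = (I \<inter> J) \<times> points M"
    by (auto simp: points_base)
  then show ?thesis using openin_box[of "I \<inter> J" "points M"] J open_I by auto
qed

lemma openin_boxE:
  assumes "openin (mtop (base F)) W" "(s, x) \<in> W"
  obtains e U where "e > 0" "ball s e \<subseteq> I" "openin (mtop M) U" "x \<in> U" "ball s e \<times> U \<subseteq> W"
proof -
  obtain J U where J: "openin (top_of_set I) J" "s \<in> J" and U: "openin (mtop M) U" "x \<in> U" "J \<times> U \<subseteq> W"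
    using assms unfolding mtop_base openin_prod_topology_alt by blast
  have "open J" "J \<subseteq> I" using J(1) openin_open_eq[OF open_I] by auto
  moreover obtain e where "e > 0" "ball s e \<subseteq> J" using \<open>open J\<close> J(2) openE by blast
  ultimately show ?thesis using U by (intro that[of e U]) auto
qed

lemma interval_between:
  fixes J :: "real set"
  assumes "is_interval J" "a \<in> J" "b \<in> J" "0 \<le> l" "l \<le> 1"
  shows "a + l * (b - a) \<in> J"
proof -
  have "(1 - l) *\<^sub>R a + l *\<^sub>R b \<in> J"
    using assms by (intro convexD_alt) (auto simp: is_interval_convex_1)
  then show ?thesis by (simp add: algebra_simps)
qed

lemma local_transport:
  assumes "s \<in> I" "x \<in> points M"
  obtains e U Q where "e > 0" "ball s e \<subseteq> I" "openin (mtop M) U" "x \<in> U" "transport F (ball s e \<times> U) Q"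
proof -
  have "(s, x) \<in> points (base F)" using assms by (simp add: points_base)
  then obtain W k \<Phi> where W: "(s, x) \<in> W" "local_trivialization F W k \<Phi>"
    using F unfolding smooth_vector_bundle_def by blast
  obtain Q where Q: "transport F W Q" using local_trivialization_transport[OF F W(2)] by blast
  obtain e U where eU: "e > 0" "ball s e \<subseteq> I" "openin (mtop M) U" "x \<in> U" "ball s e \<times> U \<subseteq> W"
    using openin_boxE[OF transportD(1)[OF Q] W(1)] .
  have "transport F (ball s e \<times> U) Q"
    by (rule transport_subset[OF Q openin_box eU(5)]) (use eU in auto)
  with eU that show ?thesis by blast
qed

lemma transport_imp_family:
  assumes Q: "transport F (J \<times> U) Q" and t0: "t0 \<in> J"
  shows "transport_family F t0 (J \<times> U) (\<lambda>y. y) Q (\<lambda>y. Q (t0, snd y))"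
proof -
  note T = transportD[OF Q]
  have J: "(t0, snd y) \<in> J \<times> U" if "y \<in> J \<times> U" for y using that t0 by auto
  have v: "v \<in> bundle_over F (J \<times> U)" "proj F v = (t0, snd y)" if "y \<in> J \<times> U" "v \<in> fibre F (t0, snd y)" for y v
    using that J[OF that(1)] by (auto simp: bundle_over_def)
  have w: "w \<in> bundle_over F (J \<times> U)" "proj F w = y" if "y \<in> J \<times> U" "w \<in> fibre F y" for y w
    using that by (auto simp: bundle_over_def)
  show ?thesis
  proof (rule transport_family.intro)
    show "Q y v \<in> fibre F y" if "y \<in> J \<times> U" "v \<in> fibre F (t0, snd y)" for y v
      using T(3)[OF that(1) v(1)[OF that]] v(2)[OF that] by simp
    show "Q (t0, snd y) (Q y v) = v" if "y \<in> J \<times> U" "v \<in> fibre F (t0, snd y)" for y v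
      using T(4)[OF that(1) v(1)[OF that]] v(2)[OF that] by simp
    show "Q y (fib_add F v w) = fib_add F (Q y v) (Q y w)"
      if "y \<in> J \<times> U" "v \<in> fibre F (t0, snd y)" "w \<in> fibre F (t0, snd y)" for y v w
      using T(5)[OF that(1) v(1)[OF that(1,2)]] v(2)[OF that(1,2)] that(3) by simp
    show "Q y (fib_scale F a v) = fib_scale F a (Q y v)"
      if "y \<in> J \<times> U" "v \<in> fibre F (t0, snd y)" for y v a
      using T(6)[OF that(1) v(1)[OF that]] v(2)[OF that] by simp
    show "Q (t0, snd y) w \<in> fibre F (t0, snd y)" if "y \<in> J \<times> U" "w \<in> fibre F y" for y w
      using T(3)[OF J[OF that(1)] w(1)[OF that]] w(2)[OF that] by simp
    show "Q y (Q (t0, snd y) w) = w" if "y \<in> J \<times> U" "w \<in> fibre F y" for y w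
      using T(4)[OF J[OF that(1)] w(1)[OF that]] w(2)[OF that] by simp
    fix m y b z assume y: "plot m (base F) y z" "y z \<in> J \<times> U" and b: "plot m (total F) b z"
    show "plot m (total F) (\<lambda>u. Q (y u) (b u)) z" if ev: "\<forall>\<^sub>F u in near m z. proj F (b u) = (t0, snd (y u))"
    proof (rule T(7)[OF y(1) b y(2)])
      show "proj F (b z) \<in> J \<times> U"
        using eventually_near_self[OF ev plot_topspace[OF b]] J[OF y(2)] by simp
      show "\<forall>\<^sub>F u in near m z. snd (proj F (b u)) = snd (y u)" using ev by eventually_elim simp
    qed
    show "plot m (total F) (\<lambda>u. Q (t0, snd (y u)) (b u)) z" if ev: "\<forall>\<^sub>F u in near m z. proj F (b u) = y u"
    proof (rule T(7)[where y="\<lambda>u. (t0, snd (y u))", OF _ b])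
      show "(t0, snd (y z)) \<in> J \<times> U" by (rule J[OF y(2)])
      show "plot m (base F) (\<lambda>u. (t0, snd (y u))) z"
        by (rule plot_change_time[OF y(1) smooth_germ_const[OF plot_topspace[OF b]] t0_I])
      show "proj F (b z) \<in> J \<times> U"
        using eventually_near_self[OF ev plot_topspace[OF b]] y(2) by simp
      show "\<forall>\<^sub>F u in near m z. snd (proj F (b u)) = snd (t0, snd (y u))" using ev by eventually_elim simp
    qed
  qed (use T(1) in auto)
qed

text \<open>The time range \<open>J\<close> is to be an interval containing \<open>t0\<close>, so
  that everything between \<open>t0\<close> and a time in \<open>J\<close> remains inside the
  box.\<close>

definition reachable :: "'a \<Rightarrow> real \<Rightarrow> bool" where
  "reachable x t \<longleftrightarrow> (\<exists>J U P R. open J \<and> is_interval J \<and> J \<subseteq> I \<and> t0 \<in> J \<and> t \<in> J \<and>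
     openin (mtop M) U \<and> x \<in> U \<and> transport_family F t0 (J \<times> U) (\<lambda>y. y) P R)"

text \<open>To pass from \<open>J\<close> to \<open>J' = ball s e\<close> through \<open>r1\<close>, first go to \<open>\<tau> r\<close>, where \<open>\<tau>\<close> is the identity
  well before \<open>r1\<close> and constantly \<open>r1\<close> after it; the sign \<open>\<kappa>\<close> tells on which side of \<open>J'\<close> the
  base time \<open>t0\<close> lies.\<close>

lemma reachable_in_ball:
  assumes x: "x \<in> points M" and eU: "e > 0" "ball s e \<subseteq> I" "openin (mtop M) U'" "x \<in> U'"
    and Q: "transport F (ball s e \<times> U') Q"
    and r1: "r1 \<in> ball s e" "reachable x r1" and r2: "r2 \<in> ball s e"
  shows "reachable x r2"
proof (cases "t0 \<in> ball s e")
  \<comment> \<open>If the ball contains \<open>t0\<close>, its own transport starts there and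
    reaches \<open>r2\<close>. Otherwise \<open>t0\<close> lies on one side of the whole
    ball.\<close>
  case True
  then show ?thesis
    unfolding reachable_def using transport_imp_family[OF Q True] eU r2
    by (intro exI[of _ "ball s e"] exI[of _ U'] exI) (auto simp: is_interval_ball_real)
next
  case False
  obtain J U P R where J: "open J" "is_interval J" "J \<subseteq> I" "t0 \<in> J" "r1 \<in> J"
    and U: "openin (mtop M) U" "x \<in> U" and fam: "transport_family F t0 (J \<times> U) (\<lambda>y. y) P R"
    using r1(2) unfolding reachable_def by blast
  define \<kappa> :: real where "\<kappa> = (if t0 < r1 then 1 else -1)"
  let ?J' = "ball s e"
  have "open (J \<inter> ?J')" "r1 \<in> J \<inter> ?J'" using J r1(1) by auto
  then obtain d0 where d0: "d0 > 0" "ball r1 d0 \<subseteq> J \<inter> ?J'" using openE by metis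
  \<comment> \<open>Two margins before \<open>r1\<close>: \<open>\<tau>\<close> changes only within
    distance \<open>d\<close>, while \<open>J\<close> and the ball are both available up to
    \<open>2 * d\<close>. The gap gives every time outside the wider margin an open neighbourhood on
    which \<open>\<tau>\<close> is the identity.\<close>
  define d where "d = d0 / 2"
  have d: "d > 0" "\<And>r. \<bar>r - r1\<bar> < 2 * d \<Longrightarrow> r \<in> J \<and> r \<in> ?J'"
    using d0 by (auto simp: d_def dist_real_def abs_minus_commute subset_iff)
  define \<tau> where "\<tau> r = r + smooth_step ((\<kappa> * (r - r1) + d) / d) * (r1 - r)" for r
  \<comment> \<open>Past \<open>r1\<close> the time \<open>\<tau> r\<close> remains
    \<open>r1\<close>, and only \<open>Q\<close> can carry the vector on. Hence \<open>J\<close> is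
    cut off at \<open>r1\<close> and continued by the ball.\<close>
  define K where "K = (J \<inter> {r. \<kappa> * r < \<kappa> * r1}) \<union> ?J'"
  have \<kappa>: "\<kappa> = 1 \<and> t0 < r1 \<and> (\<forall>r\<in>?J'. t0 < r) \<or> \<kappa> = -1 \<and> r1 < t0 \<and> (\<forall>r\<in>?J'. r < t0)"
  proof (cases "t0 < r1")
    case True
    then have "t0 < r" if "r \<in> ?J'" for r using that r1(1) False by (auto simp: dist_real_def)
    with True show ?thesis by (auto simp: \<kappa>_def)
  next
    case nlt: False
    then have "r < t0" if "r \<in> ?J'" for r using that r1(1) False by (auto simp: dist_real_def)
    with nlt r1(1) show ?thesis by (auto simp: \<kappa>_def)
  qed
  have K: "open K" "is_interval K" "K \<subseteq> I" "t0 \<in> K" "r2 \<in> K"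
  proof -
    show "open K" unfolding K_def using J(1) by (intro open_Un open_Int open_Collect_less) (auto intro: continuous_intros)
    have "is_interval {r. \<kappa> * r < \<kappa> * r1}" unfolding is_interval_1 using \<kappa> by auto
    then have 1: "is_interval (J \<inter> {r. \<kappa> * r < \<kappa> * r1})" using J(2) by (rule is_interval_Int[rotated])
    \<comment> \<open>A common point of the two pieces, so that their union is connected and hence
      an interval.\<close>
    have "r1 - \<kappa> * d \<in> (J \<inter> {r. \<kappa> * r < \<kappa> * r1}) \<inter> ?J'"
      using d(2)[of "r1 - \<kappa> * d"] d(1) \<kappa> by auto
    then show "is_interval K"
      unfolding K_def is_interval_connected_1 using 1
      by (intro connected_Un) (auto simp: is_interval_connected_1 connected_ball)
    show "K \<subseteq> I" using J(3) eU(2) by (auto simp: K_def)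
    show "t0 \<in> K" using J(4) \<kappa> by (auto simp: K_def)
    show "r2 \<in> K" using r2 by (simp add: K_def)
  qed
  have step0: "\<tau> r = r" if "\<kappa> * r \<le> \<kappa> * r1 - d" for r
  proof -
    have "(\<kappa> * (r - r1) + d) / d \<le> 0" using that d(1) by (intro divide_nonpos_pos) (auto simp: algebra_simps)
    then show ?thesis by (simp add: \<tau>_def smooth_step_eq_0)
  qed
  have step1: "\<tau> r = r1" if "\<kappa> * r1 \<le> \<kappa> * r" for r
  proof -
    have "(\<kappa> * (r - r1) + d) / d \<ge> 1" using that d(1) by (auto simp: le_divide_eq algebra_simps)
    then show ?thesis by (simp add: \<tau>_def smooth_step_eq_1)
  qed
  have \<tau>_near: "\<tau> r \<in> J \<and> \<tau> r \<in> ?J'" if r: "\<kappa> * r1 - 2 * d < \<kappa> * r" for r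
  proof (cases "\<kappa> * r1 \<le> \<kappa> * r")
    case True
    then show ?thesis using step1 J(5) r1(1) by simp
  next
    case False
    let ?l = "smooth_step ((\<kappa> * (r - r1) + d) / d)"
    have a: "\<bar>r1 - r\<bar> < 2 * d" using r False \<kappa> by auto
    \<comment> \<open>\<open>\<tau> r\<close> lies between \<open>r\<close> and \<open>r1\<close>,
      so it is no farther from \<open>r1\<close> than \<open>r\<close> is.\<close>
    have "\<bar>\<tau> r - r1\<bar> = \<bar>1 - ?l\<bar> * \<bar>r - r1\<bar>"
      unfolding abs_mult[symmetric] by (simp add: \<tau>_def algebra_simps)
    also have "\<dots> \<le> 1 * \<bar>r - r1\<bar>"
      using smooth_step_bounds[of "(\<kappa> * (r - r1) + d) / d"] by (intro mult_right_mono) auto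
    finally show ?thesis using a by (intro d(2)) auto
  qed
  have r_near: "r \<in> ?J'" if "r \<in> K" "\<kappa> * r1 - 2 * d < \<kappa> * r" for r
  proof (cases "r \<in> ?J'")
    case False
    then have "\<bar>r - r1\<bar> < 2 * d" using that \<kappa> by (auto simp: K_def)
    then show ?thesis by (rule conjunct2[OF d(2)])
  qed
  have \<tau>_J: "\<tau> r \<in> J" if "r \<in> K" for r
  proof (cases "\<kappa> * r1 - 2 * d < \<kappa> * r")
    case True then show ?thesis using \<tau>_near by blast
  next
    case False
    then have 1: "\<tau> r = r" using d(1) by (intro step0) auto
    have 2: "\<kappa> * r < \<kappa> * r1" using False d(1) by linarith
    show ?thesis
    proof (cases "r \<in> ?J'")
      case True
      \<comment> \<open>A time of the ball before \<open>r1\<close> lies between \<open>t0\<close>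
        and \<open>r1\<close>, thus in the interval \<open>J\<close>.\<close>
      have "\<kappa> = 1 \<and> t0 < r \<or> \<kappa> = -1 \<and> r < t0" using \<kappa> True by blast
      then have "t0 \<le> r \<and> r \<le> r1 \<or> r1 \<le> r \<and> r \<le> t0" using 2 by auto
      then have "r \<in> J" using J(2,4,5) unfolding is_interval_1 by blast
      with 1 show ?thesis by simp
    next
      case False with that 1 show ?thesis by (simp add: K_def)
    qed
  qed
  let ?W = "K \<times> (U \<inter> U')"
  let ?\<theta> = "\<lambda>y. (\<tau> (fst y), snd y)"
  have W: "openin (mtop (base F)) ?W" using K U eU by (intro openin_box openin_Int) auto
  have p\<theta>: "plot m (base F) (\<lambda>u. ?\<theta> (y u)) z" if y: "plot m (base F) y z" "y z \<in> ?W" for m y z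
  proof (rule plot_change_time[OF y(1)])
    note c = smooth_germ_const[OF plot_topspace[OF y(1)]] and f = plot_fst[OF y(1)]
    have "smooth_germ m (\<lambda>u. fst (y u) +
        smooth_step ((\<kappa> * (fst (y u) - r1) + d) * (1 / d)) * (r1 - fst (y u))) z"
      by (intro smooth_germ_add smooth_germ_mult smooth_germ_diff smooth_germ_smooth_step c f)
    then show "smooth_germ m (\<lambda>u. \<tau> (fst (y u))) z" unfolding \<tau>_def by simp
    show "\<tau> (fst (y z)) \<in> I" using y(2) \<tau>_J J(3) by auto
  qed
  have fam1: "transport_family F t0 ?W ?\<theta> (\<lambda>y. P (?\<theta> y)) (\<lambda>y. R (?\<theta> y))"
    by (rule transport_family_reparametrize[OF fam W _ p\<theta> charted_base[OF charted_bundleI[OF F]]]) (use \<tau>_J in auto)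
  \<comment> \<open>The reparametrized family stops at time \<open>\<tau> (fst y)\<close>; transport
    over the ball covers the rest of the way to \<open>y\<close>.\<close>
  have "transport_family F t0 ?W (\<lambda>y. y)
      (step_forward (?J' \<times> U') Q ?\<theta> (\<lambda>y. y) (\<lambda>y. P (?\<theta> y)))
      (step_backward (?J' \<times> U') Q ?\<theta> (\<lambda>y. y) (\<lambda>y. R (?\<theta> y)))"
  proof (rule transport_family_step[OF F fam1 Q])
    fix y assume y: "y \<in> ?W"
    show "?\<theta> y \<in> ?J' \<times> U' \<and> y \<in> ?J' \<times> U' \<or>
        (\<exists>V. openin (mtop (base F)) V \<and> y \<in> V \<and> (\<forall>y'\<in>V. y' = ?\<theta> y'))"
    proof (cases "\<kappa> * r1 - 2 * d < \<kappa> * fst y")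
      case True
      then show ?thesis using y \<tau>_near r_near by auto
    next
      case False
      let ?V = "{y \<in> points (base F). fst y \<in> {r. \<kappa> * r < \<kappa> * r1 - d}}"
      have "openin (mtop (base F)) ?V"
        by (intro openin_time open_Collect_less continuous_intros)
      moreover have "y \<in> ?V" using False d(1) y K(3) openin_subset[OF W] by auto
      moreover have "\<forall>y'\<in>?V. y' = ?\<theta> y'" using step0 by (auto simp: prod_eq_iff)
      ultimately show ?thesis by blast
    qed
  qed auto
  then show ?thesis
    unfolding reachable_def using K U eU by (intro exI[of _ K] exI[of _ "U \<inter> U'"] exI) auto
qed

text \<open>Within a ball that carries a transport, one reachable time makes all times reachable.
  Reachability is thus locally constant, and connectedness of \<open>I\<close> spreads it from
  \<open>t0\<close>.\<close>

lemma reachable: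
  assumes x: "x \<in> points M" and t: "t \<in> I"
  shows "reachable x t"
proof (rule connected_induction_simple[where S=I and a=t0])
  show "connected I" using interval_I by (simp add: is_interval_connected_1)
  obtain e U Q where "e > 0" "ball t0 e \<subseteq> I" "openin (mtop M) U" "x \<in> U" "transport F (ball t0 e \<times> U) Q"
    using local_transport[OF t0_I x] .
  then show "reachable x t0"
    unfolding reachable_def using transport_imp_family[of "ball t0 e" U Q]
    by (intro exI[of _ "ball t0 e"] exI[of _ U] exI) (auto simp: is_interval_ball_real)
  fix s assume s: "s \<in> I"
  obtain e U Q where Q: "e > 0" "ball s e \<subseteq> I" "openin (mtop M) U" "x \<in> U" "transport F (ball s e \<times> U) Q"
    using local_transport[OF s x] .
  then have "\<forall>r1\<in>ball s e. \<forall>r2\<in>ball s e. reachable x r1 \<longrightarrow> reachable x r2"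
    using reachable_in_ball[OF x Q] by blast
  moreover have "openin (top_of_set I) (ball s e)" using Q(2) by (simp add: openin_open_eq[OF open_I])
  ultimately show "\<exists>T. openin (top_of_set I) T \<and> s \<in> T \<and> (\<forall>x'\<in>T. \<forall>y\<in>T. reachable x x' \<longrightarrow> reachable x y)"
    using Q(1) by (intro exI[of _ "ball s e"]) auto
qed (use t t0_I in auto)

end

section \<open>Bump functions on manifolds\<close>

lemma compactin_Euclidean_cube:
  assumes "a \<in> topspace (Euc n)"
  shows "compactin (Euc n) {b \<in> topspace (Euc n). \<forall>i<n. \<bar>b i - a i\<bar> \<le> d}"
proof -
  \<comment> \<open>With \<open>{0}\<close> in the coordinates beyond \<open>n\<close>, the cube
    becomes a product of compact sets, to which Tychonoff's theorem applies.\<close>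
  let ?S = "\<lambda>i. if i < n then {a i - d..a i + d} else {0}"
  have "compactin (powertop_real UNIV) (Pi\<^sub>E UNIV ?S)"
    by (auto simp: compactin_PiE)
  moreover have "Pi\<^sub>E UNIV ?S = {b \<in> topspace (Euc n). \<forall>i<n. \<bar>b i - a i\<bar> \<le> d}" (is "?L = ?R")
  proof (intro set_eqI iffI)
    fix b assume "b \<in> ?L"
    then have b: "b i \<in> ?S i" for i by blast
    have "b i = 0" if "i \<ge> n" for i using b[of i] that by simp
    moreover have "\<bar>b i - a i\<bar> \<le> d" if "i < n" for i using b[of i] that by (simp add: abs_le_iff)
    ultimately show "b \<in> ?R" by (simp add: topspace_Euclidean_space)
  next
    fix b assume "b \<in> ?R"
    then show "b \<in> ?L" by (auto simp: topspace_Euclidean_space abs_le_iff algebra_simps)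
  qed
  ultimately show ?thesis
    unfolding Euclidean_space_def by (auto simp: compactin_subtopology)
qed

text \<open>The local form of vanishing off \<open>Z\<close> expresses that the closed support lies
  in \<open>Z\<close>. It supplies the alternative that \<open>transport_family_step\<close> asks
  for.\<close>

definition bump :: "'a manifold \<Rightarrow> 'a set \<Rightarrow> ('a \<Rightarrow> real) \<Rightarrow> 'a set \<Rightarrow> bool" where
  "bump N Z \<rho> V \<longleftrightarrow> (\<forall>q. 0 \<le> \<rho> q \<and> \<rho> q \<le> 1) \<and> openin (mtop N) V \<and> (\<forall>q\<in>V. \<rho> q = 1) \<and>
     (\<forall>q\<in>points N. q \<in> Z \<or> (\<exists>G. openin (mtop N) G \<and> q \<in> G \<and> (\<forall>q'\<in>G. \<rho> q' = 0))) \<and>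
     (\<forall>m \<phi> z. plot m N \<phi> z \<longrightarrow> smooth_germ m (\<lambda>u. \<rho> (\<phi> u)) z)"

text \<open>A function of the distance in one chart is extended by zero. It vanishes off the image
  \<open>K\<close> of a compact cube, and \<open>K\<close> is closed because the manifold is
  Hausdorff; so the extension vanishes near every point outside the chart domain.\<close>

lemma ex_bump:
  assumes N: "smooth_manifold N" and Z: "openin (mtop N) Z" "p \<in> Z"
  shows "\<exists>\<rho> V. bump N Z \<rho> V \<and> p \<in> V"
proof -
  have N': "charted N" using N by (rule smooth_manifold_imp_charted)
  have pN: "p \<in> points N" using Z openin_subset by blast
  obtain c where c: "c \<in> atlas N" "p \<in> chart_dom c" using N' pN by (rule charted_chartE)
  note cc = charted_chart_on[OF N' c(1)]
  define n where "n = chart_dim c"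
  define a where "a = chart_map c p"
  have aE: "a \<in> topspace (Euc n)" using chart_map_topspace[OF cc c(2)] by (simp add: a_def n_def)
  let ?T = "chart_map c ` (chart_dom c \<inter> Z)"
  have T: "openin (Euc n) ?T" "a \<in> ?T"
    using chart_on_image_open[OF cc Z(1)] c(2) Z(2) by (auto simp: n_def a_def)
  obtain e where e: "e > 0"
    "\<And>b. b \<in> topspace (Euc n) \<Longrightarrow> (\<And>i. i < n \<Longrightarrow> \<bar>b i - a i\<bar> < e) \<Longrightarrow> b \<in> ?T"
    using openin_Euclidean_spaceE[OF T] by blast
  \<comment> \<open>The closed cube of half-width \<open>d\<close> must fit into the open cube of
    half-width \<open>e\<close>.\<close>
  define d where "d = e / 2"
  have d: "0 < d" "d < e" using e(1) by (auto simp: d_def)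
  \<comment> \<open>Squared distance, written with products because germs are closed under
    these.\<close>
  define r where "r b = (\<Sum>i<n. (b i - a i) * (b i - a i))" for b :: "nat \<Rightarrow> real"
  \<comment> \<open>The constants make the argument \<open>\<ge> 1\<close> for
    \<open>r b \<le> d\<^sup>2 / 2\<close>, which gives the plateau, and \<open>\<le> 0\<close> for
    \<open>r b \<ge> d\<^sup>2\<close>, which holds outside the cube.\<close>
  define h where "h b = smooth_step (2 - (2 / d\<^sup>2) * r b)" for b
  define \<rho> where "\<rho> q = (if q \<in> chart_dom c then h (chart_map c q) else 0)" for q
  let ?K' = "{b \<in> topspace (Euc n). \<forall>i<n. \<bar>b i - a i\<bar> \<le> d}"
  have K'T: "?K' \<subseteq> ?T" using d(2) by (auto intro!: e(2))
  then have K'c: "?K' \<subseteq> chart_map c ` chart_dom c" by blast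
  define K where "K = chart_inv c ` ?K'"
  have "compactin (subtopology (Euc n) (chart_map c ` chart_dom c)) ?K'"
    using compactin_Euclidean_cube[OF aE] K'c by (simp add: compactin_subtopology)
  then have "compactin (mtop N) K"
    unfolding K_def n_def by (rule image_compactin[OF _ chart_inv_continuous[OF cc]])
  then have "closedin (mtop N) K"
    using N compactin_imp_closedin unfolding smooth_manifold_def by blast
  then have G: "openin (mtop N) (points N - K)" by blast
  have KZ: "K \<subseteq> Z"
    using K'T by (force simp: K_def chart_inv_chart_map[OF cc])
  have rho0: "\<rho> q = 0" if q: "q \<notin> K" for q
  proof (cases "q \<in> chart_dom c")
    case True
    let ?b = "chart_map c q"
    have bE: "?b \<in> topspace (Euc n)" using chart_map_topspace[OF cc True] by (simp add: n_def)
    have "?b \<notin> ?K'"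
    proof
      assume "?b \<in> ?K'"
      then have "chart_inv c ?b \<in> K" unfolding K_def by (rule imageI)
      then show False using q by (simp add: chart_inv_chart_map[OF cc True])
    qed
    then obtain i where i: "i < n" "\<bar>?b i - a i\<bar> > d" using bE by force
    have "d\<^sup>2 \<le> \<bar>?b i - a i\<bar>\<^sup>2" using i(2) d(1) by (intro power_mono) auto
    also have "\<dots> = (?b i - a i) * (?b i - a i)" by (simp add: power2_eq_square)
    also have "\<dots> \<le> r ?b"
      unfolding r_def using i(1) by (intro member_le_sum) auto
    finally have "2 - (2 / d\<^sup>2) * r ?b \<le> 0" using d(1) by (simp add: field_simps)
    then show ?thesis using True by (simp add: \<rho>_def h_def smooth_step_eq_0)
  qed (simp add: \<rho>_def)
  have germ_r: "smooth_germ m (\<lambda>u. r (w u)) z"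
    if "\<And>i. i < n \<Longrightarrow> smooth_germ m (\<lambda>u. w u i) z" "z \<in> topspace (Euc m)" for m w z
    unfolding r_def using that
    by (intro smooth_germ_sum smooth_germ_mult smooth_germ_diff smooth_germ_const) auto
  have "\<forall>\<^sub>F b in near n a. r b \<in> {..<d\<^sup>2 / 2}"
  proof (rule smooth_germ_eventually_in_open)
    show "smooth_germ n r a" using germ_r[of n "\<lambda>u. u" a] aE smooth_germ_coordinate by simp
    show "r a \<in> {..<d\<^sup>2 / 2}" using d(1) by (simp add: r_def)
  qed auto
  then obtain V' where V': "openin (Euc n) V'" "a \<in> V'" "\<And>b. b \<in> V' \<Longrightarrow> r b < d\<^sup>2 / 2"
    using aE unfolding eventually_nhdsin by auto
  have "bump N Z \<rho> {x \<in> chart_dom c. chart_map c x \<in> V'}"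
    unfolding bump_def
  proof (intro conjI ballI allI impI)
    show "0 \<le> \<rho> q" "\<rho> q \<le> 1" for q
      using smooth_step_bounds by (auto simp: \<rho>_def h_def)
    show "openin (mtop N) {x \<in> chart_dom c. chart_map c x \<in> V'}"
      using chart_on_preimage_open[OF cc] V'(1) by (simp add: n_def)
    show "\<rho> q = 1" if q: "q \<in> {x \<in> chart_dom c. chart_map c x \<in> V'}" for q
    proof -
      have "2 - (2 / d\<^sup>2) * r (chart_map c q) \<ge> 1"
        using V'(3)[of "chart_map c q"] q d(1) by (simp add: field_simps)
      then show ?thesis using q by (simp add: \<rho>_def h_def smooth_step_eq_1)
    qed
    show "q \<in> Z \<or> (\<exists>G. openin (mtop N) G \<and> q \<in> G \<and> (\<forall>q'\<in>G. \<rho> q' = 0))" if "q \<in> points N" for q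
      using KZ G rho0 that by (cases "q \<in> K") auto
    fix m \<phi> z assume p: "plot m N \<phi> z"
    show "smooth_germ m (\<lambda>u. \<rho> (\<phi> u)) z"
    proof (cases "\<phi> z \<in> chart_dom c")
      case True
      have "smooth_germ m (\<lambda>u. h (chart_map c (\<phi> u))) z"
        unfolding h_def using plot_coordinate[OF p c(1) True] plot_topspace[OF p]
        by (intro smooth_germ_smooth_step smooth_germ_diff smooth_germ_mult germ_r smooth_germ_const) (auto simp: n_def)
      then show ?thesis
        by (rule smooth_germ_cong)
           (use plot_eventually_chart[OF p c(1) True] in eventually_elim, simp add: \<rho>_def)
    next
      case False
      have "K \<subseteq> chart_dom c" using K'c by (force simp: K_def chart_inv_chart_map[OF cc])
      then have "\<phi> z \<in> points N - K" using False plot_points[OF p] by blast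
      from plot_eventually_in_open[OF N' p G this] have ev: "\<forall>\<^sub>F u in near m z. 0 = \<rho> (\<phi> u)"
        by eventually_elim (simp add: rho0)
      show ?thesis by (rule smooth_germ_cong[OF smooth_germ_const[OF plot_topspace[OF p]] ev])
    qed
  qed
  moreover have "p \<in> {x \<in> chart_dom c. chart_map c x \<in> V'}" using c(2) V'(2) by (simp add: a_def)
  ultimately show ?thesis by blast
qed

section \<open>Composition of countably many steps\<close>

context interval_bundle
begin

text \<open>Moving the fraction \<open>\<rho> n\<close> of the remaining way in each step, a point arrives exactly after the
  first step whose plateau contains it; hence no local finiteness is required.\<close>

primrec progress :: "(nat \<Rightarrow> real \<times> 'a \<Rightarrow> real) \<Rightarrow> nat \<Rightarrow> real \<times> 'a \<Rightarrow> real" where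
  "progress \<rho> 0 y = 0"
| "progress \<rho> (Suc n) y = progress \<rho> n y + \<rho> n y * (1 - progress \<rho> n y)"

definition midpoint :: "(nat \<Rightarrow> real \<times> 'a \<Rightarrow> real) \<Rightarrow> nat \<Rightarrow> real \<times> 'a \<Rightarrow> real \<times> 'a" where
  "midpoint \<rho> n y = (t0 + progress \<rho> n y * (fst y - t0), snd y)"

primrec forward where
  "forward Z Q \<rho> 0 = (\<lambda>y v. v)"
| "forward Z Q \<rho> (Suc n) = step_forward (Z n) (Q n) (midpoint \<rho> n) (midpoint \<rho> (Suc n)) (forward Z Q \<rho> n)"

primrec backward where
  "backward Z Q \<rho> 0 = (\<lambda>y w. w)"
| "backward Z Q \<rho> (Suc n) = step_backward (Z n) (Q n) (midpoint \<rho> n) (midpoint \<rho> (Suc n)) (backward Z Q \<rho> n)"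

lemma progress_bounds:
  assumes "\<And>n q. 0 \<le> \<rho> n q \<and> \<rho> n q \<le> 1"
  shows "0 \<le> progress \<rho> n y \<and> progress \<rho> n y \<le> 1"
proof (induction n)
  case (Suc n)
  have "\<rho> n y * (1 - progress \<rho> n y) \<le> 1 * (1 - progress \<rho> n y)"
    using Suc assms by (intro mult_right_mono) auto
  then show ?case using Suc assms[of n y] by auto
qed simp

lemma midpoint_plot:
  assumes \<rho>: "\<And>n q. 0 \<le> \<rho> n q \<and> \<rho> n q \<le> 1"
    and p\<rho>: "\<And>n m \<phi> z. plot m (base F) \<phi> z \<Longrightarrow> smooth_germ m (\<lambda>u. \<rho> n (\<phi> u)) z"
    and y: "plot m (base F) y z"
  shows "plot m (base F) (\<lambda>u. midpoint \<rho> n (y u)) z"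
  unfolding midpoint_def
proof (rule plot_change_time[OF y])
  note c = smooth_germ_const[OF plot_topspace[OF y]]
  have "smooth_germ m (\<lambda>u. progress \<rho> n (y u)) z"
    by (induction n) (auto intro!: smooth_germ_add smooth_germ_mult smooth_germ_diff c p\<rho>[OF y])
  then show "smooth_germ m (\<lambda>u. t0 + progress \<rho> n (y u) * (fst (y u) - t0)) z"
    by (intro smooth_germ_add smooth_germ_mult smooth_germ_diff c plot_fst[OF y])
  have "0 \<le> progress \<rho> n (y z) \<and> progress \<rho> n (y z) \<le> 1" by (rule progress_bounds[OF \<rho>])
  moreover have "fst (y z) \<in> I" using plot_points[OF y] by (auto simp: points_base)
  ultimately show "t0 + progress \<rho> n (y z) * (fst (y z) - t0) \<in> I"
    by (intro interval_between[OF interval_I t0_I]) auto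
qed

lemma progress_eq_1:
  assumes "\<rho> j y = 1" "n > j"
  shows "progress \<rho> n y = 1"
  using assms(2)
proof (induction n)
  case (Suc n)
  then show ?case using assms(1) by (cases "n = j") auto
qed simp

definition transport_box where
  "transport_box y J U Q \<rho> V \<longleftrightarrow>
     is_interval J \<and> t0 \<in> J \<and> transport F (J \<times> U) Q \<and> bump (base F) (J \<times> U) \<rho> V \<and> y \<in> V"

lemma ex_transport_box:
  assumes y: "y \<in> points (base F)"
  shows "\<exists>J U Q \<rho> V. transport_box y J U Q \<rho> V"
proof -
  have smB: "smooth_manifold (base F)" using F unfolding smooth_vector_bundle_def by blast
  have "reachable (snd y) (fst y)" using y by (intro reachable) (auto simp: points_base)
  then obtain J U P R where J: "is_interval J" "t0 \<in> J" "fst y \<in> J"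
    and U: "snd y \<in> U" and fam: "transport_family F t0 (J \<times> U) (\<lambda>y. y) P R"
    unfolding reachable_def by blast
  have Q: "transport F (J \<times> U) (\<lambda>y v. P y (R (proj F v) v))"
    by (rule transport_family_imp_transport[OF F fam]) simp
  have "y \<in> J \<times> U" using J U by (simp add: mem_Times_iff)
  from ex_bump[OF smB transportD(1)[OF Q] this] J Q show ?thesis
    unfolding transport_box_def by blast
qed

text \<open>Each point uses the stage at which it has just arrived, so the stage \<open>N y\<close>
  varies with \<open>y\<close>. Near a given point a fixed later stage gives the same maps, and
  smoothness is inherited from there.\<close>

lemma global_family:
  obtains P R where "transport_family F t0 (points (base F)) (\<lambda>y. y) P R"
proof (cases "points (base F) = {}")
  \<comment> \<open>Over an empty base there is no box to enumerate; every condition holds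
    vacuously.\<close>
  case True
  have "transport_family F t0 (points (base F)) (\<lambda>y. y) (\<lambda>y v. v) (\<lambda>y v. v)"
    unfolding True by (rule transport_family.intro) auto
  then show ?thesis by (rule that)
next
  case False
  let ?B = "mtop (base F)"
  have smB: "smooth_manifold (base F)" using F unfolding smooth_vector_bundle_def by blast
  have cB: "charted (base F)" by (rule charted_base[OF charted_bundleI[OF F]])
  obtain J U Q \<rho> V where
    box: "\<And>y. y \<in> points (base F) \<Longrightarrow> transport_box y (J y) (U y) (Q y) (\<rho> y) (V y)"
    using ex_transport_box by metis
  have J: "is_interval (J y)" "t0 \<in> J y" and Q: "transport F (J y \<times> U y) (Q y)"
    and \<rho>: "0 \<le> \<rho> y q \<and> \<rho> y q \<le> 1" and V: "openin ?B (V y)" "y \<in> V y" "q \<in> V y \<Longrightarrow> \<rho> y q = 1"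
    and p\<rho>0: "plot m (base F) \<phi> z \<Longrightarrow> smooth_germ m (\<lambda>u. \<rho> y (\<phi> u)) z"
    if "y \<in> points (base F)" for y q m \<phi> z
    using box[OF that] by (simp_all add: transport_box_def bump_def del: split_paired_All)
  have \<rho>0: "q \<in> J y \<times> U y \<or> (\<exists>G. openin ?B G \<and> q \<in> G \<and> (\<forall>q'\<in>G. \<rho> y q' = 0))"
    if "y \<in> points (base F)" "q \<in> points (base F)" for y q
    using box[OF that(1)] that(2) unfolding transport_box_def bump_def by meson
  \<comment> \<open>Second countability selects countably many plateaus that still cover the
    base.\<close>
  have "Lindelof_space ?B"
    using smB second_countable_imp_Lindelof_space unfolding smooth_manifold_def by blast
  moreover have "\<forall>u\<in>V ` points (base F). openin ?B u" using V(1) by blast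
  moreover have "\<Union>(V ` points (base F)) = points (base F)"
    using V(1,2) openin_subset by fast
  ultimately obtain \<V> where \<V>: "countable \<V>" "\<V> \<subseteq> V ` points (base F)" "\<Union>\<V> = points (base F)"
    unfolding Lindelof_space_def by meson
  then obtain Y where Y: "countable Y" "Y \<subseteq> points (base F)" "\<V> = V ` Y"
    by (meson countable_subset_image)
  have "Y \<noteq> {}" using False \<V>(3) Y(3) by (metis Union_empty image_empty)
  \<comment> \<open>The enumeration by natural numbers repeats boxes if \<open>Y\<close> is finite;
    a repeated box finds its plateau points already at their goal.\<close>
  then have rng: "range (from_nat_into Y) = Y" using Y(1) by (rule range_from_nat_into)
  define f where "f = from_nat_into Y"
  have f: "f n \<in> points (base F)" for n using rng Y(2) by (auto simp: f_def)
  have cover: "\<exists>n. y \<in> V (f n)" if "y \<in> points (base F)" for y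
  proof -
    have "y \<in> \<Union>(V ` Y)" using that unfolding \<V>(3)[symmetric] Y(3) .
    then obtain y' where "y' \<in> Y" "y \<in> V y'" by (rule UN_E)
    moreover obtain n where "f n = y'" using rng \<open>y' \<in> Y\<close> unfolding f_def by (metis rangeE)
    ultimately show ?thesis by blast
  qed
  define \<rho>' where "\<rho>' n = \<rho> (f n)" for n
  define Z' where "Z' n = J (f n) \<times> U (f n)" for n
  define Q' where "Q' n = Q (f n)" for n
  have \<rho>01: "0 \<le> \<rho>' n q \<and> \<rho>' n q \<le> 1" for n q using \<rho>[OF f] by (simp add: \<rho>'_def)
  have p\<rho>: "smooth_germ m (\<lambda>u. \<rho>' n (\<phi> u)) z" if "plot m (base F) \<phi> z" for n m \<phi> z
    using p\<rho>0[OF f that] by (simp add: \<rho>'_def)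
  have Q': "transport F (Z' n) (Q' n)" for n using Q[OF f] by (simp add: Z'_def Q'_def)
  have V1: "\<rho>' n q = 1" if "q \<in> V (f n)" for n q using V(3)[OF f that] by (simp add: \<rho>'_def)
  have Vo: "openin ?B (V (f n))" for n by (rule V(1)[OF f])
  let ?\<beta> = "midpoint \<rho>'" and ?P = "forward Z' Q' \<rho>'" and ?R = "backward Z' Q' \<rho>'"
  have p\<beta>: "plot m (base F) (\<lambda>u. ?\<beta> n (y u)) z" if "plot m (base F) y z" for n m y z
    by (rule midpoint_plot[where \<rho>=\<rho>']) (fact \<rho>01, erule p\<rho>, fact that)
  have fam: "transport_family F t0 (points (base F)) (?\<beta> n) (?P n) (?R n)" for n
  proof (induction n)
    case 0
    show ?case
    proof (rule transport_family.intro)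
      show "plot m (base F) (\<lambda>u. ?\<beta> 0 (y u)) z" if "plot m (base F) y z" for m y z by (rule p\<beta>[OF that])
    qed (auto simp: midpoint_def)
  next
    case (Suc n)
    show ?case
      unfolding forward.simps backward.simps
    proof (rule transport_family_step[OF F Suc.IH Q'])
      fix y assume y: "y \<in> points (base F)"
      have "y \<in> Z' n \<or> (\<exists>G. openin ?B G \<and> y \<in> G \<and> (\<forall>q'\<in>G. \<rho>' n q' = 0))"
        using \<rho>0[OF f y] by (simp add: Z'_def \<rho>'_def)
      then show "?\<beta> n y \<in> Z' n \<and> ?\<beta> (Suc n) y \<in> Z' n \<or>
          (\<exists>V. openin ?B V \<and> y \<in> V \<and> (\<forall>y'\<in>V. ?\<beta> (Suc n) y' = ?\<beta> n y'))"
      proof (elim disjE exE conjE)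
        \<comment> \<open>\<open>t0\<close> and the time of \<open>y\<close> both lie in the
          interval of the box, hence so does each point between them, at every stage.\<close>
        assume "y \<in> Z' n"
        then have "?\<beta> k y \<in> Z' n" for k
          using J[OF f[of n]] progress_bounds[where \<rho>=\<rho>' and n=k and y=y, OF \<rho>01]
          by (auto simp: Z'_def midpoint_def intro!: interval_between)
        then show ?thesis by blast
      next
        \<comment> \<open>Where \<open>\<rho>' n\<close> vanishes nearby, progress and therefore the
          target stay the same on a whole neighbourhood.\<close>
        fix G assume "openin ?B G" "y \<in> G" "\<forall>q'\<in>G. \<rho>' n q' = 0"
        then show ?thesis by (intro disjI2 exI[of _ G]) (auto simp: midpoint_def)
      qed
    next
      show "snd (?\<beta> (Suc n) y) = snd y" for y by (simp add: midpoint_def)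
      show "plot m (base F) (\<lambda>u. ?\<beta> (Suc n) (y u)) z" if "plot m (base F) y z" for m y z
        by (rule p\<beta>[OF that])
    qed
  qed
  have \<beta>_id: "?\<beta> n y = y" if "y \<in> V (f j)" "n > j" for n j y
    using progress_eq_1[where \<rho>=\<rho>' and y=y, OF V1[OF that(1)] that(2)] by (simp add: midpoint_def)
  \<comment> \<open>From stage \<open>Suc j\<close> on the target is already \<open>y\<close>, so
    further steps act as the identity.\<close>
  have stable: "(v \<in> fibre F (t0, snd y) \<longrightarrow> ?P n y v = ?P (Suc j) y v) \<and>
      (v \<in> fibre F y \<longrightarrow> ?R n y v = ?R (Suc j) y v)" if "y \<in> V (f j)" "n > j" for n j y v
    using that(2)
  proof (induction n)
    case (Suc n)
    have y: "y \<in> points (base F)" using that(1) Vo openin_subset by blast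
    show ?case
    proof (cases "n = j")
      case False
      with Suc have n: "n > j" by simp
      have eq: "?\<beta> (Suc n) y = ?\<beta> n y" "?\<beta> n y = y" using \<beta>_id[OF that(1)] n by auto
      have "?P (Suc n) y v = ?P n y v" if "v \<in> fibre F (t0, snd y)"
        unfolding forward.simps by (rule step_forward_eq[where \<beta>="?\<beta> n" and \<beta>'="?\<beta> (Suc n)", OF fam Q' y eq(1) that])
      moreover have "?R (Suc n) y v = ?R n y v" if "v \<in> fibre F y"
        unfolding backward.simps by (rule step_backward_eq[where \<beta>="?\<beta> n" and \<beta>'="?\<beta> (Suc n)", OF Q' eq(1)]) (simp add: eq(2) that)
      ultimately show ?thesis using Suc.IH[OF n] by (simp del: forward.simps backward.simps)
    qed simp
  qed simp
  \<comment> \<open>The bump with index \<open>j\<close> acts in passing from stage \<open>j\<close>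
    to stage \<open>Suc j\<close>; hence the successor.\<close>
  define N where "N y = Suc (LEAST j. y \<in> V (f j))" for y
  have N: "y \<in> V (f (N y - 1))" "N y > N y - 1" if "y \<in> points (base F)" for y
    using LeastI_ex[OF cover[OF that]] by (auto simp: N_def)
  have \<beta>N: "?\<beta> (N y) y = y" if "y \<in> points (base F)" for y by (rule \<beta>_id[OF N[OF that]])
  have PR_eq: "v \<in> fibre F (t0, snd y) \<Longrightarrow> ?P (Suc j) y v = ?P (N y) y v"
    "v \<in> fibre F y \<Longrightarrow> ?R (Suc j) y v = ?R (N y) y v" if "y \<in> V (f j)" for j y v
  proof -
    have "(LEAST j. y \<in> V (f j)) \<le> j" using that by (rule Least_le)
    moreover have "y \<in> V (f (N y - 1))" using that by (auto simp: N_def intro: LeastI)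
    ultimately have "(v \<in> fibre F (t0, snd y) \<longrightarrow> ?P (Suc j) y v = ?P (N y) y v) \<and>
        (v \<in> fibre F y \<longrightarrow> ?R (Suc j) y v = ?R (N y) y v)"
      using stable[of y "N y - 1" "Suc j" v] by (simp add: N_def)
    then show "v \<in> fibre F (t0, snd y) \<Longrightarrow> ?P (Suc j) y v = ?P (N y) y v"
      "v \<in> fibre F y \<Longrightarrow> ?R (Suc j) y v = ?R (N y) y v" by auto
  qed
  have "transport_family F t0 (points (base F)) (\<lambda>y. y) (\<lambda>y. ?P (N y) y) (\<lambda>y. ?R (N y) y)"
  proof (rule transport_family.intro)
    fix y assume y: "y \<in> points (base F)"
    note D = transport_familyD[OF fam[of "N y"]]
    show "?P (N y) y v \<in> fibre F y" "?R (N y) y (?P (N y) y v) = v"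
      "?P (N y) y (fib_scale F a v) = fib_scale F a (?P (N y) y v)" if "v \<in> fibre F (t0, snd y)" for v a
      using D(4,5,7)[OF y that] \<beta>N[OF y] by auto
    show "?P (N y) y (fib_add F v w) = fib_add F (?P (N y) y v) (?P (N y) y w)"
      if "v \<in> fibre F (t0, snd y)" "w \<in> fibre F (t0, snd y)" for v w
      by (rule D(6)[OF y that])
    show "?R (N y) y w \<in> fibre F (t0, snd y)" "?P (N y) y (?R (N y) y w) = w" if "w \<in> fibre F y" for w
      using D(8,9)[OF y] \<beta>N[OF y] that by auto
  next
    fix m y b z assume y: "plot m (base F) y z" and b: "plot m (total F) b z"
    \<comment> \<open>A plateau around \<open>y z\<close> fixes the stage \<open>Suc j\<close> for
      all nearby parameters, where it agrees with the varying stage \<open>N\<close> by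
      \<open>PR_eq\<close>.\<close>
    obtain j where j: "y z \<in> V (f j)" using cover plot_points[OF y] by blast
    have evV: "\<forall>\<^sub>F u in near m z. y u \<in> V (f j)" by (rule plot_eventually_in_open[OF cB y Vo j])
    note D = transport_familyD[OF fam[of "Suc j"]]
    show "plot m (total F) (\<lambda>u. ?P (N (y u)) (y u) (b u)) z"
      if ev: "\<forall>\<^sub>F u in near m z. proj F (b u) = (t0, snd (y u))"
    proof (rule plot_cong[OF D(10)[OF y b plot_points[OF y] ev]])
      show "\<forall>\<^sub>F u in near m z. ?P (Suc j) (y u) (b u) = ?P (N (y u)) (y u) (b u)"
        using evV plot_eventually_fibre[OF F b ev] by eventually_elim (rule PR_eq(1))
    qed
    show "plot m (total F) (\<lambda>u. ?R (N (y u)) (y u) (b u)) z"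
      if ev: "\<forall>\<^sub>F u in near m z. proj F (b u) = y u"
    proof (rule plot_cong[OF D(11)[OF y b plot_points[OF y]]])
      show "\<forall>\<^sub>F u in near m z. proj F (b u) = ?\<beta> (Suc j) (y u)"
        using ev evV by eventually_elim (simp add: \<beta>_id)
      show "\<forall>\<^sub>F u in near m z. ?R (Suc j) (y u) (b u) = ?R (N (y u)) (y u) (b u)"
        using evV plot_eventually_fibre[OF F b ev] by eventually_elim (rule PR_eq(2))
    qed
  qed auto
  then show ?thesis by (rule that)
qed

end

section \<open>Reparametrized plots and atlases whose inverse charts are plots\<close>

lemma plot_precompose:
  assumes p: "plot n N \<phi> (g z)" and g: "\<And>i. i < n \<Longrightarrow> smooth_germ m (\<lambda>u. g u i) z"
    and z: "z \<in> topspace (Euc m)"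
    and gE: "\<forall>\<^sub>F u in near m z. g u \<in> topspace (Euc n)"
  shows "plot m N (\<lambda>u. \<phi> (g u)) z"
  unfolding plot_def
proof (intro conjI ballI impI allI)
  fix d assume d: "d \<in> atlas N" "\<phi> (g z) \<in> chart_dom d"
  obtain T where T: "openin (Euc n) T" "g z \<in> T" "\<And>u. u \<in> T \<Longrightarrow> \<phi> u \<in> chart_dom d"
    using plot_eventually_chart[OF p d] plot_topspace[OF p] unfolding eventually_nhdsin by blast
  have "\<forall>\<^sub>F u in near m z. g u \<in> T"
    by (rule smooth_germs_eventually_in_open[where g=g]) (use T g gE in auto)
  then show "\<forall>\<^sub>F u in near m z. \<phi> (g u) \<in> chart_dom d"
    by eventually_elim (rule T(3))
  fix j assume "j < chart_dim d"
  from plot_coordinate[OF p d this] g z gE show "smooth_germ m (\<lambda>u. chart_map d (\<phi> (g u)) j) z"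
    by (rule smooth_germ_compose[where g=g])
qed (use z plot_points[OF p] in auto)

lemma continuous_map_plots:
  assumes N: "charted N" and T: "openin (Euc n) T" and p: "\<And>z. z \<in> T \<Longrightarrow> plot n N \<phi> z"
  shows "continuous_map (subtopology (Euc n) T) (mtop N) \<phi>"
  unfolding continuous_map_def
proof (intro conjI allI impI)
  have tT: "topspace (subtopology (Euc n) T) = T" using openin_subset[OF T] by auto
  show "\<phi> \<in> topspace (subtopology (Euc n) T) \<rightarrow> points N"
    unfolding tT using plot_points[OF p] by blast
  fix W assume W: "openin (mtop N) W"
  have "openin (Euc n) {z \<in> T. \<phi> z \<in> W}"
  proof (subst openin_subopen, intro ballI)
    fix z assume z: "z \<in> {z \<in> T. \<phi> z \<in> W}"
    then have "\<forall>\<^sub>F u in near n z. \<phi> u \<in> W" by (intro plot_eventually_in_open[OF N p W]) auto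
    then obtain V where "openin (Euc n) V" "z \<in> V" "\<And>u. u \<in> V \<Longrightarrow> \<phi> u \<in> W"
      using z openin_subset[OF T] unfolding eventually_nhdsin by blast
    then show "\<exists>V. openin (Euc n) V \<and> z \<in> V \<and> V \<subseteq> {z \<in> T. \<phi> z \<in> W}"
      using T z by (intro exI[of _ "V \<inter> T"]) auto
  qed
  then show "openin (subtopology (Euc n) T) {x \<in> topspace (subtopology (Euc n) T). \<phi> x \<in> W}"
    unfolding tT by (auto simp: openin_open_subtopology[OF T])
qed

text \<open>Smoothness of the transition maps, expressed by plots. In this form it passes to open
  submanifolds, products and pullbacks without computing a transition map.\<close>

definition compatible :: "'a manifold \<Rightarrow> bool" where
  "compatible N \<longleftrightarrow> charted N \<and>
     (\<forall>c\<in>atlas N. \<forall>z\<in>chart_map c ` chart_dom c. plot (chart_dim c) N (chart_inv c) z)"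

lemma compatible_imp_charted: "compatible N \<Longrightarrow> charted N"
  by (simp add: compatible_def)

lemma smooth_manifold_imp_compatible: "smooth_manifold N \<Longrightarrow> compatible N"
  by (simp add: compatible_def smooth_manifold_imp_charted plot_chart_inv)

text \<open>The inverse charts of \<open>X\<close> are themselves plots, so preserving plots covers
  the test in \<open>smooth_mapI_plots\<close>; it is the converse of
  \<open>plot_smooth_map\<close>.\<close>

lemma smooth_mapI_compatible:
  assumes "compatible X" "charted Y" "\<And>m \<psi> z. plot m X \<psi> z \<Longrightarrow> plot m Y (\<lambda>u. \<phi> (\<psi> u)) z"
  shows "smooth_map X Y \<phi>"
  using assms by (intro smooth_mapI_plots) (auto simp: compatible_def)

lemma eventually_near_in_open:
  "openin (Euc n) T \<Longrightarrow> z \<in> T \<Longrightarrow> \<forall>\<^sub>F u in near n z. u \<in> T"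
  unfolding eventually_nhdsin by blast

lemma compatible_open_submanifold:
  assumes N: "compatible N" and U: "openin (mtop N) U"
  shows "compatible (open_submanifold N U)"
  unfolding compatible_def
proof (intro conjI ballI)
  note cN = compatible_imp_charted[OF N]
  show "charted (open_submanifold N U)" by (rule charted_open_submanifold[OF cN U])
  fix c' z assume c': "c' \<in> atlas (open_submanifold N U)" and z: "z \<in> chart_map c' ` chart_dom c'"
  obtain c where c: "c \<in> atlas N" and c'_def: "c' = Chart (chart_dom c \<inter> U) (chart_dim c) (chart_map c)"
    using c' by (auto simp: open_submanifold_def)
  note cc = charted_chart_on[OF cN c] and cc' = charted_chart_on[OF charted_open_submanifold[OF cN U] c']
  \<comment> \<open>\<open>chart_inv\<close> depends on the chart domain, so restriction changes it
    as a function. On the image of the smaller domain both inverses agree, which is enough for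
    germs.\<close>
  have inv: "chart_inv c (chart_map c x) = x" "chart_inv c' (chart_map c x) = x" if "x \<in> chart_dom c \<inter> U" for x
    using chart_inv_chart_map[OF cc, of x] chart_inv_chart_map[OF cc', of x] that by (auto simp: c'_def)
  have T: "openin (Euc (chart_dim c)) (chart_map c ` (chart_dom c \<inter> U))"
    by (rule chart_on_image_open[OF cc U])
  have zT: "z \<in> chart_map c ` (chart_dom c \<inter> U)" using z by (simp add: c'_def)
  have "plot (chart_dim c) N (chart_inv c) z" using N c zT by (auto simp: compatible_def)
  moreover have "chart_inv c z \<in> U" using zT inv(1) by auto
  ultimately have "plot (chart_dim c) (open_submanifold N U) (chart_inv c) z"
    by (simp add: plot_open_submanifold_iff[OF cN U])
  then have "plot (chart_dim c) (open_submanifold N U) (chart_inv c') z"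
    by (rule plot_cong) (use eventually_near_in_open[OF T zT] in eventually_elim, auto simp: inv)
  then show "plot (chart_dim c') (open_submanifold N U) (chart_inv c') z" by (simp add: c'_def)
qed

lemma smooth_germ_vec_take:
  "z \<in> topspace (Euc m) \<Longrightarrow> i < n \<Longrightarrow> smooth_germ m (\<lambda>u. vec_take n u i) z"
  by (simp add: vec_take_def smooth_germ_coordinate)

lemma smooth_germ_vec_drop:
  "z \<in> topspace (Euc m) \<Longrightarrow> smooth_germ m (\<lambda>u. vec_drop n u i) z"
  by (simp add: vec_drop_def smooth_germ_coordinate)

lemma eventually_vec_drop: "\<forall>\<^sub>F u in near (n + k) z. vec_drop n u \<in> topspace (Euc k)"
  using eventually_near_topspace by eventually_elim (rule vec_drop_in_Euclidean)

lemma plot_vec_take: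
  assumes "plot n N \<phi> (vec_take n z)" "z \<in> topspace (Euc m)"
  shows "plot m N (\<lambda>u. \<phi> (vec_take n u)) z"
  by (rule plot_precompose[where g="vec_take n", OF assms(1)])
     (use assms(2) in \<open>auto simp: smooth_germ_vec_take vec_take_in_Euclidean\<close>)

lemma plot_vec_drop:
  assumes "plot k N \<phi> (vec_drop n z)" "z \<in> topspace (Euc (n + k))"
  shows "plot (n + k) N (\<lambda>u. \<phi> (vec_drop n u)) z"
  by (rule plot_precompose[where g="vec_drop n", OF assms(1)])
     (use assms(2) in \<open>auto simp: smooth_germ_vec_drop eventually_vec_drop\<close>)

lemma compatible_product_manifold:
  assumes M: "compatible M" and N: "compatible N"
  shows "compatible (product_manifold M N)"
  unfolding compatible_def
proof (intro conjI ballI)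
  note cM = compatible_imp_charted[OF M] and cN = compatible_imp_charted[OF N]
  show cMN: "charted (product_manifold M N)" by (rule charted_product_manifold[OF cM cN])
  fix e z assume e: "e \<in> atlas (product_manifold M N)" and z: "z \<in> chart_map e ` chart_dom e"
  obtain c d where cd: "c \<in> atlas M" "d \<in> atlas N" and e_def: "e = prod_chart c d"
    using e by (auto simp: product_manifold_def)
  note c = charted_chart_on[OF cM cd(1)] and d = charted_chart_on[OF cN cd(2)]
    and ee = charted_chart_on[OF cMN e]
  let ?g = "\<lambda>u. (chart_inv c (vec_take (chart_dim c) u), chart_inv d (vec_drop (chart_dim c) u))"
  have img: "vec_take (chart_dim c) u \<in> chart_map c ` chart_dom c \<and>
      vec_drop (chart_dim c) u \<in> chart_map d ` chart_dom d \<and> ?g u = chart_inv e u"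
    if u: "u \<in> chart_map e ` chart_dom e" for u
  proof -
    obtain x y where xy: "x \<in> chart_dom c" "y \<in> chart_dom d"
      and u_def: "u = vec_append (chart_dim c) (chart_map c x) (chart_map d y)"
      using u by (auto simp: e_def)
    have "chart_inv e u = (x, y)"
      using chart_inv_chart_map[OF ee, of "(x, y)"] xy by (simp add: e_def u_def)
    then show ?thesis
      using xy chart_map_topspace[OF c]
      by (simp add: u_def vec_take_append vec_drop_append chart_inv_chart_map[OF c] chart_inv_chart_map[OF d])
  qed
  have zE: "z \<in> topspace (Euc (chart_dim c + chart_dim d))"
    using z chart_map_topspace[OF ee] by (auto simp: e_def)
  have "plot (chart_dim c + chart_dim d) M (\<lambda>u. chart_inv c (vec_take (chart_dim c) u)) z"
    by (rule plot_vec_take[OF _ zE]) (use M[unfolded compatible_def] cd(1) img[OF z] in blast)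
  moreover have "plot (chart_dim c + chart_dim d) N (\<lambda>u. chart_inv d (vec_drop (chart_dim c) u)) z"
    by (rule plot_vec_drop[OF _ zE]) (use N[unfolded compatible_def] cd(2) img[OF z] in blast)
  ultimately have "plot (chart_dim c + chart_dim d) (product_manifold M N) ?g z"
    by (simp add: plot_product_iff[OF cM cN])
  then have "plot (chart_dim c + chart_dim d) (product_manifold M N) (chart_inv e) z"
  proof (rule plot_cong)
    have "openin (Euc (chart_dim c + chart_dim d)) (chart_map e ` chart_dom e)"
      using chart_on_image_openin[OF ee] by (simp add: e_def)
    from eventually_near_in_open[OF this z]
    show "\<forall>\<^sub>F u in near (chart_dim c + chart_dim d) z. ?g u = chart_inv e u"
      by eventually_elim (use img in blast)
  qed
  then show "plot (chart_dim e) (product_manifold M N) (chart_inv e) z" by (simp add: e_def)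
qed

lemma compatible_euclidean_manifold: "compatible (euclidean_manifold n)"
  unfolding compatible_def
proof (intro conjI ballI)
  show "charted (euclidean_manifold n)" by (rule charted_euclidean_manifold)
  fix c z assume c: "c \<in> atlas (euclidean_manifold n)" and z: "z \<in> chart_map c ` chart_dom c"
  have inv: "chart_inv c u = u" if "u \<in> topspace (Euc n)" for u
    using chart_inv_chart_map[OF charted_chart_on[OF charted_euclidean_manifold c], of u] c that
    by (auto simp: euclidean_manifold_def)
  have zE: "z \<in> topspace (Euc n)" and dim: "chart_dim c = n"
    using z c by (auto simp: euclidean_manifold_def)
  have "plot n (euclidean_manifold n) (\<lambda>u. u) z"
    using zE eventually_near_topspace by (auto simp: plot_euclidean_manifold_iff smooth_germ_coordinate)
  then have "plot n (euclidean_manifold n) (chart_inv c) z"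
    by (rule plot_cong) (use eventually_near_topspace in eventually_elim, simp add: inv)
  then show "plot (chart_dim c) (euclidean_manifold n) (chart_inv c) z" by (simp add: dim)
qed

section \<open>Pullback bundles\<close>

context
  fixes F :: "('b, 'e) vector_bundle" and N :: "'a manifold" and f :: "'a \<Rightarrow> 'b"
  assumes F: "charted_bundle F" and N: "compatible N" and f: "smooth_map N (base F) f"
begin

abbreviation (input) Pb :: "('a, 'a \<times> 'e) vector_bundle" where
  "Pb \<equiv> pullback_bundle N f F"

lemma charted_N: "charted N"
  by (rule compatible_imp_charted[OF N])

lemma plot_f: "plot m N a z \<Longrightarrow> plot m (base F) (\<lambda>u. f (a u)) z"
  by (rule plot_smooth_map[OF charted_N charted_base[OF F] f])

lemma openin_preimage_f: "openin (mtop (base F)) U \<Longrightarrow> openin (mtop N) {y \<in> points N. f y \<in> U}"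
  using f openin_continuous_map_preimage unfolding smooth_map_def by blast

lemma mtop_pullback:
  "mtop (total Pb) =
     subtopology (prod_topology (mtop N) (mtop (total F))) (pullback_points N f F)"
  by (simp add: pullback_bundle_def)

lemma points_pullback: "points (total Pb) = pullback_points N f F"
  by (auto simp: mtop_pullback pullback_points_def)

lemma continuous_map_pullback_fst: "continuous_map (mtop (total Pb)) (mtop N) fst"
  and continuous_map_pullback_snd: "continuous_map (mtop (total Pb)) (mtop (total F)) snd"
  unfolding mtop_pullback by (auto intro: continuous_map_from_subtopology continuous_map_fst continuous_map_snd)

definition pullback_chart ::
    "'a chart \<Rightarrow> 'b set \<Rightarrow> nat \<Rightarrow> ('e \<Rightarrow> 'b \<times> (nat \<Rightarrow> real)) \<Rightarrow> ('a \<times> 'e) chart" where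
  "pullback_chart c U k \<Phi> = Chart {(y, v) \<in> pullback_points N f F. y \<in> chart_dom c \<and> f y \<in> U}
     (chart_dim c + k) (\<lambda>(y, v). vec_append (chart_dim c) (chart_map c y) (snd (\<Phi> v)))"

lemma atlas_pullback:
  "e \<in> atlas (total Pb) \<longleftrightarrow>
     (\<exists>c U k \<Phi>. c \<in> atlas N \<and> local_trivialization F U k \<Phi> \<and> e = pullback_chart c U k \<Phi>)"
  by (auto simp: pullback_bundle_def pullback_chart_def)

text \<open>The inverse chart \<open>g\<close> is explicit: the first \<open>n\<close> coordinates
  give a point of \<open>N\<close>, the others are fibre coordinates that \<open>\<Gamma>\<close>
  realizes over its image under \<open>f\<close>. Both components are plots, and this already
  implies continuity of \<open>g\<close>.\<close>

lemma pullback_chart: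
  assumes c: "c \<in> atlas N" and triv: "local_trivialization F U k \<Phi>" and e_def: "e = pullback_chart c U k \<Phi>"
  shows chart_on_pullback: "chart_on (mtop (total Pb)) e"
    and "z \<in> chart_map e ` chart_dom e \<Longrightarrow> plot (chart_dim e) N (\<lambda>u. fst (chart_inv e u)) z"
    and "z \<in> chart_map e ` chart_dom e \<Longrightarrow> plot (chart_dim e) (total F) (\<lambda>u. snd (chart_inv e u)) z"
proof -
  obtain \<Gamma> where "trivialization_inverse F U k \<Phi> \<Gamma>"
    using ex_trivialization_inverse[OF F triv] by blast
  then interpret trivialization_inverse F U k \<Phi> \<Gamma> .
  note cont\<Phi> = continuous and \<Phi> = on_total and \<Gamma> = on_product and p\<Gamma> = plot_inverse
  note cc = charted_chart_on[OF charted_N c]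
  define n where "n = chart_dim c"
  define W where "W = {y \<in> points N. f y \<in> U}"
  have U: "openin (mtop (base F)) U" using triv unfolding local_trivialization_def by blast
  have W: "openin (mtop N) W" unfolding W_def by (rule openin_preimage_f[OF U])
  define T where "T = {a \<in> topspace (Euc (n + k)).
      vec_take n a \<in> chart_map c ` (chart_dom c \<inter> W) \<and> vec_drop n a \<in> topspace (Euc k)}"
  have T: "openin (Euc (n + k)) T"
    unfolding T_def n_def by (intro openin_vec_product chart_on_image_open[OF cc W] openin_topspace)
  define y where "y a = chart_inv c (vec_take n a)" for a
  define g where "g a = (y a, \<Gamma> (f (y a), vec_drop n a))" for a
  define D where "D = {(y, v) \<in> pullback_points N f F. y \<in> chart_dom c \<and> f y \<in> U}"
  define h where "h = (\<lambda>(y, v). vec_append n (chart_map c y) (snd (\<Phi> v)))"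
  have e: "e = Chart D (n + k) h" unfolding e_def pullback_chart_def D_def h_def n_def ..
  have D: "openin (mtop (total Pb)) D"
  proof -
    have "D = {x \<in> points (total Pb). fst x \<in> chart_dom c \<inter> W}"
      unfolding points_pullback D_def W_def by (auto simp: pullback_points_def)
    then show ?thesis
      using openin_continuous_map_preimage[OF continuous_map_pullback_fst openin_Int[OF chart_on_openin[OF cc] W]] by simp
  qed
  have vU: "v \<in> bundle_over F U" "proj F v = f x" "x \<in> chart_dom c" "f x \<in> U" "x \<in> W" if "(x, v) \<in> D" for x v
    using that by (auto simp: D_def bundle_over_def pullback_points_def W_def)
  have yT: "vec_take n a = chart_map c (y a) \<and> y a \<in> chart_dom c \<and> y a \<in> W" if "a \<in> T" for a
    using that by (auto simp: T_def y_def chart_inv_chart_map[OF cc])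
  have gT: "g a \<in> D \<and> h (g a) = a" if a: "a \<in> T" for a
  proof -
    have fU: "f (y a) \<in> U" "y a \<in> points N" using yT[OF a] by (auto simp: W_def)
    have "vec_drop n a \<in> topspace (Euc k)" using a by (simp add: T_def)
    note G = \<Gamma>[OF fU(1) this]
    have "g a \<in> D" using fU G yT[OF a] by (auto simp: D_def g_def pullback_points_def bundle_over_def)
    moreover have "h (g a) = vec_append n (vec_take n a) (vec_drop n a)"
      using G yT[OF a] by (simp add: h_def g_def)
    ultimately show ?thesis by (simp add: vec_append_take_drop)
  qed
  have hD: "h x \<in> T \<and> g (h x) = x" if x: "x \<in> D" for x
  proof -
    obtain x1 v where xv: "x = (x1, v)" by (cases x)
    note v = vU[OF x[unfolded xv]]
    have E: "chart_map c x1 \<in> topspace (Euc n)" using chart_map_topspace[OF cc v(3)] by (simp add: n_def)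
    have s: "snd (\<Phi> v) \<in> topspace (Euc k)" using \<Phi>[OF v(1)] by blast
    have "\<Gamma> (f x1, snd (\<Phi> v)) = v" using \<Phi>[OF v(1)] v(2) by metis
    then show ?thesis
      using E s v vec_append_in_Euclidean[OF s]
      by (auto simp: xv h_def T_def g_def y_def vec_take_append vec_drop_append chart_inv_chart_map[OF cc])
  qed
  have py: "plot (n + k) N y a" if a: "a \<in> T" for a
    unfolding y_def
  proof (rule plot_vec_take)
    show "plot n N (chart_inv c) (vec_take n a)"
      using N c yT[OF a] by (auto simp: compatible_def n_def)
    show "a \<in> topspace (Euc (n + k))" using a by (simp add: T_def)
  qed
  have pv: "plot (n + k) (total F) (\<lambda>a. \<Gamma> (f (y a), vec_drop n a)) a" if a: "a \<in> T" for a
  proof (rule p\<Gamma>[OF plot_f[OF py[OF a]]])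
    show "f (y a) \<in> U" using yT[OF a] by (simp add: W_def)
    show "plot (n + k) (euclidean_manifold k) (vec_drop n) a"
      using a by (simp add: plot_euclidean_manifold_iff T_def eventually_vec_drop smooth_germ_vec_drop)
  qed
  have chart: "chart_on (mtop (total Pb)) e"
    unfolding e
  proof (rule chart_onI[where T=T and g=g])
    have fst: "continuous_map (subtopology (mtop (total Pb)) D) (subtopology (mtop N) (chart_dom c)) fst"
      and snd: "continuous_map (subtopology (mtop (total Pb)) D)
          (subtopology (mtop (total F)) (bundle_over F U)) snd"
      using vU continuous_map_pullback_fst continuous_map_pullback_snd
      by (auto simp: continuous_map_in_subtopology intro: continuous_map_from_subtopology)
    show "continuous_map (subtopology (mtop (total Pb)) D) (Euc (n + k)) h"
      using continuous_map_vec_append[OF continuous_map_compose[OF fst chart_map_continuous[OF cc]]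
          continuous_map_compose[OF snd cont\<Phi>]]
      by (simp add: o_def h_def n_def case_prod_unfold)
    have "continuous_map (subtopology (Euc (n + k)) T) (prod_topology (mtop N) (mtop (total F))) g"
      using continuous_map_plots[OF charted_N T py] continuous_map_plots[OF charted_total[OF F] T pv]
      by (simp add: continuous_map_pairwise o_def g_def)
    moreover have "g a \<in> pullback_points N f F" if "a \<in> T" for a
      using gT[OF that] by (auto simp: D_def)
    ultimately show "continuous_map (subtopology (Euc (n + k)) T) (mtop (total Pb)) g"
      unfolding mtop_pullback by (auto simp: continuous_map_in_subtopology)
  qed (use D T gT hD in auto)
  then show "chart_on (mtop (total Pb)) e" .
  have im: "chart_map e ` chart_dom e = T" using gT hD by (force simp: e image_iff)
  have inv: "g u = chart_inv e u" if "u \<in> T" for u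
    using chart_inv_chart_map[OF chart, of "g u"] gT[OF that] by (simp add: e)
  have "plot (n + k) N (\<lambda>u. fst (chart_inv e u)) z \<and> plot (n + k) (total F) (\<lambda>u. snd (chart_inv e u)) z"
    if "z \<in> T"
  proof -
    have "\<forall>\<^sub>F u in near (n + k) z. chart_inv e u = g u"
      using eventually_near_in_open[OF T that] by eventually_elim (simp add: inv)
    then show ?thesis
      by (intro conjI plot_cong[OF py[OF that]] plot_cong[OF pv[OF that]])
         (auto elim!: eventually_mono simp: g_def)
  qed
  then show "z \<in> chart_map e ` chart_dom e \<Longrightarrow> plot (chart_dim e) N (\<lambda>u. fst (chart_inv e u)) z"
    "z \<in> chart_map e ` chart_dom e \<Longrightarrow> plot (chart_dim e) (total F) (\<lambda>u. snd (chart_inv e u)) z"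
    unfolding im by (auto simp: e)
qed

lemma charted_pullback: "charted (total Pb)"
  unfolding charted_def
proof (intro conjI ballI)
  show "chart_on (mtop (total Pb)) e" if "e \<in> atlas (total Pb)" for e
    using that chart_on_pullback unfolding atlas_pullback by blast
  show "\<Union>(chart_dom ` atlas (total Pb)) = points (total Pb)"
    unfolding points_pullback
  proof (intro equalityI subsetI)
    fix x assume "x \<in> \<Union>(chart_dom ` atlas (total Pb))"
    then show "x \<in> pullback_points N f F" by (auto simp: atlas_pullback pullback_chart_def)
  next
    fix x assume x: "x \<in> pullback_points N f F"
    obtain y v where yv: "x = (y, v)" "y \<in> points N" "f y = proj F v" "v \<in> points (total F)"
      using x by (auto simp: pullback_points_def)
    obtain c where c: "c \<in> atlas N" "y \<in> chart_dom c" using charted_N yv(2) by (rule charted_chartE)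
    obtain U k \<Phi> where t: "f y \<in> U" "local_trivialization F U k \<Phi>"
      using ex_local_trivialization[OF F smooth_map_points[OF f yv(2)]] by blast
    have "x \<in> chart_dom (pullback_chart c U k \<Phi>)"
      using x c t by (simp add: pullback_chart_def yv(1))
    moreover have "pullback_chart c U k \<Phi> \<in> atlas (total Pb)"
      using c t atlas_pullback by blast
    ultimately show "x \<in> \<Union>(chart_dom ` atlas (total Pb))" by blast
  qed
qed

lemma smooth_map_pullback_fst: "smooth_map (total Pb) N fst"
  by (rule smooth_mapI_plots[OF charted_pullback charted_N]) (auto simp: atlas_pullback intro: pullback_chart(2))

lemma smooth_map_pullback_snd: "smooth_map (total Pb) (total F) snd"
  by (rule smooth_mapI_plots[OF charted_pullback charted_total[OF F]])
     (auto simp: atlas_pullback intro: pullback_chart(3))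

text \<open>The universal property of the fibre product for plots. Together with the two smooth
  projections it lets smoothness into a pullback be checked componentwise.\<close>

lemma plot_pullbackI:
  assumes a: "plot m N (\<lambda>u. fst (\<psi> u)) z" and b: "plot m (total F) (\<lambda>u. snd (\<psi> u)) z"
    and ev: "\<forall>\<^sub>F u in near m z. f (fst (\<psi> u)) = proj F (snd (\<psi> u))"
  shows "plot m (total Pb) \<psi> z"
proof -
  have evp: "\<forall>\<^sub>F u in near m z. \<psi> u \<in> pullback_points N f F"
    using plot_eventually_in_open[OF charted_N a openin_topspace plot_points[OF a]]
      plot_eventually_in_open[OF charted_total[OF F] b openin_topspace plot_points[OF b]] ev
    by eventually_elim (auto simp: pullback_points_def case_prod_unfold)
  show ?thesis
    unfolding plot_def points_pullback
  proof (intro conjI ballI impI allI)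
    show "\<psi> z \<in> pullback_points N f F" by (rule eventually_near_self[OF evp plot_topspace[OF a]])
    fix e assume e: "e \<in> atlas (total Pb)" "\<psi> z \<in> chart_dom e"
    then obtain c U k \<Phi> where c: "c \<in> atlas N" and triv: "local_trivialization F U k \<Phi>"
      and e_def: "e = pullback_chart c U k \<Phi>" unfolding atlas_pullback by blast
    have U: "openin (mtop (base F)) U" using triv unfolding local_trivialization_def by blast
    have z: "fst (\<psi> z) \<in> chart_dom c" "f (fst (\<psi> z)) \<in> U" "proj F (snd (\<psi> z)) \<in> U"
      using e(2) by (auto simp: e_def pullback_chart_def pullback_points_def)
    show "\<forall>\<^sub>F u in near m z. \<psi> u \<in> chart_dom e"
      using evp plot_eventually_chart[OF a c z(1)]
        plot_eventually_in_open[OF charted_base[OF F] plot_f[OF a] U z(2)]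
      by eventually_elim (auto simp: e_def pullback_chart_def)
    have s: "plot m (euclidean_manifold k) (\<lambda>u. snd (\<Phi> (snd (\<psi> u)))) z"
      using ex_trivialization_inverse[OF F triv] trivialization_inverse.plot_coordinates b z(3) by blast
    fix j assume j: "j < chart_dim e"
    show "smooth_germ m (\<lambda>u. chart_map e (\<psi> u) j) z"
    proof (cases "j < chart_dim c")
      case True
      with plot_coordinate[OF a c z(1) True] show ?thesis
        by (simp add: e_def pullback_chart_def case_prod_unfold vec_append_def)
    next
      case False
      then have "j - chart_dim c < k" using j by (simp add: e_def pullback_chart_def)
      with s have "smooth_germ m (\<lambda>u. snd (\<Phi> (snd (\<psi> u))) (j - chart_dim c)) z"
        by (simp add: plot_euclidean_manifold_iff)
      with False show ?thesis
        by (simp add: e_def pullback_chart_def case_prod_unfold vec_append_def)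
    qed
  qed (rule plot_topspace[OF a])
qed

text \<open>Both components of an inverse chart are plots and satisfy the fibre product equation
  near \<open>z\<close>, so the universal property applies.\<close>

lemma compatible_pullback: "compatible (total Pb)"
  unfolding compatible_def
proof (intro conjI ballI charted_pullback)
  fix e z assume e: "e \<in> atlas (total Pb)" and z: "z \<in> chart_map e ` chart_dom e"
  then obtain c U k \<Phi> where *: "c \<in> atlas N" "local_trivialization F U k \<Phi>" "e = pullback_chart c U k \<Phi>"
    unfolding atlas_pullback by blast
  note ee = charted_chart_on[OF charted_pullback e]
  show "plot (chart_dim e) (total Pb) (chart_inv e) z"
  proof (rule plot_pullbackI[OF pullback_chart(2,3)[OF * z]])
    show "\<forall>\<^sub>F u in near (chart_dim e) z. f (fst (chart_inv e u)) = proj F (snd (chart_inv e u))"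
      using eventually_near_in_open[OF chart_on_image_openin[OF ee] z]
    proof eventually_elim
      case (elim u)
      then have "chart_inv e u \<in> chart_dom e" by (auto simp: chart_inv_chart_map[OF ee])
      then show ?case using chart_on_dom_subset[OF ee] points_pullback by (auto simp: pullback_points_def)
    qed
  qed
qed

text \<open>Makes iteration possible, since a second pullback builds its charts from local
  trivializations of the first. These keep the point of \<open>N\<close> and take the fibre
  coordinates of \<open>F\<close>.\<close>

lemma charted_bundle_pullback: "charted_bundle Pb"
proof -
  let ?X = "Pb"
  have base: "base ?X = N" and proj: "proj ?X = fst" by (auto simp: pullback_bundle_def)
  have "\<exists>U k \<Phi>. x \<in> U \<and> local_trivialization ?X U k \<Phi>" if x: "x \<in> points N" for x
  proof -
    obtain U k \<Phi> where U: "f x \<in> U" and triv: "local_trivialization F U k \<Phi>"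
      using ex_local_trivialization[OF F smooth_map_points[OF f x]] by blast
    obtain \<Gamma> where "trivialization_inverse F U k \<Phi> \<Gamma>"
      using ex_trivialization_inverse[OF F triv] by blast
    then interpret trivialization_inverse F U k \<Phi> \<Gamma> .
    note \<Phi> = on_total and \<Gamma> = on_product and p\<Phi> = plot_coordinates and p\<Gamma> = plot_inverse
    define W where "W = {y \<in> points N. f y \<in> U}"
    have oU: "openin (mtop (base F)) U"
      and add: "\<And>x v w. x \<in> U \<Longrightarrow> v \<in> fibre F x \<Longrightarrow> w \<in> fibre F x \<Longrightarrow>
          snd (\<Phi> (fib_add F v w)) = (\<lambda>i. snd (\<Phi> v) i + snd (\<Phi> w) i)"
      and scale: "\<And>x a v. x \<in> U \<Longrightarrow> v \<in> fibre F x \<Longrightarrow> snd (\<Phi> (fib_scale F a v)) = (\<lambda>i. a * snd (\<Phi> v) i)"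
      using triv unfolding local_trivialization_def by auto
    have W: "openin (mtop N) W" unfolding W_def by (rule openin_preimage_f[OF oU])
    let ?B = "bundle_over ?X W"
    have B: "y \<in> W \<and> f y \<in> U \<and> f y = proj F v \<and> v \<in> bundle_over F U \<and> v \<in> fibre F (f y)" if "(y, v) \<in> ?B" for y v
      using that by (auto simp: bundle_over_def points_pullback proj W_def pullback_points_def)
    have oB: "openin (mtop (total ?X)) ?B"
    proof -
      have "?B = {x \<in> points (total ?X). fst x \<in> W}" by (auto simp: bundle_over_def proj)
      then show ?thesis using openin_continuous_map_preimage[OF continuous_map_pullback_fst W] by simp
    qed
    let ?\<Phi> = "\<lambda>x. (fst x, snd (\<Phi> (snd x)))" and ?\<Gamma> = "\<lambda>p. (fst p, \<Gamma> (f (fst p), snd p))"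
    let ?T = "open_submanifold (total ?X) ?B"
    let ?P = "product_manifold (open_submanifold N W) (euclidean_manifold k)"
    have cW: "compatible (open_submanifold N W)" by (rule compatible_open_submanifold[OF N W])
    have cT: "compatible ?T" by (rule compatible_open_submanifold[OF compatible_pullback oB])
    have cP: "compatible ?P" by (rule compatible_product_manifold[OF cW compatible_euclidean_manifold])
    note chW = compatible_imp_charted[OF cW]
    have "smooth_map ?T ?P ?\<Phi>"
    proof (rule smooth_mapI_compatible[OF cT compatible_imp_charted[OF cP]])
      fix m \<psi> z assume "plot m ?T \<psi> z"
      then have p: "plot m (total ?X) \<psi> z" and z: "\<psi> z \<in> ?B"
        by (auto simp: plot_open_submanifold_iff[OF charted_pullback oB])
      have a: "plot m N (\<lambda>u. fst (\<psi> u)) z"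
        by (rule plot_smooth_map[OF charted_pullback charted_N smooth_map_pullback_fst p])
      have b: "plot m (total F) (\<lambda>u. snd (\<psi> u)) z"
        by (rule plot_smooth_map[OF charted_pullback charted_total[OF F] smooth_map_pullback_snd p])
      have "fst (\<psi> z) \<in> W" "proj F (snd (\<psi> z)) \<in> U" using B[of "fst (\<psi> z)" "snd (\<psi> z)"] z by auto
      with a p\<Phi>[OF b] show "plot m ?P (\<lambda>u. ?\<Phi> (\<psi> u)) z"
        by (simp add: plot_product_iff[OF chW charted_euclidean_manifold] plot_open_submanifold_iff[OF charted_N W])
    qed
    moreover have "smooth_map ?P ?T ?\<Gamma>"
    proof (rule smooth_mapI_compatible[OF cP compatible_imp_charted[OF cT]])
      fix m \<psi> z assume "plot m ?P \<psi> z"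
      then have a: "plot m N (\<lambda>u. fst (\<psi> u)) z" "fst (\<psi> z) \<in> W"
        and w: "plot m (euclidean_manifold k) (\<lambda>u. snd (\<psi> u)) z"
        by (auto simp: plot_product_iff[OF chW charted_euclidean_manifold] plot_open_submanifold_iff[OF charted_N W])
      have fU: "f (fst (\<psi> z)) \<in> U" using a(2) by (simp add: W_def)
      have b: "plot m (total F) (\<lambda>u. \<Gamma> (f (fst (\<psi> u)), snd (\<psi> u))) z"
        by (rule p\<Gamma>[OF plot_f[OF a(1)] fU w])
      have "\<forall>\<^sub>F u in near m z. f (fst (\<psi> u)) = proj F (\<Gamma> (f (fst (\<psi> u)), snd (\<psi> u)))"
        using plot_eventually_in_open[OF charted_base[OF F] plot_f[OF a(1)] oU fU]
          conjunct1[OF conjunct2[OF w[unfolded plot_euclidean_manifold_iff]]]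
        by eventually_elim (use \<Gamma> in \<open>auto simp: bundle_over_def\<close>)
      then have p: "plot m (total ?X) (\<lambda>u. ?\<Gamma> (\<psi> u)) z"
        by (intro plot_pullbackI) (use a b in auto)
      moreover have "?\<Gamma> (\<psi> z) \<in> ?B"
        using plot_points[OF p] a(2) by (simp add: bundle_over_def proj)
      ultimately show "plot m ?T (\<lambda>u. ?\<Gamma> (\<psi> u)) z"
        by (simp add: plot_open_submanifold_iff[OF charted_pullback oB])
    qed
    moreover have "?\<Gamma> (?\<Phi> p) = p" if p: "p \<in> points ?T" for p
    proof -
      obtain y v where yv: "p = (y, v)" by (cases p)
      then have "(y, v) \<in> ?B" using p by (simp add: open_submanifold_def)
      from B[OF this] \<Phi>[of v] yv show ?thesis by (metis fst_conv snd_conv)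
    qed
    moreover have "?\<Phi> (?\<Gamma> p) = p" if p: "p \<in> points ?P" for p
    proof -
      have "fst p \<in> W" "snd p \<in> topspace (Euc k)"
        using p by (auto simp: open_submanifold_def euclidean_manifold_def)
      with \<Gamma>[of "f (fst p)" "snd p"] show ?thesis by (simp add: W_def prod_eq_iff)
    qed
    ultimately have "diffeomorphism ?T ?P ?\<Phi>" unfolding diffeomorphism_def by blast
    then have "local_trivialization ?X W k ?\<Phi>"
      unfolding local_trivialization_def base
    proof (intro conjI ballI allI W)
      show "fst (?\<Phi> v) = proj ?X v" for v by (simp add: proj)
      fix y v assume y: "y \<in> W" and v: "v \<in> fibre ?X y"
      have v': "snd v \<in> fibre F (f y)" "f y \<in> U"
        using y v by (auto simp: bundle_over_def points_pullback proj pullback_points_def W_def)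
      show "snd (?\<Phi> (fib_add ?X v w)) = (\<lambda>i. snd (?\<Phi> v) i + snd (?\<Phi> w) i)" if w: "w \<in> fibre ?X y" for w
      proof -
        have "snd w \<in> fibre F (f y)"
          using w by (auto simp: bundle_over_def points_pullback proj pullback_points_def)
        from add[OF v'(2,1) this] show ?thesis
          by (simp add: pullback_bundle_def case_prod_unfold)
      qed
      show "snd (?\<Phi> (fib_scale ?X a v)) = (\<lambda>i. a * snd (?\<Phi> v) i)" for a
        using scale[OF v'(2,1)] by (simp add: pullback_bundle_def case_prod_unfold)
    qed
    moreover have "x \<in> W" using x U by (simp add: W_def)
    ultimately show ?thesis by blast
  qed
  then show ?thesis
    unfolding charted_bundle_def base proj
    using charted_N charted_pullback smooth_map_pullback_fst by blast
qed

end

section \<open>The isomorphism with the iterated pullback\<close>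

theorem corollary4p1:
  fixes M :: "'a manifold" and I :: "real set" and t0 :: real
    and IM :: "(real \<times> 'a) manifold" and \<iota> :: "'a \<Rightarrow> real \<times> 'a"
    and F :: "(real \<times> 'a, 'e) vector_bundle"
  defines "IM \<equiv> product_manifold (open_submanifold real_line I) M"
    and "\<iota> \<equiv> (\<lambda>x. (t0, x))"
  assumes "smooth_manifold M"
    and "open I" and "is_interval I" and "t0 \<in> I"
    and "smooth_vector_bundle F" and "base F = IM"
  shows "bundle_isomorphic F (pullback_bundle IM snd (pullback_bundle M \<iota> F))"
proof -
  interpret interval_bundle M I t0 F
    using assms(3-8) unfolding IM_def by unfold_locales
  obtain P R where fam: "transport_family F t0 (points (base F)) (\<lambda>y. y) P R"
    by (rule global_family)
  note D = transport_familyD[OF fam]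
  note cF = charted_bundleI[OF F] and base = assms(8)
  have smB: "smooth_manifold IM" and smT: "smooth_manifold (total F)"
    using F base unfolding smooth_vector_bundle_def by auto
  have cM: "compatible M" by (rule smooth_manifold_imp_compatible[OF M])
  have cB: "compatible IM" by (rule smooth_manifold_imp_compatible[OF smB])
  have cT: "compatible (total F)" by (rule smooth_manifold_imp_compatible[OF smT])
  have \<iota>: "smooth_map M (base F) \<iota>"
  proof (rule smooth_mapI_compatible[OF cM charted_base[OF cF]])
    show "plot m (base F) (\<lambda>u. \<iota> (\<psi> u)) z" if "plot m M \<psi> z" for m \<psi> z
      using that t0_I plot_topspace[OF that] by (simp add: plot_base_iff \<iota>_def smooth_germ_const)
  qed
  let ?F' = "pullback_bundle M \<iota> F"
  let ?G = "pullback_bundle IM snd ?F'"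
  have baseF': "base ?F' = M" and projF': "proj ?F' = fst" and projG: "proj ?G = fst"
    by (auto simp: pullback_bundle_def)
  have cF': "charted_bundle ?F'" by (rule charted_bundle_pullback[OF cF cM \<iota>])
  have snd: "smooth_map IM (base ?F') snd"
    unfolding baseF'
    by (rule smooth_mapI_compatible[OF cB charted_M]) (simp add: plot_base_iff flip: base)
  have cG: "compatible (total ?G)" by (rule compatible_pullback[OF cF' cB snd])
  note chG = compatible_imp_charted[OF cG] and chF' = charted_total[OF cF'] and chT = charted_total[OF cF]
    and chB = charted_base[OF cF]
  note pts = points_pullback[OF cF cM \<iota>] and ptsG = points_pullback[OF cF' cB snd]
  have sndM: "snd y \<in> points M" if "y \<in> points IM" for y
    using that by (auto simp: points_base simp flip: base)
  \<comment> \<open>Points of the iterated pullback are nested pairs whose middle entry is forced by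
    the first. What remains is a base point \<open>y\<close> and a vector over time
    \<open>t0\<close>.\<close>
  have memG: "(y, x, v) \<in> points (total ?G) \<longleftrightarrow> y \<in> points IM \<and> snd y = x \<and> v \<in> fibre F (t0, x)" for y x v
    unfolding ptsG pullback_points_def pts projF' by (auto simp: \<iota>_def bundle_over_def sndM)
  \<comment> \<open>The vector is carried back to time \<open>t0\<close>, and its base point is
    recorded because \<open>R\<close> forgets the time; \<open>\<Theta>\<close> carries it forward
    again.\<close>
  define \<Psi> where "\<Psi> v = (proj F v, snd (proj F v), R (proj F v) v)" for v
  define \<Theta> where "\<Theta> p = P (fst p) (snd (snd p))" for p :: "(real \<times> 'a) \<times> ('a \<times> 'e)"
  have v: "proj F v \<in> points (base F)" "v \<in> fibre F (proj F v)" if "v \<in> points (total F)" for v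
    using that proj_points[OF cF] by (auto simp: bundle_over_def)
  have Rv: "R (proj F v) v \<in> fibre F (t0, snd (proj F v))" "P (proj F v) (R (proj F v) v) = v"
    if "v \<in> points (total F)" for v
    using D(8,9)[OF v[OF that]] by auto
  have "smooth_map (total F) (total ?G) \<Psi>"
  proof (rule smooth_mapI_compatible[OF cT chG])
    fix m b z assume b: "plot m (total F) b z"
    have y: "plot m (base F) (\<lambda>u. proj F (b u)) z" by (rule plot_proj[OF cF b])
    have ptsb: "\<forall>\<^sub>F u in near m z. b u \<in> points (total F)"
      by (rule plot_eventually_in_open[OF chT b openin_topspace plot_points[OF b]])
    have Rb: "plot m (total F) (\<lambda>u. R (proj F (b u)) (b u)) z"
      by (rule D(11)[OF y b plot_points[OF y]]) simp
    have "plot m (total ?F') (\<lambda>u. (snd (proj F (b u)), R (proj F (b u)) (b u))) z"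
    proof (rule plot_pullbackI[OF cF cM \<iota>])
      show "\<forall>\<^sub>F u in near m z. \<iota> (fst (snd (proj F (b u)), R (proj F (b u)) (b u))) =
          proj F (snd (snd (proj F (b u)), R (proj F (b u)) (b u)))"
        using ptsb by eventually_elim (simp add: \<iota>_def fibreD(1)[OF Rv(1)])
    qed (use y Rb in \<open>auto simp: plot_base_iff\<close>)
    then show "plot m (total ?G) (\<lambda>u. \<Psi> (b u)) z"
      by (intro plot_pullbackI[OF cF' cB snd]) (use y in \<open>auto simp: \<Psi>_def base projF'\<close>)
  qed
  moreover have "smooth_map (total ?G) (total F) \<Theta>"
  proof (rule smooth_mapI_compatible[OF cG chT])
    fix m \<psi> z assume p: "plot m (total ?G) \<psi> z"
    have y: "plot m (base F) (\<lambda>u. fst (\<psi> u)) z"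
      unfolding base
      by (rule plot_smooth_map[OF chG compatible_imp_charted[OF cB] smooth_map_pullback_fst[OF cF' cB snd] p])
    have "plot m (total ?F') (\<lambda>u. snd (\<psi> u)) z"
      by (rule plot_smooth_map[OF chG chF' smooth_map_pullback_snd[OF cF' cB snd] p])
    then have b: "plot m (total F) (\<lambda>u. snd (snd (\<psi> u))) z"
      by (rule plot_smooth_map[OF chF' chT smooth_map_pullback_snd[OF cF cM \<iota>]])
    have "\<forall>\<^sub>F u in near m z. \<psi> u \<in> points (total ?G)"
      by (rule plot_eventually_in_open[OF chG p openin_topspace plot_points[OF p]])
    then have "\<forall>\<^sub>F u in near m z. proj F (snd (snd (\<psi> u))) = (t0, snd (fst (\<psi> u)))"
    proof eventually_elim
      case (elim u)
      then have "(fst (\<psi> u), fst (snd (\<psi> u)), snd (snd (\<psi> u))) \<in> points (total ?G)" by simp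
      then show ?case unfolding memG by (auto simp: bundle_over_def)
    qed
    then show "plot m (total F) (\<lambda>u. \<Theta> (\<psi> u)) z"
      unfolding \<Theta>_def by (rule D(10)[OF y b plot_points[OF y]])
  qed
  moreover have "\<Theta> (\<Psi> v) = v" if "v \<in> points (total F)" for v
    using Rv(2)[OF that] by (simp add: \<Theta>_def \<Psi>_def)
  moreover have "\<Psi> (\<Theta> p) = p" if p: "p \<in> points (total ?G)" for p
  proof -
    obtain y x v where p_def: "p = (y, x, v)" by (cases p)
    have *: "y \<in> points (base F)" "snd y = x" "v \<in> fibre F (t0, snd y)"
      using p unfolding p_def memG base by auto
    have "proj F (P y v) = y" using fibreD(1)[OF D(4)[OF *(1,3)]] .
    then show ?thesis using D(5)[OF *(1,3)] *(2) by (simp add: \<Psi>_def \<Theta>_def p_def)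
  qed
  ultimately have diffeo: "diffeomorphism (total F) (total ?G) \<Psi>"
    unfolding diffeomorphism_def by blast
  \<comment> \<open>Additivity and homogeneity of \<open>\<Psi>\<close> concern \<open>R\<close>;
    they are transferred from \<open>P\<close>, which \<open>R\<close> inverts.\<close>
  have R_eqI: "R y w = u" if "y \<in> points (base F)" "u \<in> fibre F (t0, snd y)" "P y u = w" for y u w
    using D(5)[OF that(1,2)] that(3) by simp
  have "bundle_isomorphism F ?G \<Psi>"
    unfolding bundle_isomorphism_def
  proof (intro conjI ballI allI diffeo)
    show "proj ?G (\<Psi> v) = proj F v" for v by (simp add: projG \<Psi>_def)
    fix y v assume y: "y \<in> points (base F)" and v: "v \<in> fibre F y"
    have pv: "proj F v = y" by (rule fibreD(1)[OF v])
    have Rv: "R y v \<in> fibre F (t0, snd y)" "P y (R y v) = v" using D(8,9)[OF y v] by auto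
    show "\<Psi> (fib_add F v w) = fib_add ?G (\<Psi> v) (\<Psi> w)" if w: "w \<in> fibre F y" for w
    proof -
      have pw: "proj F w = y" by (rule fibreD(1)[OF w])
      have Rw: "R y w \<in> fibre F (t0, snd y)" "P y (R y w) = w" using D(8,9)[OF y w] by auto
      have "R y (fib_add F v w) = fib_add F (R y v) (R y w)"
        by (rule R_eqI[OF y fibre_add_closed[OF F Rv(1) Rw(1)]]) (simp add: D(6)[OF y Rv(1) Rw(1)] Rv Rw)
      moreover have "proj F (fib_add F v w) = y" by (rule fibreD(1)[OF fibre_add_closed[OF F v w]])
      ultimately show ?thesis by (simp add: \<Psi>_def pv pw pullback_bundle_def)
    qed
    show "\<Psi> (fib_scale F a v) = fib_scale ?G a (\<Psi> v)" for a
    proof -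
      have "R y (fib_scale F a v) = fib_scale F a (R y v)"
        by (rule R_eqI[OF y fibre_scale_closed[OF F Rv(1)]]) (simp add: D(7)[OF y Rv(1)] Rv)
      moreover have "proj F (fib_scale F a v) = y" by (rule fibreD(1)[OF fibre_scale_closed[OF F v]])
      ultimately show ?thesis by (simp add: \<Psi>_def pv pullback_bundle_def)
    qed
  qed
  moreover have "base F = base ?G" by (simp add: pullback_bundle_def base)
  ultimately show ?thesis unfolding bundle_isomorphic_def by blast
qed

end
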